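(* Let $G$ be a finite group, let $K$ be a simplicial $G$-complex with $m$ vertices, and let $(X,A)$ be a pair of connected based CW-complexes. Then there is a homotopy $G$-decomposition $$\theta\colon\Sigma^2(X,A)^K\simeq\Sigma^2\bigvee_{J\subseteq[m]}(X,A)^{\wedge K_J},$$ that is, a homotopy equivalence $\theta$ such that $g\circ\theta\simeq\theta\circ g$ for every $g\in G$, where the $G$-action on $\Sigma^2(X,A)^K$ is induced by the $G$-action on $X^m$, and the $G$-action on the right-hand side is induced by the coordinate permutations $(X,A)^{\wedge K_J}\to(X,A)^{\wedge K_{g\cdot J}}$.
   Context: $[m]=\{1,\dots,m\}$; $\Sigma^2$ is double suspension, and groups act trivially on suspension coordinates. A simplicial $G$-complex is a simplicial complex $K$ on vertex set $[m]$ with a $G$-action on $[m]$ such that the induced action on subsets of $[m]$ preserves $K$. For $J\subseteq[m]$, $K_J=\{\sigma\cap J\mid\sigma\in K\}$ is the full subcomplex on $J$. Polyhedral product: $(X,A)^K=\bigcup_{I\in K}(X,A)^I$ with $(X,A)^I=\{(x_1,\dots,x_m)\in X^m\mid x_j\in A\text{ for }j\notin I\}$. Polyhedral smash product: for non-empty $J\subseteq[m]$, $(X,A)^{\wedge K_J}=\bigcup_{\sigma\in K_J}(X,A)^{\wedge\sigma}$, where $(X,A)^{\wedge\sigma}$ is the subspace of $X^{\wedge J}$ (smash product of copies of $X$ indexed by $J$) of points whose $j$-th coordinate lies in $A$ for $j\in J\setminus\sigma$. The wedge runs over non-empty $J\subseteq[m]$. $G$ acts on $X^m$, and hence on $(X,A)^K$,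 by $(g\cdot x)_i=x_{g^{-1}\cdot i}$. On the wedge, $g$ maps $(X,A)^{\wedge K_J}$ to $(X,A)^{\wedge K_{g\cdot J}}$ by sending the coordinate indexed by $i\in J$ to the coordinate indexed by $g\cdot i\in g\cdot J$. *)

theory Defs
  imports "HOL-Analysis.Analysis" "HOL-Algebra.Group_Action"
begin

section \<open>Final topologies, quotients and based spaces\<close>

definition final_topology ::
  "'b set \<Rightarrow> 'i set \<Rightarrow> ('i \<Rightarrow> 'a topology) \<Rightarrow> ('i \<Rightarrow> 'a \<Rightarrow> 'b) \<Rightarrow> 'b topology"
  where "final_topology S I X f =
    topology (\<lambda>U. U \<subseteq> S \<and> (\<forall>i\<in>I. openin (X i) {x \<in> topspace (X i). f i x \<in> U}))"

lemma openin_final_topology: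
  "openin (final_topology S I X f) U \<longleftrightarrow>
     U \<subseteq> S \<and> (\<forall>i\<in>I. openin (X i) {x \<in> topspace (X i). f i x \<in> U})"
proof -
  have "istopology (\<lambda>U. U \<subseteq> S \<and> (\<forall>i\<in>I. openin (X i) {x \<in> topspace (X i). f i x \<in> U}))"
    unfolding istopology_def
  proof (intro conjI allI impI ballI; (elim conjE)?)
    fix U V i
    assume i: "i \<in> I"
      and "\<forall>i\<in>I. openin (X i) {x \<in> topspace (X i). f i x \<in> U}"
      and "\<forall>i\<in>I. openin (X i) {x \<in> topspace (X i). f i x \<in> V}"
    then have "openin (X i) ({x \<in> topspace (X i). f i x \<in> U} \<inter> {x \<in> topspace (X i). f i x \<in> V})"
      by blast
    moreover have "{x \<in> topspace (X i). f i x \<in> U} \<inter> {x \<in> topspace (X i). f i x \<in> V}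
        = {x \<in> topspace (X i). f i x \<in> U \<inter> V}"
      by blast
    ultimately show "openin (X i) {x \<in> topspace (X i). f i x \<in> U \<inter> V}"
      by simp
  next
    fix \<K> i
    assume i: "i \<in> I"
      and "\<forall>U\<in>\<K>. U \<subseteq> S \<and> (\<forall>i\<in>I. openin (X i) {x \<in> topspace (X i). f i x \<in> U})"
    then have "openin (X i) (\<Union>U\<in>\<K>. {x \<in> topspace (X i). f i x \<in> U})"
      by blast
    moreover have "(\<Union>U\<in>\<K>. {x \<in> topspace (X i). f i x \<in> U})
        = {x \<in> topspace (X i). f i x \<in> \<Union>\<K>}"
      by blast
    ultimately show "openin (X i) {x \<in> topspace (X i). f i x \<in> \<Union>\<K>}"
      by simp
  qed blast+
  then show ?thesis
    by (simp add: final_topology_def)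
qed

lemma topspace_final_topology:
  assumes "\<And>i x. \<lbrakk>i \<in> I; x \<in> topspace (X i)\<rbrakk> \<Longrightarrow> f i x \<in> S"
  shows "topspace (final_topology S I X f) = S"
proof
  show "topspace (final_topology S I X f) \<subseteq> S"
    using openin_final_topology openin_topspace by metis
  have "{x \<in> topspace (X i). f i x \<in> S} = topspace (X i)" if "i \<in> I" for i
    using assms that by blast
  then have "openin (final_topology S I X f) S"
    by (simp add: openin_final_topology)
  then show "S \<subseteq> topspace (final_topology S I X f)"
    by (rule openin_subset)
qed

definition quotient_topology :: "'a topology \<Rightarrow> ('a \<Rightarrow> 'b) \<Rightarrow> 'b topology"
  where "quotient_topology X q = final_topology (q ` topspace X) {()} (\<lambda>_. X) (\<lambda>_. q)"

lemma quotient_map_quotient_topology: "quotient_map X (quotient_topology X q) q"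
  by (auto simp: quotient_map_def quotient_topology_def openin_final_topology
      topspace_final_topology)

text \<open>
  A based space is a topology together with a point of it.  The quotient \<open>X/W\<close> of \<open>X\<close> by a
  subset \<open>W\<close> is carried by a set of representatives: \<open>collapse_map W b\<close>, with \<open>b \<in> W\<close>, sends all
  of \<open>W\<close> to \<open>b\<close> and fixes every other point, and \<open>X/W\<close> has the quotient topology of this map.
  A map between such quotients is given on representatives and followed by the collapse map of
  the target.
\<close>

type_synonym 'a based = "'a topology \<times> 'a"

definition collapse_map :: "'a set \<Rightarrow> 'a \<Rightarrow> 'a \<Rightarrow> 'a"
  where "collapse_map W b x = (if x \<in> W then b else x)"

definition collapse :: "'a topology \<Rightarrow> 'a set \<Rightarrow> 'a \<Rightarrow> 'a based"
  where "collapse X W b = (quotient_topology X (collapse_map W b), b)"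

definition based_map :: "'a based \<Rightarrow> 'b based \<Rightarrow> ('a \<Rightarrow> 'b) \<Rightarrow> bool"
  where "based_map P Q f \<longleftrightarrow> continuous_map (fst P) (fst Q) f \<and> f (snd P) = snd Q"

definition based_homotopic :: "'a based \<Rightarrow> 'b based \<Rightarrow> ('a \<Rightarrow> 'b) \<Rightarrow> ('a \<Rightarrow> 'b) \<Rightarrow> bool"
  where "based_homotopic P Q = homotopic_with (\<lambda>h. h (snd P) = snd Q) (fst P) (fst Q)"

definition based_homotopy_equivalence :: "'a based \<Rightarrow> 'b based \<Rightarrow> ('a \<Rightarrow> 'b) \<Rightarrow> bool"
  where "based_homotopy_equivalence P Q f \<longleftrightarrow>
    based_map P Q f \<and>
    (\<exists>k. based_map Q P k \<and> based_homotopic P P (k \<circ> f) id \<and> based_homotopic Q Q (f \<circ> k) id)"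


section \<open>Reduced suspension and wedge\<close>

definition susp_collapse :: "'a based \<Rightarrow> 'a \<times> real \<Rightarrow> 'a \<times> real"
  where "susp_collapse P =
    collapse_map (topspace (fst P) \<times> {0, 1} \<union> {snd P} \<times> {0..1}) (snd P, 0)"

definition susp :: "'a based \<Rightarrow> ('a \<times> real) based"
  where "susp P =
    collapse (prod_topology (fst P) (top_of_set {0..1}))
      (topspace (fst P) \<times> {0, 1} \<union> {snd P} \<times> {0..1}) (snd P, 0)"

text \<open>The map \<open>\<Sigma>P \<rightarrow> \<Sigma>Q\<close> induced by a based map \<open>f : P \<rightarrow> Q\<close>; only the target is needed.\<close>

definition susp_map :: "'b based \<Rightarrow> ('a \<Rightarrow> 'b) \<Rightarrow> 'a \<times> real \<Rightarrow> 'b \<times> real"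
  where "susp_map Q f = (\<lambda>(x, t). susp_collapse Q (f x, t))"

definition susp2 :: "'a based \<Rightarrow> (('a \<times> real) \<times> real) based"
  where "susp2 P = susp (susp P)"

definition susp2_map :: "'b based \<Rightarrow> ('a \<Rightarrow> 'b) \<Rightarrow> ('a \<times> real) \<times> real \<Rightarrow> ('b \<times> real) \<times> real"
  where "susp2_map Q f = susp_map (susp Q) (susp_map Q f)"

text \<open>
  In the wedge, \<open>None\<close> is the common base point (so that the empty wedge is a point) and
  \<open>Some (i, x)\<close> is the non-base point \<open>x\<close> of the \<open>i\<close>-th summand.
\<close>

definition wedge_in :: "('i \<Rightarrow> 'a based) \<Rightarrow> 'i \<Rightarrow> 'a \<Rightarrow> ('i \<times> 'a) option"
  where "wedge_in P i x = (if x = snd (P i) then None else Some (i, x))"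

definition wedge :: "'i set \<Rightarrow> ('i \<Rightarrow> 'a based) \<Rightarrow> ('i \<times> 'a) option based"
  where "wedge I P =
    (final_topology (insert None (\<Union>i\<in>I. wedge_in P i ` topspace (fst (P i))))
       I (\<lambda>i. fst (P i)) (wedge_in P), None)"

text \<open>
  The map of wedges that sends the \<open>i\<close>-th summand to the \<open>u i\<close>-th summand of the wedge of the
  family \<open>Q\<close> by the based map \<open>f i\<close>.
\<close>

definition wedge_map ::
  "('j \<Rightarrow> 'b based) \<Rightarrow> ('i \<Rightarrow> 'j) \<Rightarrow> ('i \<Rightarrow> 'a \<Rightarrow> 'b) \<Rightarrow> ('i \<times> 'a) option \<Rightarrow> ('j \<times> 'b) option"
  where "wedge_map Q u f p =
    (case p of None \<Rightarrow> None | Some (i, x) \<Rightarrow> wedge_in Q (u i) (f i x))"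


section \<open>CW-complexes\<close>

text \<open>
  Whitehead's definition: \<open>E n\<close> is the set of open \<open>n\<close>-cells.  The last two conditions are
  the existence of characteristic maps, including closure-finiteness, and the weak topology.
\<close>

definition cw_complex :: "'a topology \<Rightarrow> (nat \<Rightarrow> 'a set set) \<Rightarrow> bool"
  where "cw_complex X E \<longleftrightarrow>
    Hausdorff_space X \<and>
    (\<Union>n. \<Union>(E n)) = topspace X \<and>
    (\<forall>n k. \<forall>e\<in>E n. \<forall>e'\<in>E k. e \<inter> e' \<noteq> {} \<longrightarrow> n = k \<and> e = e') \<and>
    (\<forall>n. \<forall>e\<in>E n. \<exists>\<Phi>.
       continuous_map (subtopology (Euclidean_space n) {x. (\<Sum>i<n. (x i)\<^sup>2) \<le> 1}) X \<Phi> \<and>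
       homeomorphic_map (subtopology (Euclidean_space n) {x. (\<Sum>i<n. (x i)\<^sup>2) < 1})
         (subtopology X e) \<Phi> \<and>
       (\<exists>F. finite F \<and> F \<subseteq> (\<Union>k<n. E k) \<and>
          \<Phi> ` {x \<in> topspace (Euclidean_space n). (\<Sum>i<n. (x i)\<^sup>2) = 1} \<subseteq> \<Union>F)) \<and>
    (\<forall>C. C \<subseteq> topspace X \<and> (\<forall>n. \<forall>e\<in>E n. closedin X (C \<inter> X closure_of e)) \<longrightarrow> closedin X C)"

definition cw_subcomplex :: "'a topology \<Rightarrow> (nat \<Rightarrow> 'a set set) \<Rightarrow> 'a set \<Rightarrow> bool"
  where "cw_subcomplex X E A \<longleftrightarrow>
    (\<exists>D. (\<forall>n. D n \<subseteq> E n) \<and> A = (\<Union>n. \<Union>(D n)) \<and> (\<forall>n. \<forall>e\<in>D n. X closure_of e \<subseteq> A))"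

definition connected_based_cw_pair :: "'a topology \<Rightarrow> 'a set \<Rightarrow> 'a \<Rightarrow> bool"
  where "connected_based_cw_pair X A x0 \<longleftrightarrow>
    (\<exists>E. cw_complex X E \<and> cw_subcomplex X E A \<and> {x0} \<in> E 0) \<and>
    x0 \<in> A \<and> connected_space X \<and> connectedin X A"


section \<open>Simplicial complexes with a group action\<close>

text \<open>It is not required that every element of \<open>V\<close> span a simplex.\<close>

definition simplicial_complex_on :: "'v set \<Rightarrow> 'v set set \<Rightarrow> bool"
  where "simplicial_complex_on V K \<longleftrightarrow>
    K \<subseteq> Pow V \<and> {} \<in> K \<and> (\<forall>\<sigma>\<in>K. \<forall>\<tau>. \<tau> \<subseteq> \<sigma> \<longrightarrow> \<tau> \<in> K)"

definition simplicial_G_complex ::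
  "('g, 'r) monoid_scheme \<Rightarrow> ('g \<Rightarrow> nat \<Rightarrow> nat) \<Rightarrow> nat \<Rightarrow> nat set set \<Rightarrow> bool"
  where "simplicial_G_complex G \<phi> m K \<longleftrightarrow>
    simplicial_complex_on {1..m} K \<and> group_action G {1..m} \<phi> \<and>
    (\<forall>g\<in>carrier G. \<forall>\<sigma>\<in>K. \<phi> g ` \<sigma> \<in> K)"

definition full_subcomplex :: "'v set set \<Rightarrow> 'v set \<Rightarrow> 'v set set"
  where "full_subcomplex K J = {\<sigma> \<inter> J |\<sigma>. \<sigma> \<in> K}"


section \<open>Polyhedral products and polyhedral smash products\<close>

text \<open>Here \<open>V\<close> is the set indexing the coordinates: \<open>(X,A)\<^sup>I\<close> as a subset of \<open>X\<^sup>V\<close>.\<close>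

definition polyhedral_block :: "'a topology \<Rightarrow> 'a set \<Rightarrow> 'v set \<Rightarrow> 'v set \<Rightarrow> ('v \<Rightarrow> 'a) set"
  where "polyhedral_block X A V I =
    {x \<in> topspace (product_topology (\<lambda>_. X) V). \<forall>j\<in>V - I. x j \<in> A}"

definition polyhedral_product ::
  "'a topology \<Rightarrow> 'a set \<Rightarrow> 'a \<Rightarrow> 'v set \<Rightarrow> 'v set set \<Rightarrow> ('v \<Rightarrow> 'a) based"
  where "polyhedral_product X A x0 V K =
    (subtopology (product_topology (\<lambda>_. X) V) (\<Union>I\<in>K. polyhedral_block X A V I),
     \<lambda>j\<in>V. x0)"

definition fat_wedge :: "'a topology \<Rightarrow> 'a \<Rightarrow> 'v set \<Rightarrow> ('v \<Rightarrow> 'a) set"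
  where "fat_wedge X x0 J = {x \<in> topspace (product_topology (\<lambda>_. X) J). \<exists>j\<in>J. x j = x0}"

definition smash_power :: "'a topology \<Rightarrow> 'a \<Rightarrow> 'v set \<Rightarrow> ('v \<Rightarrow> 'a) based"
  where "smash_power X x0 J =
    collapse (product_topology (\<lambda>_. X) J) (fat_wedge X x0 J) (\<lambda>j\<in>J. x0)"

definition polyhedral_smash ::
  "'a topology \<Rightarrow> 'a set \<Rightarrow> 'a \<Rightarrow> 'v set \<Rightarrow> 'v set set \<Rightarrow> ('v \<Rightarrow> 'a) based"
  where "polyhedral_smash X A x0 J L =
    (subtopology (fst (smash_power X x0 J))
       (\<Union>\<sigma>\<in>L. collapse_map (fat_wedge X x0 J) (\<lambda>j\<in>J. x0) ` polyhedral_block X A J \<sigma>),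
     \<lambda>j\<in>J. x0)"

definition smash_wedge ::
  "'a topology \<Rightarrow> 'a set \<Rightarrow> 'a \<Rightarrow> 'v set \<Rightarrow> 'v set set \<Rightarrow> ('v set \<times> ('v \<Rightarrow> 'a)) option based"
  where "smash_wedge X A x0 V K =
    wedge {J. J \<subseteq> V \<and> J \<noteq> {}} (\<lambda>J. polyhedral_smash X A x0 J (full_subcomplex K J))"


section \<open>The actions\<close>

text \<open>
  The coordinate of \<open>x\<close> indexed by \<open>i \<in> J\<close> becomes the coordinate indexed by \<open>g\<cdot>i \<in> g\<cdot>J\<close>.
  For \<open>J = {1..m}\<close> this is the action on \<open>X\<^sup>m\<close>, as \<open>g\<cdot>J = J\<close>.
\<close>

definition permute_coords ::
  "('g, 'r) monoid_scheme \<Rightarrow> ('g \<Rightarrow> 'v \<Rightarrow> 'v) \<Rightarrow> 'g \<Rightarrow> 'v set \<Rightarrow> ('v \<Rightarrow> 'a) \<Rightarrow> 'v \<Rightarrow> 'a"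
  where "permute_coords G \<phi> g J x = (\<lambda>i\<in>\<phi> g ` J. x (\<phi> (inv\<^bsub>G\<^esub> g) i))"

text \<open>
  A permutation of coordinates maps the fat wedge to the fat wedge, its complement to its
  complement and the base point to the base point, so on smash products it already acts on the
  chosen representatives.
\<close>

definition smash_wedge_action ::
  "('g, 'r) monoid_scheme \<Rightarrow> ('g \<Rightarrow> 'v \<Rightarrow> 'v) \<Rightarrow> 'a topology \<Rightarrow> 'a set \<Rightarrow> 'a \<Rightarrow> 'v set set \<Rightarrow> 'g \<Rightarrow>
    ('v set \<times> ('v \<Rightarrow> 'a)) option \<Rightarrow> ('v set \<times> ('v \<Rightarrow> 'a)) option"
  where "smash_wedge_action G \<phi> X A x0 K g =
    wedge_map (\<lambda>J. polyhedral_smash X A x0 J (full_subcomplex K J))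
      (\<lambda>J. \<phi> g ` J) (\<lambda>J. permute_coords G \<phi> g J)"

end

theory Submission
  imports Defs
begin

text \<open>
  Let \<open>P\<close> be the polyhedral product and, for \<open>J \<subseteq> [m]\<close>, let \<open>f_J\<close> be the map from \<open>P\<close> to the wedge
  that restricts a point to the coordinates in \<open>J\<close> and then collapses the fat wedge.  The splitting
  map \<open>\<theta>\<close> is the sum over all \<open>J\<close> of the double suspensions of the \<open>f_J\<close>, taken in the outer
  suspension coordinate.  Strictly, \<open>g f_J = f_{gJ} g\<close>; so \<open>g \<theta>\<close> and \<open>\<theta> g\<close> are sums of the same terms
  in different orders, and addition on a double suspension is homotopy commutative
  (\<open>rel_homotopic_track_sum_mset\<close>, \<open>theta_equivariant\<close>).

  A homotopy inverse is written down explicitly.  Let \<open>r_j\<close> be the retraction of \<open>P\<close> that sets the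
  \<open>j\<close>-th coordinate to \<open>x0\<close>.  The vertex \<open>x0\<close> has a neighbourhood in \<open>X\<close> that can be contracted to it by
  a homotopy of \<open>X\<close> that preserves \<open>A\<close> (\<open>cw_pair_contraction\<close>).  With its help the difference
  \<open>1 - r_j\<close> on \<open>\<Sigma>P\<close> is deformed to a map \<open>D_j\<close> that is constant on the points with \<open>x_j = x0\<close>
  (\<open>cancel\<close>): it runs along \<open>x\<close>, returns along \<open>r_j x\<close>, and turns back the earlier the closer \<open>x_j\<close>
  is to \<open>x0\<close>.  The composite of the \<open>D_j\<close> for \<open>j \<in> J\<close> is then constant on every point with one of its
  \<open>J\<close>-coordinates equal to \<open>x0\<close>; hence it factors through the smash product and gives a map from
  the suspension of the \<open>J\<close>-th polyhedral smash product to \<open>\<Sigma>P\<close>.  These maps, put together on the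
  wedge and suspended once more, form \<open>\<kappa>\<close>.

  Up to homotopy, \<open>\<kappa> \<theta>\<close> is the sum over \<open>J\<close> of the products of the \<open>1 - r_j\<close>, \<open>j \<in> J\<close>, and the \<open>r_i\<close>,
  \<open>i \<notin> J\<close>, which is the expansion of the product of all \<open>(1 - r_j) + r_j\<close> and so the identity
  (\<open>rel_homotopic_sum_splittings\<close>).  On the \<open>J\<close>-th summand, the \<open>I\<close>-th term of \<open>\<theta> \<kappa>\<close> is null unless
  \<open>I = J\<close>: if \<open>j \<in> J - I\<close> then \<open>f_I r_j = f_I\<close> is annihilated by \<open>1 - r_j\<close>, and if \<open>i \<in> I - J\<close> then \<open>f_I\<close>
  vanishes on points with \<open>x_i = x0\<close>.  The term \<open>I = J\<close> is homotopic to the inclusion, because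
  \<open>f_J r_j\<close> is constant for \<open>j \<in> J\<close> (\<open>theta_kappa\<close>).  The two sums use different suspension
  coordinates: \<open>\<theta>\<close> adds in the outer one and \<open>D_j\<close> in the inner one, so that the sum \<open>\<theta>\<close> can be
  composed termwise with \<open>\<kappa>\<close> on the right.

  All homotopies are given on cylinders and passed to quotients, wedges and smash products by the
  fact that a product with the unit interval preserves final topologies
  (\<open>final_maps_prod_right\<close>).  This works directly with the product topology on \<open>X\<^sup>m\<close>.
\<close>

section \<open>Continuous maps and final topologies\<close>

abbreviation unit_interval :: "real topology" ("\<I>")
  where "\<I> \<equiv> top_of_set {0..1}"

lemma continuous_map_unit_interval:
  "continuous_map X \<I> f \<longleftrightarrow>
     continuous_map X euclideanreal f \<and> (\<forall>x\<in>topspace X. 0 \<le> f x \<and> f x \<le> 1)"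
  by (auto simp: continuous_map_in_subtopology)

named_theorems cmap

lemma cmap_unit_intervalI:
  assumes "continuous_map X euclideanreal f"
    and "\<And>x. x \<in> topspace X \<Longrightarrow> 0 \<le> f x" "\<And>x. x \<in> topspace X \<Longrightarrow> f x \<le> 1"
  shows "continuous_map X \<I> f"
  using assms by (simp add: continuous_map_unit_interval)

lemma cmap_unit_intervalD: "continuous_map X \<I> f \<Longrightarrow> continuous_map X euclideanreal f"
  by (simp add: continuous_map_unit_interval)

lemma cmap_ident [cmap]: "continuous_map X X (\<lambda>x. x)"
  using continuous_map_id[of X] by (simp add: id_def)

lemma cmap_const: "c \<in> topspace Y \<Longrightarrow> continuous_map X Y (\<lambda>x. c)"
  by simp

lemma cmap_fst [cmap]: "continuous_map Z (prod_topology X Y) f \<Longrightarrow> continuous_map Z X (\<lambda>z. fst (f z))"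
  using continuous_map_fst_of[of Z X Y f] by (simp add: o_def)

lemma cmap_snd [cmap]: "continuous_map Z (prod_topology X Y) f \<Longrightarrow> continuous_map Z Y (\<lambda>z. snd (f z))"
  using continuous_map_snd_of[of Z X Y f] by (simp add: o_def)

lemma cmap_compose:
  assumes "continuous_map Y Z g" and "continuous_map X Y f"
  shows "continuous_map X Z (\<lambda>x. g (f x))"
  using continuous_map_compose[OF assms(2,1)] by (simp add: o_def)

lemma cmap_subtopology: "continuous_map X Y f \<Longrightarrow> continuous_map (subtopology X S) Y f"
  by (rule continuous_map_from_subtopology)

text \<open>
  Quotients, wedges and the weak topology of a cell complex are all final for a jointly surjective
  family of maps, so that one result on products with the interval covers them all.
\<close>

definition final_maps :: "'i set \<Rightarrow> ('i \<Rightarrow> 'a topology) \<Rightarrow> ('i \<Rightarrow> 'a \<Rightarrow> 'b) \<Rightarrow> 'b topology \<Rightarrow> bool"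
  where "final_maps L X f Y \<longleftrightarrow>
    (\<forall>i\<in>L. continuous_map (X i) Y (f i)) \<and> topspace Y \<subseteq> (\<Union>i\<in>L. f i ` topspace (X i)) \<and>
    (\<forall>U. U \<subseteq> topspace Y \<and> (\<forall>i\<in>L. openin (X i) {x \<in> topspace (X i). f i x \<in> U}) \<longrightarrow> openin Y U)"

lemma continuous_map_from_final:
  assumes "final_maps L X f Y" and "\<And>i. i \<in> L \<Longrightarrow> continuous_map (X i) Z (\<lambda>x. g (f i x))"
  shows "continuous_map Y Z g"
  unfolding continuous_map_def
proof (intro conjI allI impI)
  show "g \<in> topspace Y \<rightarrow> topspace Z"
  proof
    fix y assume "y \<in> topspace Y"
    then obtain i x where "i \<in> L" "x \<in> topspace (X i)" "y = f i x"
      using assms(1) unfolding final_maps_def by blast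
    then show "g y \<in> topspace Z"
      using continuous_map_image_subset_topspace[OF assms(2)] by blast
  qed
  fix U assume U: "openin Z U"
  have "openin (X i) {x \<in> topspace (X i). f i x \<in> {y \<in> topspace Y. g y \<in> U}}" if i: "i \<in> L" for i
  proof -
    have "f i x \<in> topspace Y" if "x \<in> topspace (X i)" for x
      using assms(1) i that by (auto simp: final_maps_def continuous_map_def)
    then have "{x \<in> topspace (X i). f i x \<in> {y \<in> topspace Y. g y \<in> U}} = {x \<in> topspace (X i). g (f i
        x) \<in> U}"
      by auto
    then show ?thesis
      using openin_continuous_map_preimage[OF assms(2)[OF i] U] by simp
  qed
  then show "openin Y {y \<in> topspace Y. g y \<in> U}"
    using assms(1) by (auto simp: final_maps_def)
qed

lemma final_maps_quotient_source:
  assumes fin: "final_maps L X f Y" and q: "\<And>i. i \<in> L \<Longrightarrow> quotient_map (X' i) (X i) (q i)"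
  shows "final_maps L X' (\<lambda>i x. f i (q i x)) Y"
  unfolding final_maps_def
proof (intro conjI allI ballI impI; (elim conjE)?)
  fix i assume "i \<in> L"
  then show "continuous_map (X' i) Y (\<lambda>x. f i (q i x))"
    using fin cmap_compose[OF _ quotient_imp_continuous_map[OF q], of i Y "f i"]
    by (simp add: final_maps_def)
next
  have "f i ` topspace (X i) = (\<lambda>x. f i (q i x)) ` topspace (X' i)" if "i \<in> L" for i
    using quotient_imp_surjective_map[OF q[OF that]] by (metis image_image)
  then show "topspace Y \<subseteq> (\<Union>i\<in>L. (\<lambda>x. f i (q i x)) ` topspace (X' i))"
    using fin by (simp add: final_maps_def)
next
  fix U assume U: "U \<subseteq> topspace Y"
    and op: "\<forall>i\<in>L. openin (X' i) {x \<in> topspace (X' i). f i (q i x) \<in> U}"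
  have "openin (X i) {x \<in> topspace (X i). f i x \<in> U}" if i: "i \<in> L" for i
  proof -
    have "{x \<in> topspace (X' i). q i x \<in> {x \<in> topspace (X i). f i x \<in> U}} = {x \<in> topspace (X' i). f i
        (q i x) \<in> U}"
      using q[OF i] by (auto simp: quotient_map_def)
    moreover have "openin (X' i) {x \<in> topspace (X' i). q i x \<in> {x \<in> topspace (X i). f i x \<in> U}}
        \<longleftrightarrow> openin (X i) {x \<in> topspace (X i). f i x \<in> U}"
      by (rule conjunct2[OF q[OF i, unfolded quotient_map_def], rule_format]) auto
    ultimately show ?thesis
      using op i by simp
  qed
  then show "openin Y U"
    using assms(1) U by (auto simp: final_maps_def)
qed

lemma final_maps_quotient_target:
  assumes fin: "final_maps L X f Y" and q: "quotient_map Y Y' q"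
  shows "final_maps L X (\<lambda>i x. q (f i x)) Y'"
  unfolding final_maps_def
proof (intro conjI allI ballI impI; (elim conjE)?)
  fix i assume "i \<in> L"
  then show "continuous_map (X i) Y' (\<lambda>x. q (f i x))"
    using fin cmap_compose[OF quotient_imp_continuous_map[OF q], of "X i" "f i"]
    by (simp add: final_maps_def)
next
  have "topspace Y' = q ` topspace Y"
    using quotient_imp_surjective_map[OF q] by simp
  also have "\<dots> \<subseteq> (\<Union>i\<in>L. (\<lambda>x. q (f i x)) ` topspace (X i))"
    using fin unfolding final_maps_def by blast
  finally show "topspace Y' \<subseteq> (\<Union>i\<in>L. (\<lambda>x. q (f i x)) ` topspace (X i))" .
next
  fix U assume U: "U \<subseteq> topspace Y'"
    and op: "\<forall>i\<in>L. openin (X i) {x \<in> topspace (X i). q (f i x) \<in> U}"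
  have "{x \<in> topspace (X i). f i x \<in> {y \<in> topspace Y. q y \<in> U}} = {x \<in> topspace (X i). q (f i x) \<in> U}"
    if "i \<in> L" for i
    using assms(1) that by (auto simp: final_maps_def continuous_map_def)
  then have "openin Y {y \<in> topspace Y. q y \<in> U}"
    using assms(1) op by (simp add: final_maps_def)
  then show "openin Y' U"
    using q U by (simp add: quotient_map_def)
qed

text \<open>
  A point \<open>(y, t)\<close> of a set \<open>W\<close> with open preimages has a compact neighbourhood \<open>N\<close> of \<open>t\<close> with
  \<open>{y} \<times> N \<subseteq> W\<close>, because \<open>y\<close> comes from one of the spaces upstairs.  The tube lemma, applied upstairs,
  shows that the set of all \<open>y\<close> with this property for the same \<open>N\<close> is open.
\<close>

lemma final_maps_prod_right:
  assumes fin: "final_maps L X f Y"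
  shows "final_maps L (\<lambda>i. prod_topology (X i) \<I>) (\<lambda>i p. (f i (fst p), snd p)) (prod_topology Y \<I>)"
  unfolding final_maps_def
proof (intro conjI allI ballI impI; (elim conjE)?)
  have cont: "continuous_map (X i) Y (f i)" if "i \<in> L" for i
    using fin that by (simp add: final_maps_def)
  show "continuous_map (prod_topology (X i) \<I>) (prod_topology Y \<I>) (\<lambda>p. (f i (fst p), snd p))"
    if "i \<in> L" for i
    by (intro continuous_map_pairedI cmap_compose[OF cont[OF that]] cmap; rule cmap_ident)
  have cov: "topspace Y \<subseteq> (\<Union>i\<in>L. f i ` topspace (X i))"
    using fin by (simp add: final_maps_def)
  then show "topspace (prod_topology Y \<I>) \<subseteq> (\<Union>i\<in>L. (\<lambda>p. (f i (fst p), snd p)) ` topspace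
      (prod_topology (X i) \<I>))"
    by (auto simp: image_iff subset_iff)
  fix W assume WY: "W \<subseteq> topspace (prod_topology Y \<I>)"
    and "\<forall>i\<in>L. openin (prod_topology (X i) \<I>) {p \<in> topspace (prod_topology (X i) \<I>). (f i (fst p),
        snd p) \<in> W}"
  then have op: "openin (prod_topology (X i) \<I>) {p \<in> topspace (prod_topology (X i) \<I>). (f i (fst p),
      snd p) \<in> W}"
    (is "openin _ (?pre i)") if "i \<in> L" for i
    using that by blast
  show "openin (prod_topology Y \<I>) W"
  proof (subst openin_subopen, intro ballI)
    fix p assume "p \<in> W"
    then obtain y t where p: "p = (y, t)" "(y, t) \<in> W" and y: "y \<in> topspace Y" and t: "t \<in> {0..1}"
      using WY by (cases p) auto
    from y cov obtain i x where i: "i \<in> L" and x: "x \<in> topspace (X i)" and yx: "y = f i x"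
      by blast
    have "(x, t) \<in> ?pre i"
      using p x t yx by simp
    then obtain U V where U: "openin (X i) U" "x \<in> U" and V: "openin \<I> V" "t \<in> V" and UV: "U \<times> V \<subseteq>
        ?pre i"
      using op[OF i, unfolded openin_prod_topology_alt, rule_format, of x t] by blast
    obtain \<epsilon> where \<epsilon>: "\<epsilon> > 0" "cball t \<epsilon> \<inter> {0..1} \<subseteq> V"
      using V unfolding openin_contains_cball by blast
    define N where "N = cball t \<epsilon> \<inter> {0..1}"
    have "compact N"
      unfolding N_def by (intro compact_Int) auto
    then have N: "compactin \<I> N"
      by (auto simp: N_def compactin_subtopology)
    define B where "B = ball t \<epsilon> \<inter> {0..1}"
    have B: "openin \<I> B" "t \<in> B" "B \<subseteq> N"
      using \<epsilon> t openin_open_Int[of "ball t \<epsilon>" "{0..1}"] by (auto simp: B_def N_def Int_commute)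
    define S where "S = {y \<in> topspace Y. {y} \<times> N \<subseteq> W}"
    have "openin (X j) {z \<in> topspace (X j). f j z \<in> S}" if j: "j \<in> L" for j
    proof (subst openin_subopen, intro ballI)
      fix z assume "z \<in> {z \<in> topspace (X j). f j z \<in> S}"
      then have z: "z \<in> topspace (X j)" "{z} \<times> N \<subseteq> ?pre j"
        by (auto simp: S_def N_def)
      obtain U' V' where U': "openin (X j) U'" "z \<in> U'" "N \<subseteq> V'" "U' \<times> V' \<subseteq> ?pre j"
        using tube_lemma_right[OF op[OF j] N z] by blast
      have "U' \<subseteq> {z \<in> topspace (X j). f j z \<in> S}"
        using U'(3,4) openin_subset[OF U'(1)] continuous_map_image_subset_topspace[OF cont[OF j]]
        by (auto simp: S_def subset_iff)
      then show "\<exists>T. openin (X j) T \<and> z \<in> T \<and> T \<subseteq> {z \<in> topspace (X j). f j z \<in> S}"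
        using U' by blast
    qed
    then have "openin Y S"
      using fin by (auto simp: final_maps_def S_def)
    moreover have "{x} \<times> N \<subseteq> ?pre i"
      using UV U(2) \<epsilon>(2) unfolding N_def by blast
    then have "y \<in> S"
      using y unfolding S_def yx by auto
    moreover have "S \<times> B \<subseteq> W"
      using B(3) unfolding S_def by blast
    ultimately show "\<exists>T. openin (prod_topology Y \<I>) T \<and> p \<in> T \<and> T \<subseteq> W"
      using B(1,2) p(1) by (intro exI[of _ "S \<times> B"]) (simp add: openin_prod_Times_iff)
  qed
qed

lemma final_maps_prod_left:
  assumes fin: "final_maps L X f Y"
  shows "final_maps L (\<lambda>i. prod_topology \<I> (X i)) (\<lambda>i p. (fst p, f i (snd p))) (prod_topology \<I> Y)"
proof -
  have swap: "quotient_map (prod_topology S T) (prod_topology T S) prod.swap" for S :: "'x topology"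
      and T :: "'y topology"
  proof -
    have "prod.swap = (\<lambda>(x :: 'x, y :: 'y). (y, x))" by auto
    then show ?thesis
      using homeomorphic_map_swap[of S T] by (simp add: homeomorphic_map_def)
  qed
  show ?thesis
    using final_maps_quotient_target[OF final_maps_quotient_source[OF final_maps_prod_right[OF fin]
        swap] swap]
    by simp
qed

lemma final_maps_quotient_map: "quotient_map X Y q \<Longrightarrow> final_maps {()} (\<lambda>_. X) (\<lambda>_. q) Y"
  by (simp add: final_maps_def quotient_imp_continuous_map quotient_imp_surjective_map)
    (simp add: quotient_map_def, blast)

lemmas real_cmap = continuous_map_real_min continuous_map_real_max continuous_map_diff
  continuous_map_add continuous_map_real_mult continuous_map_canonical_const

section \<open>Homotopies relative to a trivial part\<close>

abbreviation cyl :: "'a topology \<Rightarrow> ('a \<times> real) topology"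
  where "cyl P \<equiv> prod_topology P \<I>"

text \<open>
  A based map from the reduced suspension of \<open>P/W\<close> to \<open>Z\<close> is treated as a map on the cylinder of \<open>P\<close>
  that sends \<open>W \<times> [0,1]\<close> and both ends to the base point.  The set \<open>W\<close> is kept as a parameter, since maps
  that are to be factored through a smash product need homotopies relative to the fat wedge.
\<close>

definition rel_map :: "'a topology \<Rightarrow> 'a set \<Rightarrow> 'z based \<Rightarrow> ('a \<times> real \<Rightarrow> 'z) \<Rightarrow> bool"
  where "rel_map P W Z F \<longleftrightarrow> continuous_map (cyl P) (fst Z) F \<and>
    (\<forall>x t. x \<in> topspace P \<and> 0 \<le> t \<and> t \<le> 1 \<and> (x \<in> W \<or> t = 0 \<or> t = 1) \<longrightarrow> F (x, t) = snd Z)"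

definition rel_homotopy ::
  "'a topology \<Rightarrow> 'a set \<Rightarrow> 'z based \<Rightarrow> (real \<times> 'a \<times> real \<Rightarrow> 'z) \<Rightarrow> ('a \<times> real \<Rightarrow> 'z) \<Rightarrow> ('a \<times> real \<Rightarrow> 'z) \<Rightarrow>
      bool"
  where "rel_homotopy P W Z H F G \<longleftrightarrow>
    continuous_map (prod_topology \<I> (cyl P)) (fst Z) H \<and>
    (\<forall>x t. x \<in> topspace P \<and> 0 \<le> t \<and> t \<le> 1 \<longrightarrow> H (0, (x, t)) = F (x, t) \<and> H (1, (x, t)) = G (x, t)) \<and>
    (\<forall>s x t. 0 \<le> s \<and> s \<le> 1 \<and> x \<in> topspace P \<and> 0 \<le> t \<and> t \<le> 1 \<and> (x \<in> W \<or> t = 0 \<or> t = 1) \<longrightarrow>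
       H (s, (x, t)) = snd Z)"

definition rel_homotopic :: "'a topology \<Rightarrow> 'a set \<Rightarrow> 'z based \<Rightarrow> ('a \<times> real \<Rightarrow> 'z) \<Rightarrow> ('a \<times> real \<Rightarrow> 'z) \<Rightarrow>
    bool"
  where "rel_homotopic P W Z F G \<longleftrightarrow> (\<exists>H. rel_homotopy P W Z H F G)"

lemma rel_mapD:
  assumes "rel_map P W Z F"
  shows "continuous_map (cyl P) (fst Z) F"
    and "\<And>x t. \<lbrakk>x \<in> topspace P; 0 \<le> t; t \<le> 1; x \<in> W \<or> t = 0 \<or> t = 1\<rbrakk> \<Longrightarrow> F (x, t) = snd Z"
  using assms unfolding rel_map_def by blast+

lemma rel_homotopyD:
  assumes "rel_homotopy P W Z H F G"
  shows "continuous_map (prod_topology \<I> (cyl P)) (fst Z) H"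
    and "\<And>x t. \<lbrakk>x \<in> topspace P; 0 \<le> t; t \<le> 1\<rbrakk> \<Longrightarrow> H (0, (x, t)) = F (x, t)"
    and "\<And>x t. \<lbrakk>x \<in> topspace P; 0 \<le> t; t \<le> 1\<rbrakk> \<Longrightarrow> H (1, (x, t)) = G (x, t)"
    and "\<And>s x t. \<lbrakk>0 \<le> s; s \<le> 1; x \<in> topspace P; 0 \<le> t; t \<le> 1; x \<in> W \<or> t = 0 \<or> t = 1\<rbrakk> \<Longrightarrow> H (s, (x, t))
        = snd Z"
  using assms unfolding rel_homotopy_def by blast+

lemma rel_homotopicI:
  assumes "continuous_map (prod_topology \<I> (cyl P)) (fst Z) H"
    and "\<And>x t. \<lbrakk>x \<in> topspace P; 0 \<le> t; t \<le> 1\<rbrakk> \<Longrightarrow> H (0, (x, t)) = F (x, t)"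
    and "\<And>x t. \<lbrakk>x \<in> topspace P; 0 \<le> t; t \<le> 1\<rbrakk> \<Longrightarrow> H (1, (x, t)) = G (x, t)"
    and "\<And>s x t. \<lbrakk>0 \<le> s; s \<le> 1; x \<in> topspace P; 0 \<le> t; t \<le> 1; x \<in> W \<or> t = 0 \<or> t = 1\<rbrakk> \<Longrightarrow> H (s, (x, t))
        = snd Z"
  shows "rel_homotopic P W Z F G"
  unfolding rel_homotopic_def rel_homotopy_def using assms by blast

lemma homotopy_coords:
  shows "continuous_map (prod_topology \<I> (cyl P)) \<I> fst"
    and "continuous_map (prod_topology \<I> (cyl P)) P (\<lambda>p. fst (snd p))"
    and "continuous_map (prod_topology \<I> (cyl P)) \<I> (\<lambda>p. snd (snd p))"
    and "continuous_map (prod_topology \<I> (cyl P)) (cyl P) snd"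
    and "continuous_map (prod_topology \<I> (cyl P)) euclideanreal fst"
    and "continuous_map (prod_topology \<I> (cyl P)) euclideanreal (\<lambda>p. snd (snd p))"
proof -
  show 1: "continuous_map (prod_topology \<I> (cyl P)) \<I> fst"
    and "continuous_map (prod_topology \<I> (cyl P)) P (\<lambda>p. fst (snd p))"
    and 2: "continuous_map (prod_topology \<I> (cyl P)) \<I> (\<lambda>p. snd (snd p))"
    and "continuous_map (prod_topology \<I> (cyl P)) (cyl P) snd"
    by (intro continuous_map_fst continuous_map_snd | intro cmap, rule cmap_ident)+
  show "continuous_map (prod_topology \<I> (cyl P)) euclideanreal fst"
    "continuous_map (prod_topology \<I> (cyl P)) euclideanreal (\<lambda>p. snd (snd p))"
    by (intro cmap_unit_intervalD 1 2)+
qed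

lemma rel_map_cong:
  assumes "rel_map P W Z F" and "\<And>x t. \<lbrakk>x \<in> topspace P; 0 \<le> t; t \<le> 1\<rbrakk> \<Longrightarrow> F (x, t) = G (x, t)"
  shows "rel_map P W Z G"
  unfolding rel_map_def
proof (intro conjI)
  show "continuous_map (cyl P) (fst Z) G"
    by (rule continuous_map_eq[OF rel_mapD(1)[OF assms(1)]]) (auto simp: assms(2))
qed (use rel_mapD(2)[OF assms(1)] assms(2) in auto)

lemma rel_map_mono: "rel_map P W Z F \<Longrightarrow> W' \<subseteq> W \<Longrightarrow> rel_map P W' Z F"
  by (auto simp: rel_map_def)

lemma rel_homotopic_mono: "rel_homotopic P W Z F G \<Longrightarrow> W' \<subseteq> W \<Longrightarrow> rel_homotopic P W' Z F G"
proof -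
  assume "rel_homotopic P W Z F G" and W: "W' \<subseteq> W"
  then obtain H where H: "rel_homotopy P W Z H F G"
    unfolding rel_homotopic_def by blast
  show "rel_homotopic P W' Z F G"
    by (rule rel_homotopicI[of P Z H]) (use W in \<open>auto simp: rel_homotopyD[OF H] subset_iff\<close>)
qed

lemma rel_homotopic_cong:
  assumes "rel_homotopic P W Z F G"
    and "\<And>x t. \<lbrakk>x \<in> topspace P; 0 \<le> t; t \<le> 1\<rbrakk> \<Longrightarrow> F (x, t) = F' (x, t)"
    and "\<And>x t. \<lbrakk>x \<in> topspace P; 0 \<le> t; t \<le> 1\<rbrakk> \<Longrightarrow> G (x, t) = G' (x, t)"
  shows "rel_homotopic P W Z F' G'"
proof -
  obtain H where H: "rel_homotopy P W Z H F G"
    using assms(1) unfolding rel_homotopic_def by blast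
  show ?thesis
    by (rule rel_homotopicI[of P Z H]) (simp_all add: rel_homotopyD[OF H] assms(2,3))
qed

lemma rel_homotopic_refl:
  assumes "rel_map P W Z F"
    and "\<And>x t. \<lbrakk>x \<in> topspace P; 0 \<le> t; t \<le> 1\<rbrakk> \<Longrightarrow> F (x, t) = G (x, t)"
  shows "rel_homotopic P W Z F G"
proof (rule rel_homotopicI[where H = "\<lambda>p. F (snd p)"])
  show "continuous_map (prod_topology \<I> (cyl P)) (fst Z) (\<lambda>p. F (snd p))"
    by (rule cmap_compose[OF rel_mapD(1)[OF assms(1)] homotopy_coords(4)])
qed (use rel_mapD(2)[OF assms(1)] assms(2) in auto)

lemma rel_homotopic_rel_map:
  assumes "rel_homotopic P W Z F G"
  shows "rel_map P W Z F" "rel_map P W Z G"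
proof -
  obtain H where H: "rel_homotopy P W Z H F G"
    using assms unfolding rel_homotopic_def by blast
  have slice: "rel_map P W Z (\<lambda>p. H (s, p))" if "s \<in> {0..1}" for s
    unfolding rel_map_def
  proof (intro conjI)
    show "continuous_map (cyl P) (fst Z) (\<lambda>p. H (s, p))"
      by (intro cmap_compose[OF rel_homotopyD(1)[OF H]] continuous_map_pairedI cmap_const cmap) (use
          that in auto)
  qed (use that in \<open>auto simp: rel_homotopyD[OF H]\<close>)
  show "rel_map P W Z F"
    by (rule rel_map_cong[OF slice[of 0]]) (auto simp: rel_homotopyD[OF H])
  show "rel_map P W Z G"
    by (rule rel_map_cong[OF slice[of 1]]) (auto simp: rel_homotopyD[OF H])
qed

lemma rel_homotopic_sym:
  assumes "rel_homotopic P W Z F G" shows "rel_homotopic P W Z G F"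
proof -
  obtain H where H: "rel_homotopy P W Z H F G"
    using assms unfolding rel_homotopic_def by blast
  show ?thesis
  proof (rule rel_homotopicI[where H = "\<lambda>p. H (1 - fst p, snd p)"])
    show "continuous_map (prod_topology \<I> (cyl P)) (fst Z) (\<lambda>p. H (1 - fst p, snd p))"
      by (intro cmap_compose[OF rel_homotopyD(1)[OF H]] continuous_map_pairedI homotopy_coords
          cmap_unit_intervalI real_cmap) auto
  qed (auto simp: rel_homotopyD[OF H])
qed

lemma rel_homotopic_trans [trans]:
  assumes "rel_homotopic P W Z F G" "rel_homotopic P W Z G K" shows "rel_homotopic P W Z F K"
proof -
  obtain H where H: "rel_homotopy P W Z H F G"
    using assms(1) unfolding rel_homotopic_def by blast
  obtain H' where H': "rel_homotopy P W Z H' G K"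
    using assms(2) unfolding rel_homotopic_def by blast
  show ?thesis
  proof (rule rel_homotopicI[where H = "\<lambda>p. if fst p \<le> 1/2 then H (2 * fst p, snd p) else H' (2 *
      fst p - 1, snd p)"])
    show "continuous_map (prod_topology \<I> (cyl P)) (fst Z) (\<lambda>p. if fst p \<le> 1/2 then H (2 * fst p,
        snd p) else H' (2 * fst p - 1, snd p))"
    proof (rule continuous_map_cases_le)
      show "continuous_map (subtopology (prod_topology \<I> (cyl P)) {x \<in> topspace (prod_topology \<I>
          (cyl P)). fst x \<le> 1 / 2}) (fst Z) (\<lambda>p. H (2 * fst p, snd p))"
        by (intro cmap_compose[OF rel_homotopyD(1)[OF H]] continuous_map_pairedI cmap_unit_intervalI
            real_cmap cmap_subtopology homotopy_coords) auto
      show "continuous_map (subtopology (prod_topology \<I> (cyl P)) {x \<in> topspace (prod_topology \<I>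
          (cyl P)). 1 / 2 \<le> fst x}) (fst Z) (\<lambda>p. H' (2 * fst p - 1, snd p))"
        by (intro cmap_compose[OF rel_homotopyD(1)[OF H']] continuous_map_pairedI
            cmap_unit_intervalI real_cmap cmap_subtopology homotopy_coords) auto
    qed (auto intro: homotopy_coords simp: field_simps rel_homotopyD[OF H] rel_homotopyD[OF H'])
  qed (auto simp: rel_homotopyD[OF H] rel_homotopyD[OF H'])
qed

text \<open>
  Self-maps of the interval that agree at the ends, and send ends to ends, are joined by linear
  interpolation, which does not move the values at the ends.
\<close>

lemma rel_homotopic_reparam:
  assumes F: "rel_map P W Z F"
    and a: "continuous_map \<I> \<I> a" and b: "continuous_map \<I> \<I> b"
    and ends: "a 0 = b 0" "a 1 = b 1" "a 0 = 0 \<or> a 0 = 1" "a 1 = 0 \<or> a 1 = 1"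
  shows "rel_homotopic P W Z (\<lambda>p. F (fst p, a (snd p))) (\<lambda>p. F (fst p, b (snd p)))"
proof (rule rel_homotopicI[where H = "\<lambda>p. F (fst (snd p), (1 - fst p) * a (snd (snd p)) + fst p * b
    (snd (snd p)))"])
  have ab: "0 \<le> a t \<and> a t \<le> 1 \<and> 0 \<le> b t \<and> b t \<le> 1" if "0 \<le> t" "t \<le> 1" for t
    using a b that by (auto simp: continuous_map_in_subtopology)
  have conv: "0 \<le> (1 - s) * a t + s * b t \<and> (1 - s) * a t + s * b t \<le> 1" if "0 \<le> t" "t \<le> 1" "0 \<le> s"
      "s \<le> 1" for s t
    using ab[OF that(1,2)] that convex_bound_le[of "a t" 1 "b t" "1 - s" s] by auto
  show "continuous_map (prod_topology \<I> (cyl P)) (fst Z)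
      (\<lambda>p. F (fst (snd p), (1 - fst p) * a (snd (snd p)) + fst p * b (snd (snd p))))"
    by (intro cmap_compose[OF rel_mapD(1)[OF F]] continuous_map_pairedI cmap_unit_intervalI
        real_cmap homotopy_coords
        cmap_compose[OF cmap_unit_intervalD[OF a]] cmap_compose[OF cmap_unit_intervalD[OF b]])
      (use conv in auto)
  fix s t :: real and x assume *: "0 \<le> s" "s \<le> 1" "x \<in> topspace P" "0 \<le> t" "t \<le> 1" "x \<in> W \<or> t = 0 \<or>
      t = 1"
  have "(1 - s) * a t + s * b t = a t" if "a t = b t"
    using that by (simp add: algebra_simps)
  then have "x \<in> W \<or> (1 - s) * a t + s * b t = 0 \<or> (1 - s) * a t + s * b t = 1"
    using *(6) ends by metis
  then show "F (fst (snd (s, x, t)), (1 - fst (s, x, t)) * a (snd (snd (s, x, t))) + fst (s, x, t) *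
      b (snd (snd (s, x, t)))) = snd Z"
    using rel_mapD(2)[OF F *(3)] conv[OF *(4,5,1,2)] by auto
qed auto

section \<open>Addition of maps on a cylinder\<close>

definition track_add :: "('a \<times> real \<Rightarrow> 'z) \<Rightarrow> ('a \<times> real \<Rightarrow> 'z) \<Rightarrow> 'a \<times> real \<Rightarrow> 'z"
  where "track_add F G p = (if snd p \<le> 1/2 then F (fst p, 2 * snd p) else G (fst p, 2 * snd p - 1))"

lemma rel_homotopic_track_add:
  assumes "rel_homotopic P W Z F F'" "rel_homotopic P W Z G G'"
  shows "rel_homotopic P W Z (track_add F G) (track_add F' G')"
proof -
  obtain H where H: "rel_homotopy P W Z H F F'"
    using assms(1) unfolding rel_homotopic_def by blast
  obtain H' where H': "rel_homotopy P W Z H' G G'"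
    using assms(2) unfolding rel_homotopic_def by blast
  let ?T = "prod_topology \<I> (cyl P)"
  show ?thesis
  proof (rule rel_homotopicI[where H = "\<lambda>p. if snd (snd p) \<le> 1/2 then H (fst p, (fst (snd p), 2 *
      snd (snd p)))
        else H' (fst p, (fst (snd p), 2 * snd (snd p) - 1))"])
    show "continuous_map ?T (fst Z) (\<lambda>p. if snd (snd p) \<le> 1/2 then H (fst p, (fst (snd p), 2 * snd
        (snd p)))
        else H' (fst p, (fst (snd p), 2 * snd (snd p) - 1)))"
    proof (rule continuous_map_cases_le)
      show "continuous_map (subtopology ?T {x \<in> topspace ?T. snd (snd x) \<le> 1 / 2}) (fst Z) (\<lambda>p. H
          (fst p, (fst (snd p), 2 * snd (snd p))))"
        by (intro cmap_compose[OF rel_homotopyD(1)[OF H]] continuous_map_pairedI cmap_unit_intervalI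
            real_cmap cmap_subtopology homotopy_coords) auto
      show "continuous_map (subtopology ?T {x \<in> topspace ?T. 1 / 2 \<le> snd (snd x)}) (fst Z) (\<lambda>p. H'
          (fst p, (fst (snd p), 2 * snd (snd p) - 1)))"
        by (intro cmap_compose[OF rel_homotopyD(1)[OF H']] continuous_map_pairedI
            cmap_unit_intervalI real_cmap cmap_subtopology homotopy_coords) auto
    qed (auto intro: homotopy_coords simp: rel_homotopyD[OF H] rel_homotopyD[OF H'])
  qed (auto simp: track_add_def rel_homotopyD[OF H] rel_homotopyD[OF H'])
qed

lemma rel_map_track_add: "rel_map P W Z F \<Longrightarrow> rel_map P W Z G \<Longrightarrow> rel_map P W Z (track_add F G)"
  using rel_homotopic_rel_map(1)[OF rel_homotopic_track_add[OF rel_homotopic_refl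
      rel_homotopic_refl]] by blast

lemma rel_map_const: "snd Z \<in> topspace (fst Z) \<Longrightarrow> rel_map P W Z (\<lambda>_. snd Z)"
  by (simp add: rel_map_def)

lemma cmap_interval_self: "continuous_map \<I> euclideanreal (\<lambda>t. t)"
  by (rule cmap_unit_intervalD[OF cmap_ident])

lemma rel_homotopic_track_add_null_right:
  assumes F: "rel_map P W Z F"
  shows "rel_homotopic P W Z (track_add F (\<lambda>_. snd Z)) F"
proof -
  have a: "continuous_map \<I> \<I> (\<lambda>t. min 1 (2 * t))"
    by (intro cmap_unit_intervalI real_cmap cmap_interval_self) auto
  show ?thesis
    by (rule rel_homotopic_cong[OF rel_homotopic_reparam[OF F a cmap_ident]]) (auto simp:
        track_add_def rel_mapD(2)[OF F])
qed

lemma rel_homotopic_track_add_null_left: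
  assumes F: "rel_map P W Z F"
  shows "rel_homotopic P W Z (track_add (\<lambda>_. snd Z) F) F"
proof -
  have a: "continuous_map \<I> \<I> (\<lambda>t. max 0 (2 * t - 1))"
    by (intro cmap_unit_intervalI real_cmap cmap_interval_self) auto
  show ?thesis
    by (rule rel_homotopic_cong[OF rel_homotopic_reparam[OF F a cmap_ident]]) (auto simp:
        track_add_def max_def rel_mapD(2)[OF F])
qed

lemma rel_homotopic_track_add_assoc:
  assumes F: "rel_map P W Z F" and G: "rel_map P W Z G" and K: "rel_map P W Z K"
  shows "rel_homotopic P W Z (track_add (track_add F G) K) (track_add F (track_add G K))"
proof -
  have c: "continuous_map \<I> \<I> (\<lambda>t. min (2 * t) (min (t + 1/4) (t * (1/2) + 1/2)))"
    by (intro cmap_unit_intervalI real_cmap cmap_interval_self) auto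
  show ?thesis
  proof (rule rel_homotopic_cong[OF rel_homotopic_reparam[OF rel_map_track_add[OF F
      rel_map_track_add[OF G K]] c cmap_ident]])
    fix x t assume x: "x \<in> topspace P" and t: "0 \<le> t" "t \<le> (1::real)"
    consider "t \<le> 1/4" | "1/4 < t" "t \<le> 1/2" | "1/2 < t" by linarith
    then show "track_add F (track_add G K) (fst (x, t), min (2 * snd (x, t)) (min (snd (x, t) + 1 /
        4) (snd (x, t) * (1 / 2) + 1 / 2)))
        = track_add (track_add F G) K (x, t)"
    proof cases
      case 2
      have "2 * (2 * (t + 1/4) - 1) = 2 * (2 * t) - 1" by simp
      with 2 show ?thesis by (simp add: track_add_def min_def)
    qed (auto simp: track_add_def min_def field_simps)
  qed auto
qed

primrec track_sum :: "'z \<Rightarrow> ('a \<times> real \<Rightarrow> 'z) list \<Rightarrow> 'a \<times> real \<Rightarrow> 'z"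
  where
    "track_sum z [] = (\<lambda>_. z)"
  | "track_sum z (F # Fs) = track_add F (track_sum z Fs)"

lemma track_sum_postcompose: "g (track_sum z Fs p) = track_sum (g z) (map (\<lambda>F p. g (F p)) Fs) p"
  by (induction Fs arbitrary: p) (auto simp: track_add_def)

lemma track_sum_precompose: "track_sum z Fs (e (fst p), snd p) = track_sum z (map (\<lambda>F p. F (e (fst
    p), snd p)) Fs) p"
  by (induction Fs arbitrary: p) (auto simp: track_add_def)

lemma track_sum_cong_at:
  assumes "\<And>J r. \<lbrakk>J \<in> set Js; 0 \<le> r; r \<le> 1\<rbrakk> \<Longrightarrow> F J (x, r) = G J (x, r)" and "0 \<le> r" "r \<le> 1"
  shows "track_sum z (map F Js) (x, r) = track_sum z (map G Js) (x, r)"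
  using assms
proof (induction Js arbitrary: r)
  case (Cons J Js)
  have "F J (x, 2 * r) = G J (x, 2 * r)" if "r \<le> 1/2"
    using Cons.prems that by simp
  moreover have "track_sum z (map F Js) (x, 2 * r - 1) = track_sum z (map G Js) (x, 2 * r - 1)" if
      "\<not> r \<le> 1/2"
    by (rule Cons.IH) (use Cons.prems that in auto)
  ultimately show ?case by (simp add: track_add_def)
qed simp

lemma rel_map_track_sum:
  assumes "snd Z \<in> topspace (fst Z)" and "\<And>F. F \<in> set Fs \<Longrightarrow> rel_map P W Z F"
  shows "rel_map P W Z (track_sum (snd Z) Fs)"
  using assms(2) by (induction Fs) (auto intro: rel_map_const rel_map_track_add assms(1))

text \<open>
  This is the step that removes one factor \<open>(1 - r_j) + r_j\<close> from an expanded product: neighbouring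
  terms are combined in pairs, so only associativity is needed.
\<close>

lemma rel_homotopic_track_sum_pairs:
  assumes Z: "snd Z \<in> topspace (fst Z)"
    and "\<And>J. J \<in> set Js \<Longrightarrow> rel_map P W Z (a J)" "\<And>J. J \<in> set Js \<Longrightarrow> rel_map P W Z (b J)"
    and "\<And>J. J \<in> set Js \<Longrightarrow> rel_homotopic P W Z (track_add (a J) (b J)) (c J)"
  shows "rel_homotopic P W Z (track_sum (snd Z) (concat (map (\<lambda>J. [a J, b J]) Js))) (track_sum (snd
      Z) (map c Js))"
  using assms(2-)
proof (induction Js)
  case Nil
  show ?case
    by simp (rule rel_homotopic_refl[OF rel_map_const[OF Z]], simp)
next
  case (Cons J Js)
  let ?R = "track_sum (snd Z) (concat (map (\<lambda>J. [a J, b J]) Js))"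
  have IH: "rel_homotopic P W Z ?R (track_sum (snd Z) (map c Js))"
    by (rule Cons.IH) (auto intro: Cons.prems)
  have "rel_homotopic P W Z (track_add (a J) (track_add (b J) ?R)) (track_add (track_add (a J) (b
      J)) ?R)"
    by (rule rel_homotopic_sym[OF rel_homotopic_track_add_assoc]) (auto intro: Cons.prems
        rel_homotopic_rel_map(1)[OF IH])
  also have "rel_homotopic P W Z (track_add (track_add (a J) (b J)) ?R) (track_add (c J) (track_sum
      (snd Z) (map c Js)))"
    by (rule rel_homotopic_track_add[OF Cons.prems(3) IH]) simp
  finally show ?case by simp
qed

lemma rel_homotopic_track_sum_null:
  assumes Z: "snd Z \<in> topspace (fst Z)"
    and "\<And>F. F \<in> set Fs \<Longrightarrow> rel_homotopic P W Z F (\<lambda>_. snd Z)"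
  shows "rel_homotopic P W Z (track_sum (snd Z) Fs) (\<lambda>_. snd Z)"
  using assms(2)
proof (induction Fs)
  case Nil
  show ?case
    by simp (rule rel_homotopic_refl[OF rel_map_const[OF Z]], simp)
next
  case (Cons F Fs)
  have "rel_homotopic P W Z (track_add F (track_sum (snd Z) Fs)) (track_add (\<lambda>_. snd Z) (\<lambda>_. snd Z))"
    by (intro rel_homotopic_track_add Cons.IH Cons.prems) auto
  also have "rel_homotopic P W Z \<dots> (\<lambda>_. snd Z)"
    by (rule rel_homotopic_track_add_null_left[OF rel_map_const[OF Z]])
  finally show ?case by simp
qed

lemma rel_homotopic_track_sum_single:
  assumes Z: "snd Z \<in> topspace (fst Z)"
    and "distinct Js" "J \<in> set Js" and FJ: "rel_map P W Z (F J)"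
    and "\<And>I. \<lbrakk>I \<in> set Js; I \<noteq> J\<rbrakk> \<Longrightarrow> rel_homotopic P W Z (F I) (\<lambda>_. snd Z)"
  shows "rel_homotopic P W Z (track_sum (snd Z) (map F Js)) (F J)"
  using assms(2,3,5)
proof (induction Js)
  case (Cons I Js)
  show ?case
  proof (cases "I = J")
    case True
    have "rel_homotopic P W Z (track_add (F J) (track_sum (snd Z) (map F Js))) (track_add (F J) (\<lambda>_.
        snd Z))"
    proof (rule rel_homotopic_track_add)
      show "rel_homotopic P W Z (F J) (F J)"
        by (rule rel_homotopic_refl[OF FJ]) simp
      show "rel_homotopic P W Z (track_sum (snd Z) (map F Js)) (\<lambda>_. snd Z)"
        by (rule rel_homotopic_track_sum_null[OF Z]) (use Cons.prems True in auto)
    qed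
    also have "rel_homotopic P W Z \<dots> (F J)"
      by (rule rel_homotopic_track_add_null_right[OF FJ])
    finally show ?thesis using True by simp
  next
    case False
    have "rel_homotopic P W Z (track_add (F I) (track_sum (snd Z) (map F Js))) (track_add (\<lambda>_. snd
        Z) (F J))"
    proof (rule rel_homotopic_track_add)
      show "rel_homotopic P W Z (F I) (\<lambda>_. snd Z)"
        using Cons.prems False by simp
      show "rel_homotopic P W Z (track_sum (snd Z) (map F Js)) (F J)"
        by (rule Cons.IH) (use Cons.prems False in auto)
    qed
    also have "rel_homotopic P W Z \<dots> (F J)"
      by (rule rel_homotopic_track_add_null_left[OF FJ])
    finally show ?thesis by simp
  qed
qed simp

section \<open>Homotopy commutativity on double cylinders\<close>

definition cyl_trivial :: "'a topology \<Rightarrow> 'a set \<Rightarrow> ('a \<times> real) set"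
  where "cyl_trivial P W = topspace P \<times> {0, 1} \<union> W \<times> {0..1}"

definition box_dist :: "real \<Rightarrow> real \<Rightarrow> real"
  where "box_dist a b = min (min a (1 - a)) (min b (1 - b))"

text \<open>
  Two maps on \<open>P \<times> [0,1]\<^sup>2\<close> share the square: \<open>F\<close> is evaluated at \<open>(a, b)\<close> and \<open>G\<close> at \<open>(a', b')\<close>.  If at
  every point one of the two pairs lies on the boundary of the square, then that map takes the base
  value there and the other one counts.  The function \<open>box_dist\<close> vanishes exactly on the boundary, so
  comparing its values selects the pair in the interior by a condition that allows continuous pasting.
\<close>

definition boxes :: "(('a \<times> real) \<times> real \<Rightarrow> 'z) \<Rightarrow> (('a \<times> real) \<times> real \<Rightarrow> 'z) \<Rightarrow>
    'a \<Rightarrow> real \<Rightarrow> real \<Rightarrow> real \<Rightarrow> real \<Rightarrow> 'z"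
  where "boxes F G x a b a' b' =
    (if box_dist a b \<le> box_dist a' b' then G ((x, a'), b') else F ((x, a), b))"

lemma box_dist_nonneg: "\<lbrakk>0 \<le> a; a \<le> 1; 0 \<le> b; b \<le> 1\<rbrakk> \<Longrightarrow> 0 \<le> box_dist a b"
  by (auto simp: box_dist_def)

lemma box_dist_zero: "a = 0 \<or> a = 1 \<or> b = 0 \<or> b = 1 \<Longrightarrow> \<lbrakk>0 \<le> a; a \<le> 1; 0 \<le> b; b \<le> 1\<rbrakk> \<Longrightarrow> box_dist a b = 0"
  by (auto simp: box_dist_def)

lemma rel_map_box_dist:
  assumes "rel_map (cyl P) (cyl_trivial P W) Z F" and "x \<in> topspace P" "0 \<le> a" "a \<le> 1" "0 \<le> b" "b \<le> 1"
    and "x \<in> W \<or> box_dist a b = 0"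
  shows "F ((x, a), b) = snd Z"
proof (rule rel_mapD(2)[OF assms(1)])
  have "a = 0 \<or> a = 1 \<or> b = 0 \<or> b = 1" if "box_dist a b = 0"
    using that by (auto simp: box_dist_def min_def split: if_splits)
  then show "(x, a) \<in> cyl_trivial P W \<or> b = 0 \<or> b = 1"
    using assms(2-) by (auto simp: cyl_trivial_def)
qed (use assms in auto)

lemma boxes_eq:
  assumes F: "rel_map (cyl P) (cyl_trivial P W) Z F" and G: "rel_map (cyl P) (cyl_trivial P W) Z G"
    and x: "x \<in> topspace P"
    and r: "0 \<le> a" "a \<le> 1" "0 \<le> b" "b \<le> 1" "0 \<le> a'" "a' \<le> 1" "0 \<le> b'" "b' \<le> 1"
  shows "box_dist a' b' = 0 \<Longrightarrow> boxes F G x a b a' b' = F ((x, a), b)"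
    and "box_dist a b = 0 \<Longrightarrow> boxes F G x a b a' b' = G ((x, a'), b')"
    and "x \<in> W \<Longrightarrow> boxes F G x a b a' b' = snd Z"
proof -
  show "boxes F G x a b a' b' = F ((x, a), b)" if 0: "box_dist a' b' = 0"
  proof (cases "box_dist a b = 0")
    case True
    then show ?thesis
      using rel_map_box_dist[OF F x r(1-4)] rel_map_box_dist[OF G x r(5-8)] 0 by (simp add: boxes_def)
  next
    case False
    then show ?thesis using box_dist_nonneg[OF r(1-4)] 0 by (simp add: boxes_def)
  qed
  show "boxes F G x a b a' b' = G ((x, a'), b')" if "box_dist a b = 0"
    using that box_dist_nonneg[OF r(5-8)] by (simp add: boxes_def)
  show "boxes F G x a b a' b' = snd Z" if "x \<in> W"
    using rel_map_box_dist[OF F x r(1-4)] rel_map_box_dist[OF G x r(5-8)] that by (simp add: boxes_def)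
qed

lemma rel_homotopic_boxes:
  fixes a b a' b' :: "real \<times> real \<times> real \<Rightarrow> real"
  assumes F: "rel_map (cyl P) (cyl_trivial P W) Z F" and G: "rel_map (cyl P) (cyl_trivial P W) Z G"
    and cont: "continuous_map (prod_topology \<I> (cyl \<I>)) \<I> a" "continuous_map (prod_topology \<I> (cyl
        \<I>)) \<I> b"
      "continuous_map (prod_topology \<I> (cyl \<I>)) \<I> a'" "continuous_map (prod_topology \<I> (cyl \<I>)) \<I> b'"
    and disj: "\<And>s t r. \<lbrakk>0 \<le> s; s \<le> 1; 0 \<le> t; t \<le> 1; 0 \<le> r; r \<le> 1\<rbrakk> \<Longrightarrow>
      box_dist (a (s,t,r)) (b (s,t,r)) = 0 \<or> box_dist (a' (s,t,r)) (b' (s,t,r)) = 0"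
    and bd: "\<And>s t r. \<lbrakk>0 \<le> s; s \<le> 1; 0 \<le> t; t \<le> 1; 0 \<le> r; r \<le> 1; box_dist t r = 0\<rbrakk> \<Longrightarrow>
      box_dist (a (s,t,r)) (b (s,t,r)) = 0 \<and> box_dist (a' (s,t,r)) (b' (s,t,r)) = 0"
  shows "rel_homotopic (cyl P) (cyl_trivial P W) Z
    (\<lambda>p. let q = (0, snd (fst p), snd p) in boxes F G (fst (fst p)) (a q) (b q) (a' q) (b' q))
    (\<lambda>p. let q = (1, snd (fst p), snd p) in boxes F G (fst (fst p)) (a q) (b q) (a' q) (b' q))"
proof -
  have rng: "0 \<le> a (s,t,r)" "a (s,t,r) \<le> 1" "0 \<le> b (s,t,r)" "b (s,t,r) \<le> 1"
      "0 \<le> a' (s,t,r)" "a' (s,t,r) \<le> 1" "0 \<le> b' (s,t,r)" "b' (s,t,r) \<le> 1"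
    if "0 \<le> s" "s \<le> 1" "0 \<le> t" "t \<le> 1" "0 \<le> r" "r \<le> 1" for s t r
    using cont that by (auto simp: continuous_map_in_subtopology Pi_iff)
  let ?T = "prod_topology \<I> (cyl (cyl P))"
  let ?q = "\<lambda>p :: real \<times> ('a \<times> real) \<times> real. (fst p, snd (fst (snd p)), snd (snd p))"
  let ?x = "\<lambda>p :: real \<times> ('a \<times> real) \<times> real. fst (fst (snd p))"
  have q: "continuous_map ?T (prod_topology \<I> (cyl \<I>)) ?q"
    by (intro continuous_map_pairedI continuous_map_fst cmap; rule cmap_ident)
  have x: "continuous_map ?T P ?x"
    by (intro cmap; rule cmap_ident)
  have c: "continuous_map ?T \<I> (\<lambda>p. a (?q p))" "continuous_map ?T \<I> (\<lambda>p. b (?q p))"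
     "continuous_map ?T \<I> (\<lambda>p. a' (?q p))" "continuous_map ?T \<I> (\<lambda>p. b' (?q p))"
    by (intro cmap_compose[OF cont(1) q] cmap_compose[OF cont(2) q] cmap_compose[OF cont(3) q]
        cmap_compose[OF cont(4) q])+
  note cr = c[THEN cmap_unit_intervalD]
  show ?thesis
  proof (rule rel_homotopicI[where H = "\<lambda>p. boxes F G (?x p) (a (?q p)) (b (?q p)) (a' (?q p)) (b'
      (?q p))"])
    show "continuous_map ?T (fst Z) (\<lambda>p. boxes F G (?x p) (a (?q p)) (b (?q p)) (a' (?q p)) (b' (?q p)))"
      unfolding boxes_def
    proof (rule continuous_map_cases_le)
      show "continuous_map ?T euclideanreal (\<lambda>p. box_dist (a (?q p)) (b (?q p)))"
        "continuous_map ?T euclideanreal (\<lambda>p. box_dist (a' (?q p)) (b' (?q p)))"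
        unfolding box_dist_def by (intro real_cmap cr)+
      show "continuous_map (subtopology ?T {p \<in> topspace ?T. box_dist (a (?q p)) (b (?q p)) \<le>
          box_dist (a' (?q p)) (b' (?q p))})
          (fst Z) (\<lambda>p. G ((?x p, a' (?q p)), b' (?q p)))"
        by (intro cmap_subtopology cmap_compose[OF rel_mapD(1)[OF G]] continuous_map_pairedI x c)
      show "continuous_map (subtopology ?T {p \<in> topspace ?T. box_dist (a' (?q p)) (b' (?q p)) \<le>
          box_dist (a (?q p)) (b (?q p))})
          (fst Z) (\<lambda>p. F ((?x p, a (?q p)), b (?q p)))"
        by (intro cmap_subtopology cmap_compose[OF rel_mapD(1)[OF F]] continuous_map_pairedI x c)
      fix p assume "p \<in> topspace ?T" and eq: "box_dist (a (?q p)) (b (?q p)) = box_dist (a' (?q p))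
          (b' (?q p))"
      then obtain s y t r where p: "p = (s, (y, t), r)" and y: "y \<in> topspace P"
        and I: "0 \<le> s" "s \<le> 1" "0 \<le> t" "t \<le> 1" "0 \<le> r" "r \<le> 1"
        by (cases p) auto
      show "G ((?x p, a' (?q p)), b' (?q p)) = F ((?x p, a (?q p)), b (?q p))"
        using disj[OF I] eq rel_map_box_dist[OF F y rng(1-4)[OF I]] rel_map_box_dist[OF G y
            rng(5-8)[OF I]]
        by (auto simp: p)
    qed
  next
    fix s r :: real and z :: "'a \<times> real"
    assume s: "0 \<le> s" "s \<le> 1" and z: "z \<in> topspace (cyl P)" and r: "0 \<le> r" "r \<le> 1"
      and triv: "z \<in> cyl_trivial P W \<or> r = 0 \<or> r = 1"
    obtain y t where zy: "z = (y, t)" and y: "y \<in> topspace P" and t: "0 \<le> t" "t \<le> 1"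
      using z by (cases z) auto
    have "y \<in> W \<or> box_dist t r = 0"
      using triv t r by (auto simp: zy cyl_trivial_def box_dist_def)
    then show "boxes F G (?x (s, z, r)) (a (?q (s, z, r))) (b (?q (s, z, r))) (a' (?q (s, z, r)))
        (b' (?q (s, z, r))) = snd Z"
      using boxes_eq(2,3)[OF F G y rng[OF s t r]] bd[OF s t r] rel_map_box_dist[OF G y rng(5-8)[OF s
          t r]]
      by (auto simp: zy)
  qed (auto simp: Let_def)
qed

definition inner_add :: "(('a \<times> real) \<times> real \<Rightarrow> 'z) \<Rightarrow> (('a \<times> real) \<times> real \<Rightarrow> 'z) \<Rightarrow> ('a \<times> real) \<times> real \<Rightarrow> 'z"
  where "inner_add F G p = track_add (\<lambda>q. F (q, snd p)) (\<lambda>q. G (q, snd p)) (fst p)"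

text \<open>
  As \<open>s\<close> runs from \<open>0\<close> to \<open>1\<close>, these squeeze the identity of the interval into its lower half and its
  upper half respectively.
\<close>

definition glide0 :: "real \<Rightarrow> real \<Rightarrow> real" where "glide0 s t = min 1 (t + s * t)"
definition glide1 :: "real \<Rightarrow> real \<Rightarrow> real" where "glide1 s t = max 0 (t + s * t - s)"

lemma glide_range:
  assumes "0 \<le> s" "s \<le> 1" "0 \<le> t" "t \<le> 1"
  shows "0 \<le> glide0 s t" "glide0 s t \<le> 1" "0 \<le> glide1 s t" "glide1 s t \<le> 1"
proof -
  have "s * t \<le> s" using assms by (simp add: mult_left_le)
  then show "0 \<le> glide0 s t" "glide0 s t \<le> 1" "0 \<le> glide1 s t" "glide1 s t \<le> 1"
    using assms by (auto simp: glide0_def glide1_def)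
qed

lemma glide_simps [simp]:
  "s \<ge> 0 \<Longrightarrow> glide0 s 0 = 0" "s \<ge> 0 \<Longrightarrow> glide0 s 1 = 1" "s \<ge> 0 \<Longrightarrow> glide1 s 0 = 0" "glide1 s 1 = 1"
  "\<lbrakk>0 \<le> t; t \<le> 1\<rbrakk> \<Longrightarrow> glide0 0 t = t" "\<lbrakk>0 \<le> t; t \<le> 1\<rbrakk> \<Longrightarrow> glide1 0 t = t"
  by (auto simp: glide0_def glide1_def)

lemma glide_disjoint: "glide0 1 t = 1 \<or> glide1 1 t = 0"
  by (auto simp: glide0_def glide1_def)

lemma glide_half:
  "t \<le> 1/2 \<Longrightarrow> glide0 1 t = 2 * t" "t \<le> 1/2 \<Longrightarrow> glide1 1 t = 0"
  "1/2 \<le> t \<Longrightarrow> glide0 1 t = 1" "1/2 \<le> t \<Longrightarrow> glide1 1 t = 2 * t - 1"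
  by (auto simp: glide0_def glide1_def)

lemma cmap_glide:
  assumes f: "continuous_map X \<I> f" and g: "continuous_map X \<I> g"
  shows "continuous_map X \<I> (\<lambda>x. glide0 (f x) (g x))" "continuous_map X \<I> (\<lambda>x. glide1 (f x) (g x))"
proof -
  have "0 \<le> f x \<and> f x \<le> 1" "0 \<le> g x \<and> g x \<le> 1" if "x \<in> topspace X" for x
    using f g that unfolding continuous_map_unit_interval by blast+
  note * = this glide_range
  have "continuous_map X euclideanreal (\<lambda>x. glide0 (f x) (g x))" "continuous_map X euclideanreal
      (\<lambda>x. glide1 (f x) (g x))"
    unfolding glide0_def glide1_def by (intro real_cmap f[THEN cmap_unit_intervalD] g[THEN
        cmap_unit_intervalD])+
  then show "continuous_map X \<I> (\<lambda>x. glide0 (f x) (g x))" "continuous_map X \<I> (\<lambda>x. glide1 (f x) (g x))"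
    by (intro cmap_unit_intervalI; simp add: *)+
qed

lemma cmap_one: "continuous_map X \<I> (\<lambda>_. 1)" by simp

lemmas glide_coords = cmap_glide cmap_one homotopy_coords(1) homotopy_coords(2,3)[of \<I>]

text \<open>
  The Eckmann-Hilton argument.  Squeeze \<open>F\<close> and \<open>G\<close> into two opposite quarters of the square; from there
  the sum in either coordinate is reached by letting the supports grow again in the other coordinate.
  The two choices of opposite quarters give the two orders of the outer sum.
\<close>

lemma rel_homotopic_track_add_inner_add:
  assumes F: "rel_map (cyl P) (cyl_trivial P W) Z F" and G: "rel_map (cyl P) (cyl_trivial P W) Z G"
  shows "rel_homotopic (cyl P) (cyl_trivial P W) Z (track_add F G) (inner_add F G)"
    and "rel_homotopic (cyl P) (cyl_trivial P W) Z (track_add G F) (inner_add F G)"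
proof -
  let ?lt = "\<lambda>q :: real \<times> real \<times> real. glide0 (fst q) (fst (snd q))" and ?ut = "\<lambda>q :: real \<times> real \<times>
      real. glide1 (fst q) (fst (snd q))"
  let ?lr = "\<lambda>q :: real \<times> real \<times> real. glide0 (fst q) (snd (snd q))" and ?ur = "\<lambda>q :: real \<times> real \<times>
      real. glide1 (fst q) (snd (snd q))"
  let ?lt1 = "\<lambda>q :: real \<times> real \<times> real. glide0 1 (fst (snd q))" and ?ut1 = "\<lambda>q :: real \<times> real \<times>
      real. glide1 1 (fst (snd q))"
  let ?lr1 = "\<lambda>q :: real \<times> real \<times> real. glide0 1 (snd (snd q))" and ?ur1 = "\<lambda>q :: real \<times> real \<times>
      real. glide1 1 (snd (snd q))"
  let ?B = "\<lambda>s a b a' b' p. let q = (s, snd (fst p), snd p) in boxes F G (fst (fst p)) (a q) (b q)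
      (a' q) (b' q)"
  note bz = box_dist_zero[OF _ glide_range(1,2) glide_range(1,2)] box_dist_zero[OF _
      glide_range(1,2) glide_range(3,4)]
     box_dist_zero[OF _ glide_range(3,4) glide_range(1,2)] box_dist_zero[OF _ glide_range(3,4)
         glide_range(3,4)]
  have tr: "t = 0 \<or> t = 1 \<or> r = 0 \<or> r = 1" if "box_dist t r = 0" for t r
    using that by (auto simp: box_dist_def min_def split: if_splits)
  have 1: "rel_homotopic (cyl P) (cyl_trivial P W) Z (?B 0 ?lt ?lr1 ?ut ?ur1) (?B 1 ?lt ?lr1 ?ut ?ur1)"
    apply (rule rel_homotopic_boxes[OF F G])
    apply (intro glide_coords)+
    subgoal for s t r using glide_disjoint[of r] by (auto intro!: bz)
    subgoal for s t r using tr[of t r] by (auto intro!: bz)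
    done
  have 2: "rel_homotopic (cyl P) (cyl_trivial P W) Z (?B 0 ?lt1 ?lr ?ut1 ?ur) (?B 1 ?lt1 ?lr ?ut1 ?ur)"
    apply (rule rel_homotopic_boxes[OF F G])
    apply (intro glide_coords)+
    subgoal for s t r using glide_disjoint[of t] by (auto intro!: bz)
    subgoal for s t r using tr[of t r] by (auto intro!: bz)
    done
  have 3: "rel_homotopic (cyl P) (cyl_trivial P W) Z (?B 0 ?lt ?ur1 ?ut ?lr1) (?B 1 ?lt ?ur1 ?ut ?lr1)"
    apply (rule rel_homotopic_boxes[OF F G])
    apply (intro glide_coords)+
    subgoal for s t r using glide_disjoint[of r] by (auto intro!: bz)
    subgoal for s t r using tr[of t r] by (auto intro!: bz)
    done
  have 4: "rel_homotopic (cyl P) (cyl_trivial P W) Z (?B 0 ?lt1 ?ur ?ut1 ?lr) (?B 1 ?lt1 ?ur ?ut1 ?lr)"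
    apply (rule rel_homotopic_boxes[OF F G])
    apply (intro glide_coords)+
    subgoal for s t r using glide_disjoint[of t] by (auto intro!: bz)
    subgoal for s t r using tr[of t r] by (auto intro!: bz)
    done

  have e1: "boxes F G x t (glide0 1 r) t (glide1 1 r) = track_add F G ((x, t), r)"
    and e2: "boxes F G x t (glide1 1 r) t (glide0 1 r) = track_add G F ((x, t), r)"
    and e3: "boxes F G x (glide0 1 t) r (glide1 1 t) r = inner_add F G ((x, t), r)"
    if "x \<in> topspace P" "0 \<le> t" "t \<le> 1" "0 \<le> r" "r \<le> 1" for x t r
  proof -
    note r01 = glide_range[of 1 r, simplified, OF that(4,5)] and t01 = glide_range[of 1 t,
        simplified, OF that(2,3)]
    note be1 = boxes_eq(1,2)[OF F G that(1), of t "glide0 1 r" t "glide1 1 r"]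
      and be2 = boxes_eq(1,2)[OF F G that(1), of t "glide1 1 r" t "glide0 1 r"]
      and be3 = boxes_eq(1,2)[OF F G that(1), of "glide0 1 t" r "glide1 1 t" r]
    show "boxes F G x t (glide0 1 r) t (glide1 1 r) = track_add F G ((x, t), r)"
      using be1 that r01 by (cases "r \<le> 1/2") (auto simp: track_add_def glide_half box_dist_zero)
    show "boxes F G x t (glide1 1 r) t (glide0 1 r) = track_add G F ((x, t), r)"
      using be2 that r01 by (cases "r \<le> 1/2") (auto simp: track_add_def glide_half box_dist_zero)
    show "boxes F G x (glide0 1 t) r (glide1 1 t) r = inner_add F G ((x, t), r)"
      using be3 that t01 by (cases "t \<le> 1/2") (auto simp: inner_add_def track_add_def glide_half
          box_dist_zero)
  qed
  note ends = 1[unfolded Let_def fst_conv snd_conv] 2[unfolded Let_def fst_conv snd_conv]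
    3[unfolded Let_def fst_conv snd_conv] 4[unfolded Let_def fst_conv snd_conv]
  show "rel_homotopic (cyl P) (cyl_trivial P W) Z (track_add F G) (inner_add F G)"
    by (rule rel_homotopic_cong[OF rel_homotopic_trans[OF ends(1) rel_homotopic_sym[OF ends(2)]]])
        (auto simp: e1 e3)
  show "rel_homotopic (cyl P) (cyl_trivial P W) Z (track_add G F) (inner_add F G)"
    by (rule rel_homotopic_cong[OF rel_homotopic_trans[OF ends(3) rel_homotopic_sym[OF ends(4)]]])
        (auto simp: e2 e3)
qed

lemma rel_homotopic_track_add_commute:
  assumes "rel_map (cyl P) (cyl_trivial P W) Z F" and "rel_map (cyl P) (cyl_trivial P W) Z G"
  shows "rel_homotopic (cyl P) (cyl_trivial P W) Z (track_add F G) (track_add G F)"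
  using rel_homotopic_trans[OF rel_homotopic_track_add_inner_add(1)[OF assms] rel_homotopic_sym[OF
      rel_homotopic_track_add_inner_add(2)[OF assms]]] .

text \<open>
  By commutativity and associativity any term can be moved to the front.
\<close>

lemma rel_homotopic_track_sum_mset:
  assumes Z: "snd Z \<in> topspace (fst Z)"
    and "mset Fs = mset Gs" and "\<And>F. F \<in> set Fs \<Longrightarrow> rel_map (cyl P) (cyl_trivial P W) Z F"
  shows "rel_homotopic (cyl P) (cyl_trivial P W) Z (track_sum (snd Z) Fs) (track_sum (snd Z) Gs)"
  using assms(2,3)
proof (induction Fs arbitrary: Gs)
  case Nil
  show ?case
    by (rule rel_homotopic_refl[OF rel_map_track_sum[OF Z]]) (use Nil in auto)
next
  case (Cons F Fs)
  let ?rel_homotopic = "rel_homotopic (cyl P) (cyl_trivial P W) Z" and ?rel_map = "rel_map (cyl P)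
      (cyl_trivial P W) Z"
  have F: "?rel_map F" using Cons.prems by simp
  have "F \<in> set Gs" using Cons.prems(1) by (metis list.set_intros(1) set_mset_mset)
  then obtain us vs where Gs: "Gs = us @ F # vs" by (meson split_list)
  then have m: "mset Fs = mset (us @ vs)" using Cons.prems(1) by simp
  then have sm: "?rel_map G" if "G \<in> set (us @ vs)" for G
    using Cons.prems(2) that by (metis list.set_intros(2) set_mset_mset)
  have front: "?rel_homotopic (track_sum (snd Z) (us @ F # vs)) (track_add F (track_sum (snd Z) (us
      @ vs)))"
    using sm
  proof (induction us)
    case Nil
    show ?case by simp (intro rel_homotopic_refl rel_map_track_add F rel_map_track_sum Z Nil; simp)
  next
    case (Cons u us)
    let ?R = "track_sum (snd Z) (us @ vs)"
    have u: "?rel_map u" and R: "?rel_map ?R"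
      using Cons.prems by (auto intro!: rel_map_track_sum[OF Z])
    have "?rel_homotopic (track_add u (track_sum (snd Z) (us @ F # vs))) (track_add u (track_add F ?R))"
      by (intro rel_homotopic_track_add rel_homotopic_refl[OF u] Cons.IH Cons.prems) auto
    also have "?rel_homotopic \<dots> (track_add (track_add u F) ?R)"
      by (rule rel_homotopic_sym[OF rel_homotopic_track_add_assoc[OF u F R]])
    also have "?rel_homotopic \<dots> (track_add (track_add F u) ?R)"
      by (intro rel_homotopic_track_add rel_homotopic_refl[OF R] rel_homotopic_track_add_commute[OF
          u F]) auto
    also have "?rel_homotopic \<dots> (track_add F (track_add u ?R))"
      by (rule rel_homotopic_track_add_assoc[OF F u R])
    finally show ?case by simp
  qed
  have "?rel_homotopic (track_add F (track_sum (snd Z) Fs)) (track_add F (track_sum (snd Z) (us @ vs)))"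
    by (intro rel_homotopic_track_add rel_homotopic_refl[OF F] Cons.IH m Cons.prems(2)) auto
  also have "?rel_homotopic \<dots> (track_sum (snd Z) Gs)"
    using rel_homotopic_sym[OF front] by (simp add: Gs)
  finally show ?case by simp
qed

section \<open>Reduced suspensions\<close>

lemma susp_collapse_eq:
  "susp_collapse P p = (if p \<in> cyl_trivial (fst P) {snd P} then (snd P, 0) else p)"
  by (simp add: susp_collapse_def collapse_map_def cyl_trivial_def)

lemma susp_eq: "susp P = collapse (cyl (fst P)) (cyl_trivial (fst P) {snd P}) (snd P, 0)"
  by (simp add: susp_def cyl_trivial_def)

lemma snd_susp [simp]: "snd (susp P) = (snd P, 0)"
  by (simp add: susp_eq collapse_def)

lemma quotient_map_susp: "quotient_map (cyl (fst P)) (fst (susp P)) (susp_collapse P)"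
  unfolding susp_def collapse_def susp_collapse_def by (simp add: quotient_map_quotient_topology)

lemma base_susp [simp]:
  assumes "snd P \<in> topspace (fst P)" shows "(snd P, 0) \<in> topspace (fst (susp P))"
proof -
  have "susp_collapse P (snd P, 0) \<in> topspace (fst (susp P))"
    using quotient_imp_surjective_map[OF quotient_map_susp[of P]] assms by force
  then show ?thesis using assms by (simp add: susp_collapse_eq)
qed

text \<open>
  The suspension of a map, as a map on the cylinder of its source: only the target is collapsed.
\<close>

definition presusp :: "'z based \<Rightarrow> ('a \<Rightarrow> 'z) \<Rightarrow> 'a \<times> real \<Rightarrow> 'z \<times> real"
  where "presusp Z F p = susp_collapse Z (F (fst p), snd p)"

lemma presusp_base: "F x = snd Z \<Longrightarrow> 0 \<le> r \<Longrightarrow> r \<le> 1 \<Longrightarrow> presusp Z F (x, r) = (snd Z, 0)"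
  by (simp add: presusp_def susp_collapse_eq cyl_trivial_def)

lemma presusp_ends: "F x \<in> topspace (fst Z) \<Longrightarrow> r = 0 \<or> r = 1 \<Longrightarrow> presusp Z F (x, r) = (snd Z, 0)"
  by (auto simp add: presusp_def susp_collapse_eq cyl_trivial_def)

lemma presusp_track_add: "presusp Z (track_add F G) = inner_add (presusp Z F) (presusp Z G)"
  by (rule ext) (simp add: presusp_def inner_add_def track_add_def)

lemma rel_map_presusp:
  assumes "continuous_map P (fst Z) f" and "\<And>x. x \<in> topspace P \<Longrightarrow> x \<in> W \<Longrightarrow> f x = snd Z"
  shows "rel_map P W (susp Z) (presusp Z f)"
  unfolding rel_map_def
proof (intro conjI allI impI)
  show "continuous_map (cyl P) (fst (susp Z)) (presusp Z f)"
    unfolding presusp_def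
    by (intro cmap_compose[OF quotient_imp_continuous_map[OF quotient_map_susp]] continuous_map_pairedI
      cmap_compose[OF assms(1)] continuous_map_fst continuous_map_snd)
  fix x t assume *: "x \<in> topspace P \<and> 0 \<le> t \<and> t \<le> 1 \<and> (x \<in> W \<or> t = 0 \<or> t = (1::real))"
  moreover have "f x \<in> topspace (fst Z)"
    using continuous_map_image_subset_topspace[OF assms(1)] * by blast
  ultimately show "presusp Z f (x, t) = snd (susp Z)"
    using presusp_base[of f x Z t] presusp_ends[of f x Z t] assms(2)[of x] by auto
qed

lemma rel_homotopic_presusp:
  assumes "rel_homotopic P W Z F G"
  shows "rel_homotopic (cyl P) (cyl_trivial P W) (susp Z) (presusp Z F) (presusp Z G)"
proof -
  obtain H where H: "rel_homotopy P W Z H F G"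
    using assms unfolding rel_homotopic_def by blast
  let ?T = "prod_topology \<I> (cyl (cyl P))"
  show ?thesis
  proof (rule rel_homotopicI[where H = "\<lambda>p. susp_collapse Z (H (fst p, fst (snd p)), snd (snd p))"])
    show "continuous_map ?T (fst (susp Z)) (\<lambda>p. susp_collapse Z (H (fst p, fst (snd p)), snd (snd p)))"
      by (intro cmap_compose[OF quotient_imp_continuous_map[OF quotient_map_susp]] continuous_map_pairedI
        cmap_compose[OF rel_homotopyD(1)[OF H]] homotopy_coords)
    fix s r :: real and z assume s: "0 \<le> s" "s \<le> 1" and z: "z \<in> topspace (cyl P)" and r: "0 \<le> r" "r \<le> 1"
      and triv: "z \<in> cyl_trivial P W \<or> r = 0 \<or> r = 1"
    obtain x t where zx: "z = (x, t)" "x \<in> topspace P" "0 \<le> t" "t \<le> 1"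
      using z by (cases z) auto
    have "H (s, x, t) = snd Z" if "z \<in> cyl_trivial P W"
      using rel_homotopyD(4)[OF H s zx(2-4)] that zx by (auto simp: cyl_trivial_def)
    moreover have "H (s, x, t) \<in> topspace (fst Z)"
      using continuous_map_image_subset_topspace[OF rel_homotopyD(1)[OF H]] s zx by (auto simp:
          image_subset_iff)
    ultimately show "susp_collapse Z (H (fst (s, z, r), fst (snd (s, z, r))), snd (snd (s, z, r))) =
        snd (susp Z)"
      using triv r zx by (auto simp: susp_collapse_eq cyl_trivial_def)
  qed (auto simp: presusp_def rel_homotopyD[OF H])
qed

lemma topspace_collapse: "b \<in> W \<Longrightarrow> topspace (fst (collapse P W b)) = collapse_map W b ` topspace P"
  using quotient_imp_surjective_map[OF quotient_map_quotient_topology[of P "collapse_map W b"]]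
  by (simp add: collapse_def)

lemma quotient_map_collapse: "quotient_map P (fst (collapse P W b)) (collapse_map W b)"
  by (simp add: collapse_def quotient_map_quotient_topology)

text \<open>
  Quotients are carried by representatives, so a homotopy that is trivial on \<open>W\<close> is itself the induced
  homotopy on the quotient; only its continuity has to be transferred.
\<close>

lemma rel_homotopic_collapse:
  assumes rel_homotopic: "rel_homotopic P W Z F G" and b: "b \<in> W" and W: "W \<subseteq> topspace P"
  shows "rel_homotopic (fst (collapse P W b)) {b} Z F G"
proof -
  obtain H where H: "rel_homotopy P W Z H F G"
    using rel_homotopic unfolding rel_homotopic_def by blast
  let ?c = "collapse_map W b" and ?Q = "fst (collapse P W b)"
  have Q: "x \<in> topspace P \<and> (x \<in> W \<longrightarrow> x = b)" if "x \<in> topspace ?Q" for x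
    using that b W by (auto simp: topspace_collapse collapse_map_def split: if_splits)
  show ?thesis
  proof (rule rel_homotopicI[where H = H])
    have fin: "final_maps {()} (\<lambda>_. prod_topology \<I> (cyl P)) (\<lambda>_ p. (fst p, (?c (fst (snd p)), snd
        (snd p)))) (prod_topology \<I> (cyl ?Q))"
      using final_maps_prod_left[OF final_maps_prod_right[OF final_maps_quotient_map[OF
          quotient_map_collapse[of P W b]]]] .
    show "continuous_map (prod_topology \<I> (cyl ?Q)) (fst Z) H"
    proof (rule continuous_map_from_final[OF fin])
      show "continuous_map (prod_topology \<I> (cyl P)) (fst Z) (\<lambda>p. H (fst p, (?c (fst (snd p)), snd
          (snd p))))"
      proof (rule continuous_map_eq[OF rel_homotopyD(1)[OF H]])
        fix p assume "p \<in> topspace (prod_topology \<I> (cyl P))"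
        then show "H p = H (fst p, (?c (fst (snd p)), snd (snd p)))"
          using W b by (cases p) (auto simp: collapse_map_def rel_homotopyD(4)[OF H])
      qed
    qed
  qed (use Q b rel_homotopyD[OF H] in auto)
qed

lemma based_homotopic_susp:
  assumes rel_homotopic: "rel_homotopic (fst B) {snd B} Z F G" and B: "snd B \<in> topspace (fst B)"
  shows "based_homotopic (susp B) Z F G"
proof -
  obtain H where H: "rel_homotopy (fst B) {snd B} Z H F G"
    using rel_homotopic unfolding rel_homotopic_def by blast
  let ?T = "fst (susp B)"
  have T: "\<exists>x t. p = (x, t) \<and> x \<in> topspace (fst B) \<and> 0 \<le> t \<and> t \<le> 1" if "p \<in> topspace ?T" for p
  proof -
    have "p \<in> susp_collapse B ` topspace (cyl (fst B))"
      using quotient_imp_surjective_map[OF quotient_map_susp[of B]] that by simp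
    then show ?thesis
      using B by (auto simp: susp_collapse_eq split: if_splits)
  qed
  have "continuous_map (prod_topology \<I> ?T) (fst Z) H"
  proof (rule continuous_map_from_final[OF final_maps_prod_left[OF final_maps_quotient_map[OF
      quotient_map_susp[of B]]]])
    show "continuous_map (prod_topology \<I> (cyl (fst B))) (fst Z) (\<lambda>p. H (fst p, susp_collapse B (snd
        p)))"
    proof (rule continuous_map_eq[OF rel_homotopyD(1)[OF H]])
      fix p assume "p \<in> topspace (prod_topology \<I> (cyl (fst B)))"
      then show "H p = H (fst p, susp_collapse B (snd p))"
        using B by (cases p) (auto simp: susp_collapse_eq cyl_trivial_def rel_homotopyD(4)[OF H])
    qed
  qed
  moreover have "H (0, p) = F p" "H (1, p) = G p" if "p \<in> topspace ?T" for p
    using T[OF that] rel_homotopyD(2,3)[OF H] by auto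
  moreover have "H (s, snd (susp B)) = snd Z" if "s \<in> {0..1}" for s
    using rel_homotopyD(4)[OF H, of s "snd B" 0] that B by auto
  ultimately show ?thesis
    unfolding based_homotopic_def using base_susp[OF B]
    by (subst homotopic_with) auto
qed

lemma based_homotopic_susp2:
  assumes rel_homotopic: "rel_homotopic (cyl (fst B)) (cyl_trivial (fst B) {snd B}) Z F G" and B:
      "snd B \<in> topspace (fst B)"
  shows "based_homotopic (susp2 B) Z F G"
  unfolding susp2_def
proof (rule based_homotopic_susp)
  have "rel_homotopic (fst (collapse (cyl (fst B)) (cyl_trivial (fst B) {snd B}) (snd B, 0))) {(snd
      B, 0)} Z F G"
    by (rule rel_homotopic_collapse[OF rel_homotopic]) (use B in \<open>auto simp: cyl_trivial_def\<close>)
  then show "rel_homotopic (fst (susp B)) {snd (susp B)} Z F G"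
    by (simp add: susp_eq[of B, symmetric])
  show "snd (susp B) \<in> topspace (fst (susp B))"
    using base_susp[OF B] by simp
qed

lemma based_homotopic_imp_based_map:
  assumes "based_homotopic P Q f g" shows "based_map P Q f"
  using homotopic_with_imp_continuous_maps[OF assms[unfolded based_homotopic_def]]
    homotopic_with_imp_property[OF assms[unfolded based_homotopic_def]]
  by (simp add: based_map_def)

lemma susp_rep:
  assumes B: "snd B \<in> topspace (fst B)" and p: "p \<in> topspace (fst (susp B))"
  shows "susp_collapse B p = p" "p \<in> topspace (cyl (fst B))"
proof -
  obtain q where q: "q \<in> topspace (cyl (fst B))" "p = susp_collapse B q"
    using quotient_imp_surjective_map[OF quotient_map_susp[of B]] p by blast
  then show "susp_collapse B p = p" "p \<in> topspace (cyl (fst B))"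
    using B by (auto simp: susp_collapse_eq cyl_trivial_def)
qed

text \<open>
  A map that is trivial on the collapsed points does not notice whether its argument has been replaced
  by the representative of its class.
\<close>

lemma double_collapse:
  assumes F: "rel_map (cyl (fst B)) (cyl_trivial (fst B) {snd B}) Z F" and B: "snd B \<in> topspace (fst B)"
    and x: "x \<in> topspace (fst B)" and t: "0 \<le> t" "t \<le> 1" and r: "0 \<le> r" "r \<le> 1"
  shows "F (susp_collapse (susp B) (susp_collapse B (x, t), r)) = F ((x, t), r)"
proof -
  have triv: "F (z, s) = snd Z" if "z \<in> topspace (cyl (fst B))" "0 \<le> s" "s \<le> 1" "z \<in> cyl_trivial
      (fst B) {snd B} \<or> s = 0 \<or> s = 1" for z s
    using rel_mapD(2)[OF F that(1-3)] that(4) by blast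
  have xt: "(x, t) \<in> topspace (cyl (fst B))" using x t by simp
  have b0: "(snd B, 0) \<in> topspace (cyl (fst B))" "(snd B, 0) \<in> cyl_trivial (fst B) {snd B}"
    using B by (auto simp: cyl_trivial_def)
  have Fb: "F ((snd B, 0), 0) = snd Z" using triv[OF b0(1), of 0] by simp
  show ?thesis
  proof (cases "(x, t) \<in> cyl_trivial (fst B) {snd B}")
    case True
    then have "susp_collapse B (x, t) = (snd B, 0)" by (simp add: susp_collapse_eq)
    then have "susp_collapse (susp B) (susp_collapse B (x, t), r) = ((snd B, 0), 0)"
      using r by (simp add: susp_collapse_eq[of "susp B"] cyl_trivial_def)
    then show ?thesis using triv[OF xt r] True Fb by simp
  next
    case False
    then have xt': "susp_collapse B (x, t) = (x, t)" by (simp add: susp_collapse_eq)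
    then have inS: "(x, t) \<in> topspace (fst (susp B))"
      using quotient_imp_surjective_map[OF quotient_map_susp[of B]] xt by (metis imageI)
    have "(x, t) \<noteq> (snd B, 0)" using False b0 by auto
    then have "susp_collapse (susp B) ((x, t), r) = (if r = 0 \<or> r = 1 then ((snd B, 0), 0) else ((x,
        t), r))"
      using inS by (auto simp: susp_collapse_eq[of "susp B"] cyl_trivial_def)
    then show ?thesis using triv[OF xt r] Fb xt' by auto
  qed
qed

lemma based_homotopic_cong:
  assumes "based_homotopic B C f g" and "snd B \<in> topspace (fst B)"
    and "\<And>x. x \<in> topspace (fst B) \<Longrightarrow> f x = f' x" and "\<And>x. x \<in> topspace (fst B) \<Longrightarrow> g x = g' x"
  shows "based_homotopic B C f' g'"
proof -
  have "homotopic_with (\<lambda>h. h (snd B) = snd C) (fst B) (fst C) f' g' \<longleftrightarrow>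
    homotopic_with (\<lambda>h. h (snd B) = snd C) (fst B) (fst C) f g"
    using assms(2-) by (subst (1 2) homotopic_with) auto
  then show ?thesis using assms(1) by (simp add: based_homotopic_def)
qed

lemma susp2_rep:
  assumes B: "snd B \<in> topspace (fst B)" and p: "p \<in> topspace (fst (susp2 B))"
  obtains x t r where "p = ((x, t), r)" "x \<in> topspace (fst B)" "0 \<le> t" "t \<le> 1" "0 \<le> r" "r \<le> 1"
    "susp_collapse (susp B) (susp_collapse B (x, t), r) = p"
proof -
  have SB: "snd (susp B) \<in> topspace (fst (susp B))" using base_susp[OF B] by simp
  note 1 = susp_rep[OF SB p[unfolded susp2_def]]
  obtain z r where z: "p = (z, r)" by (cases p)
  then have "z \<in> topspace (fst (susp B))" "0 \<le> r" "r \<le> 1" using 1(2) by auto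
  note 2 = susp_rep[OF B this(1)] this(2,3)
  obtain x t where "z = (x, t)" by (cases z)
  then show ?thesis using 1 2 z by (intro that[of x t r]) auto
qed

lemma susp_map_collapse:
  assumes "a (snd B) = snd C" and "x \<in> topspace (fst B)" "a x \<in> topspace (fst C)" "0 \<le> t" "t \<le> 1"
  shows "susp_map C a (susp_collapse B (x, t)) = susp_collapse C (a x, t)"
  using assms by (auto simp: susp_map_def susp_collapse_eq cyl_trivial_def)

lemma susp2_map_collapse:
  assumes a: "a (snd B) = snd C" and x: "x \<in> topspace (fst B)" "a x \<in> topspace (fst C)"
    and t: "0 \<le> t" "t \<le> 1" and r: "0 \<le> r" "r \<le> 1" and C: "snd C \<in> topspace (fst C)"
  shows "susp2_map C a (susp_collapse (susp B) (susp_collapse B (x, t), r))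
    = susp_collapse (susp C) (susp_collapse C (a x, t), r)"
proof -
  have base: "susp_map C a (snd (susp B)) = snd (susp C)"
    using C by (simp add: susp_map_def a susp_collapse_eq cyl_trivial_def)
  note step = susp_map_collapse[where a = a, OF a x t]
  have "susp_map (susp C) (susp_map C a) (susp_collapse (susp B) (susp_collapse B (x, t), r))
      = susp_collapse (susp C) (susp_map C a (susp_collapse B (x, t)), r)"
  proof (rule susp_map_collapse[where a = "susp_map C a", OF base _ _ r])
    show "susp_collapse B (x, t) \<in> topspace (fst (susp B))"
      using continuous_map_image_subset_topspace[OF quotient_imp_continuous_map[OF
          quotient_map_susp[of B]]] x(1) t
      by (auto simp: image_subset_iff)
    show "susp_map C a (susp_collapse B (x, t)) \<in> topspace (fst (susp C))"
      unfolding step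
      using continuous_map_image_subset_topspace[OF quotient_imp_continuous_map[OF
          quotient_map_susp[of C]]] x(2) t
      by (auto simp: image_subset_iff)
  qed
  then show ?thesis by (simp only: susp2_map_def step)
qed

section \<open>Subtracting a retraction\<close>

text \<open>
  The map \<open>D\<close> that represents \<open>1 - r\<close>.  For \<open>v x \<ge> 1/2\<close> it runs along the suspension line of \<open>k (1, x)\<close>
  and back along that of \<open>r x\<close>.  For \<open>v x \<le> 1/2\<close> the two lines are the same, and the path turns back
  already at height \<open>2 v x\<close>; at \<open>v x = 0\<close> it does not leave the base point.
\<close>

definition cancel :: "(real \<times> 'a \<Rightarrow> 'a) \<Rightarrow> ('a \<Rightarrow> 'a) \<Rightarrow> ('a \<Rightarrow> real) \<Rightarrow> 'a \<times> real \<Rightarrow> 'a \<times> real"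
  where "cancel k r v p =
    (if snd p \<le> 1/2 then (k (1, fst p), min (2 * snd p) (2 * v (fst p)))
     else (r (fst p), min (2 - 2 * snd p) (2 * v (fst p))))"

text \<open>
  The fixed points of \<open>r\<close> are meant to be zeros of \<open>v\<close>; the set \<open>v < 1\<close> is then a neighbourhood of them that
  the homotopy \<open>k\<close> of the whole space moves into them.
\<close>

locale numerable_retraction =
  fixes P :: "'a topology" and k :: "real \<times> 'a \<Rightarrow> 'a" and r :: "'a \<Rightarrow> 'a" and v :: "'a \<Rightarrow> real"
  assumes k: "continuous_map (prod_topology \<I> P) P k"
    and r: "continuous_map P P r"
    and v: "continuous_map P \<I> v"
    and k0: "\<And>x. x \<in> topspace P \<Longrightarrow> k (0, x) = x"
    and k1: "\<And>x. \<lbrakk>x \<in> topspace P; v x < 1\<rbrakk> \<Longrightarrow> k (1, x) = r x"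
begin

lemma v_range: "x \<in> topspace P \<Longrightarrow> 0 \<le> v x" "x \<in> topspace P \<Longrightarrow> v x \<le> 1"
  using v by (auto simp: continuous_map_unit_interval)

lemma r_in: "x \<in> topspace P \<Longrightarrow> r x \<in> topspace P"
  using continuous_map_image_subset_topspace[OF r] by blast

lemma k_in: "0 \<le> s \<Longrightarrow> s \<le> 1 \<Longrightarrow> x \<in> topspace P \<Longrightarrow> k (s, x) \<in> topspace P"
  using continuous_map_image_subset_topspace[OF k] by (auto simp: image_subset_iff)

text \<open>
  Composing with \<open>D\<close> enlarges the trivial part by the points with \<open>v x = 0\<close>.  At the turning point
  \<open>t = 1/2\<close> either the height is 1, so that both branches have the base value, or \<open>v x < 1/2\<close> and the
  branches agree because \<open>k (1, x) = r x\<close>.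
\<close>

lemma rel_homotopic_cancel:
  assumes rel_homotopic: "rel_homotopic P W Z q q'"
    and W: "\<And>x. x \<in> W \<Longrightarrow> x \<in> topspace P \<Longrightarrow> k (1, x) \<in> W \<and> r x \<in> W"
    and T: "\<And>x. x \<in> T \<Longrightarrow> x \<in> topspace P \<Longrightarrow> v x = 0"
  shows "rel_homotopic P (W \<union> T) Z (\<lambda>p. q (cancel k r v p)) (\<lambda>p. q' (cancel k r v p))"
proof -
  obtain H where H: "rel_homotopy P W Z H q q'"
    using rel_homotopic unfolding rel_homotopic_def by blast
  let ?T = "prod_topology \<I> (cyl P)"
  let ?x = "\<lambda>p :: real \<times> 'a \<times> real. fst (snd p)" and ?t = "\<lambda>p :: real \<times> 'a \<times> real. snd (snd p)"
  have vr: "continuous_map ?T euclideanreal (\<lambda>p. v (?x p))"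
    by (rule cmap_compose[OF cmap_unit_intervalD[OF v] homotopy_coords(2)])
  have kx: "continuous_map ?T P (\<lambda>p. k (1, ?x p))"
    by (intro cmap_compose[OF k] continuous_map_pairedI homotopy_coords cmap_one)
  have rx: "continuous_map ?T P (\<lambda>p. r (?x p))"
    by (rule cmap_compose[OF r homotopy_coords(2)])
  have canc: "fst (cancel k r v (x, t)) \<in> topspace P" "0 \<le> snd (cancel k r v (x, t))" "snd (cancel k
      r v (x, t)) \<le> 1"
    if "x \<in> topspace P" "0 \<le> t" "t \<le> 1" for x t
    using that v_range[OF that(1)] r_in[OF that(1)] k_in[of 1 x] by (auto simp: cancel_def)
  have tw: "fst (cancel k r v (x, t)) \<in> W \<or> snd (cancel k r v (x, t)) = 0 \<or> snd (cancel k r v (x,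
      t)) = 1"
    if "x \<in> topspace P" "0 \<le> t" "t \<le> 1" "x \<in> W \<union> T \<or> t = 0 \<or> t = 1" for x t
    using that W[of x] T[of x] v_range[OF that(1)] by (auto simp: cancel_def)
  show ?thesis
  proof (rule rel_homotopicI[where H = "\<lambda>p. H (fst p, cancel k r v (snd p))"])
    have "continuous_map ?T (fst Z)
      (\<lambda>p. if ?t p \<le> 1/2 then H (fst p, (k (1, ?x p), min (2 * ?t p) (2 * v (?x p))))
        else H (fst p, (r (?x p), min (2 - 2 * ?t p) (2 * v (?x p)))))"
    proof (rule continuous_map_cases_le)
      show "continuous_map (subtopology ?T {p \<in> topspace ?T. ?t p \<le> 1/2}) (fst Z) (\<lambda>p. H (fst p, (k
          (1, ?x p), min (2 * ?t p) (2 * v (?x p)))))"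
        by (intro cmap_compose[OF rel_homotopyD(1)[OF H]] continuous_map_pairedI cmap_unit_intervalI
            real_cmap
            cmap_subtopology homotopy_coords vr kx) (use v_range in auto)
      show "continuous_map (subtopology ?T {p \<in> topspace ?T. 1/2 \<le> ?t p}) (fst Z) (\<lambda>p. H (fst p, (r
          (?x p), min (2 - 2 * ?t p) (2 * v (?x p)))))"
        by (intro cmap_compose[OF rel_homotopyD(1)[OF H]] continuous_map_pairedI cmap_unit_intervalI
            real_cmap
            cmap_subtopology homotopy_coords vr rx) (use v_range in auto)
      fix p assume "p \<in> topspace ?T" and t: "?t p = 1/2"
      then obtain s x where p: "p = (s, x, 1/2)" and s: "0 \<le> s" "s \<le> 1" and x: "x \<in> topspace P"
        by (cases p) auto
      show "H (fst p, (k (1, ?x p), min (2 * ?t p) (2 * v (?x p)))) = H (fst p, (r (?x p), min (2 -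
          2 * ?t p) (2 * v (?x p))))"
      proof (cases "2 * v x \<ge> 1")
        case True
        then show ?thesis
          using rel_homotopyD(4)[OF H s k_in[of 1 x], of 1] rel_homotopyD(4)[OF H s r_in[OF x], of
              1] x by (simp add: p)
      next
        case False
        then show ?thesis using k1[OF x] by (simp add: p)
      qed
    qed (intro homotopy_coords real_cmap)+
    then show "continuous_map ?T (fst Z) (\<lambda>p. H (fst p, cancel k r v (snd p)))"
      by (rule continuous_map_eq) (simp add: cancel_def)
  next
    fix s x t assume s: "0 \<le> s" "s \<le> (1::real)" and x: "x \<in> topspace P" "0 \<le> t" "t \<le> (1::real)" "x \<in>
        W \<union> T \<or> t = 0 \<or> t = 1"
    show "H (fst (s, x, t), cancel k r v (snd (s, x, t))) = snd Z"
      using rel_homotopyD(4)[OF H s canc[OF x(1-3)] tw[OF x]] by simp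
  next
    fix x t assume x: "x \<in> topspace P" "0 \<le> t" "t \<le> (1::real)"
    show "H (fst (0::real, x, t), cancel k r v (snd (0::real, x, t))) = q (cancel k r v (x, t))"
      "H (fst (1::real, x, t), cancel k r v (snd (1::real, x, t))) = q' (cancel k r v (x, t))"
      using rel_homotopyD(2,3)[OF H canc[OF x]] by simp_all
  qed
qed

text \<open>
  \<open>(1 - r) + r = 1\<close>.  First the level at which the path turns back is raised to 1, after which the
  homotopy \<open>k\<close> can be undone and, at the same time, the way down and up again along \<open>r x\<close> can be
  contracted towards the top.
\<close>

lemma cancel_add:
  assumes q: "rel_map P W Z q"
    and W: "\<And>s x. \<lbrakk>x \<in> W; x \<in> topspace P; 0 \<le> s; s \<le> 1\<rbrakk> \<Longrightarrow> k (s, x) \<in> W"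
    and Wr: "\<And>x. \<lbrakk>x \<in> W; x \<in> topspace P\<rbrakk> \<Longrightarrow> r x \<in> W"
  shows "rel_homotopic P W Z (track_add (\<lambda>p. q (cancel k r v p)) (\<lambda>p. q (r (fst p), snd p))) q"
proof -
  let ?T = "prod_topology \<I> (cyl P)"
  let ?x = "\<lambda>p :: real \<times> 'a \<times> real. fst (snd p)" and ?t = "\<lambda>p :: real \<times> 'a \<times> real. snd (snd p)"
  \<comment> \<open>The level at which the path turns back; it is at least 1 from \<open>s = 1/2\<close> on, when \<open>k\<close> starts to be undone.\<close>
  define m where "m s x = max (2 * v x) (2 * s)" for s x
  define h1 where "h1 s x t = min 1 (min (4 * t) (m s x))" for s x t
  \<comment> \<open>The height along \<open>r x\<close>: down, up again, and \<open>2 s - 1\<close> as a lower bound that reaches the top at \<open>s = 1\<close>.\<close>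
  define h2 where "h2 s x t = max (max (min 1 (min (2 - 4 * t) (m s x))) (2 * t - 1)) (max 0 (2 * s
      - 1))" for s x t
  define L where "L p = q (k (1 - max 0 (2 * fst p - 1), ?x p), h1 (fst p) (?x p) (?t p))" for p
  define R where "R p = q (r (?x p), h2 (fst p) (?x p) (?t p))" for p
  have vr: "continuous_map ?T euclideanreal (\<lambda>p. v (?x p))"
    by (rule cmap_compose[OF cmap_unit_intervalD[OF v] homotopy_coords(2)])
  have rx: "continuous_map ?T P (\<lambda>p. r (?x p))"
    by (rule cmap_compose[OF r homotopy_coords(2)])
  have m0: "0 \<le> m s x" if "0 \<le> s" for s x using that by (simp add: m_def)
  have h: "0 \<le> h1 s x t" "h1 s x t \<le> 1" "0 \<le> h2 s x t" "h2 s x t \<le> 1" if "0 \<le> s" "s \<le> 1" "0 \<le> t" "t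
      \<le> 1" for s x t
    using that m0[OF that(1), of x] by (auto simp: h1_def h2_def)
  have contL: "continuous_map ?T (fst Z) L"
    unfolding L_def h1_def m_def
    by (intro cmap_compose[OF rel_mapD(1)[OF q]] cmap_compose[OF k] continuous_map_pairedI
        cmap_unit_intervalI
       real_cmap homotopy_coords vr) (use v_range in \<open>auto simp: le_max_iff_disj\<close>)
  have contR: "continuous_map ?T (fst Z) R"
    unfolding R_def h2_def m_def
    by (intro cmap_compose[OF rel_mapD(1)[OF q]] continuous_map_pairedI cmap_unit_intervalI
       real_cmap homotopy_coords vr rx) (use v_range in \<open>auto simp: le_max_iff_disj\<close>)
  have "rel_homotopic P W Z (track_add (\<lambda>p. q (cancel k r v p)) (\<lambda>p. q (r (fst p), snd p))) (\<lambda>p. q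
      (fst p, min 1 (4 * snd p)))"
  proof (rule rel_homotopicI[where H = "\<lambda>p. if ?t p \<le> 1/4 then L p else R p"])
    show "continuous_map ?T (fst Z) (\<lambda>p. if ?t p \<le> 1/4 then L p else R p)"
    proof (rule continuous_map_cases_le)
      fix p assume "p \<in> topspace ?T" and t: "?t p = 1/4"
      then obtain s x where p: "p = (s, x, 1/4)" and s: "0 \<le> s" "s \<le> 1" and x: "x \<in> topspace P"
        by (cases p) auto
      show "L p = R p"
      proof (cases "m s x \<ge> 1")
        case True
        then show ?thesis
          using rel_mapD(2)[OF q k_in[OF _ _ x], of "1 - max 0 (2 * s - 1)" 1] rel_mapD(2)[OF q
              r_in[OF x], of 1] s
          by (simp add: p L_def R_def h1_def h2_def)
      next
        case False
        then have "s < 1/2" "v x < 1" using s v_range[OF x] by (auto simp: m_def)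
        then show ?thesis using k1[OF x] False m0[OF s(1), of x]
          by (simp add: p L_def R_def h1_def h2_def)
      qed
    qed (intro cmap_subtopology contL contR homotopy_coords real_cmap)+
  next
    fix x t assume x: "x \<in> topspace P" and t: "0 \<le> t" "t \<le> (1::real)"
    have m: "m 0 x = 2 * v x" using v_range[OF x] by (simp add: m_def)
    consider "t \<le> 1/4" | "1/4 < t" "t \<le> 1/2" | "1/2 < t" by linarith
    then show "(if ?t (0::real, x, t) \<le> 1/4 then L (0, x, t) else R (0, x, t))
      = track_add (\<lambda>p. q (cancel k r v p)) (\<lambda>p. q (r (fst p), snd p)) (x, t)"
    proof cases
      case 1
      then show ?thesis using t v_range[OF x] by (simp add: L_def h1_def m track_add_def cancel_def)
    next
      case 2
      then have "h2 0 x t = min (2 - 2 * (2 * t)) (2 * v x)"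
        using t v_range[OF x] by (simp add: h2_def m min_def max_def)
      with 2 show ?thesis by (simp add: R_def track_add_def cancel_def)
    next
      case 3
      then have "h2 0 x t = 2 * t - 1"
        using t v_range[OF x] by (simp add: h2_def m min_def max_def)
      with 3 show ?thesis by (simp add: R_def track_add_def)
    qed
    have m1: "m 1 x \<ge> 2" by (simp add: m_def)
    then have h11: "h1 1 x t = min 1 (4 * t)" "h2 1 x t = 1"
      using t by (auto simp: h1_def h2_def)
    show "(if ?t (1::real, x, t) \<le> 1/4 then L (1, x, t) else R (1, x, t)) = q (fst (x, t), min 1 (4
        * snd (x, t)))"
      using rel_mapD(2)[OF q x, of 1] rel_mapD(2)[OF q r_in[OF x], of 1] by (simp add: L_def R_def
          h11 k0[OF x])
  next
    fix s x t assume s: "0 \<le> s" "s \<le> (1::real)" and x: "x \<in> topspace P" and t: "0 \<le> t" "t \<le>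
        (1::real)" "x \<in> W \<or> t = 0 \<or> t = 1"
    define \<kappa> where "\<kappa> = 1 - max 0 (2 * s - 1)"
    have \<kappa>: "0 \<le> \<kappa>" "\<kappa> \<le> 1" using s by (auto simp: \<kappa>_def)
    have ends: "h1 s x 0 = 0" "h2 s x 1 = 1" using m0[OF s(1), of x] s by (auto simp: h1_def h2_def)
    have "k (\<kappa>, x) \<in> W \<or> h1 s x t = 0" if "t \<le> 1/4"
      using t(3) that W[of x \<kappa>] x \<kappa> ends by auto
    moreover have "r x \<in> W \<or> h2 s x t = 1" if "\<not> t \<le> 1/4"
      using t(3) that Wr[of x] x ends by auto
    ultimately show "(if ?t (s, x, t) \<le> 1/4 then L (s, x, t) else R (s, x, t)) = snd Z"
      using rel_mapD(2)[OF q k_in[OF \<kappa> x] h(1,2)[OF s t(1,2), of x]] rel_mapD(2)[OF q r_in[OF x]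
          h(3,4)[OF s t(1,2), of x]]
      by (auto simp: L_def R_def \<kappa>_def)
  qed
  also have "rel_homotopic P W Z (\<lambda>p. q (fst p, min 1 (4 * snd p))) q"
  proof (rule rel_homotopic_cong[OF rel_homotopic_reparam[OF q _ cmap_ident]])
    show "continuous_map \<I> \<I> (\<lambda>t. min 1 (4 * t))"
      by (intro cmap_unit_intervalI real_cmap cmap_interval_self) auto
  qed auto
  finally show ?thesis .
qed

text \<open>
  If \<open>q r = 0\<close> then \<open>q (1 - r) = q\<close>.
\<close>

lemma cancel_null_retract:
  assumes q: "rel_map P W Z q"
    and W: "\<And>s x. \<lbrakk>x \<in> W; x \<in> topspace P; 0 \<le> s; s \<le> 1\<rbrakk> \<Longrightarrow> k (s, x) \<in> W"
    and Wr: "\<And>x. \<lbrakk>x \<in> W; x \<in> topspace P\<rbrakk> \<Longrightarrow> r x \<in> W"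
    and null: "\<And>x t. \<lbrakk>x \<in> topspace P; 0 \<le> t; t \<le> 1\<rbrakk> \<Longrightarrow> q (r x, t) = snd Z"
  shows "rel_homotopic P W Z (\<lambda>p. q (cancel k r v p)) q"
proof -
  let ?qc = "\<lambda>p. q (cancel k r v p)"
  have "rel_homotopic P (W \<union> {}) Z ?qc ?qc"
    by (rule rel_homotopic_cancel[OF rel_homotopic_refl[OF q]]) (use W[of _ 1] Wr in auto)
  then have qc: "rel_map P W Z ?qc" using rel_homotopic_rel_map(1) by simp
  have "rel_homotopic P W Z ?qc (track_add ?qc (\<lambda>_. snd Z))"
    by (rule rel_homotopic_sym[OF rel_homotopic_track_add_null_right[OF qc]])
  also have "rel_homotopic P W Z \<dots> q"
    by (rule rel_homotopic_cong[OF cancel_add[OF q W Wr]]) (auto simp: track_add_def null)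
  finally show ?thesis .
qed

text \<open>
  If \<open>q r = q\<close> then \<open>q (1 - r) = 0\<close>: both branches of \<open>q D\<close> follow the same line, so the height can be
  scaled down to 0.
\<close>

lemma cancel_retract_invariant:
  assumes q: "rel_map P W Z q"
    and T: "\<And>x. x \<in> T \<Longrightarrow> x \<in> topspace P \<Longrightarrow> v x = 0"
    and rk: "\<And>x. x \<in> topspace P \<Longrightarrow> r (k (1, x)) = r x"
    and inv: "\<And>x t. \<lbrakk>x \<in> topspace P; 0 \<le> t; t \<le> 1\<rbrakk> \<Longrightarrow> q (r x, t) = q (x, t)"
  shows "rel_homotopic P (W \<union> T) Z (\<lambda>p. q (cancel k r v p)) (\<lambda>_. snd Z)"
proof -
  let ?T = "prod_topology \<I> (cyl P)"
  let ?x = "\<lambda>p :: real \<times> 'a \<times> real. fst (snd p)" and ?t = "\<lambda>p :: real \<times> 'a \<times> real. snd (snd p)"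
  define h where "h s x t = (1 - s) * min (min (2 * t) (2 - 2 * t)) (2 * v x)" for s x t
  have h: "0 \<le> h s x t" "h s x t \<le> 1" if "0 \<le> s" "s \<le> 1" "x \<in> topspace P" "0 \<le> t" "t \<le> 1" for s x t
  proof -
    have "0 \<le> min (min (2 * t) (2 - 2 * t)) (2 * v x)" "min (min (2 * t) (2 - 2 * t)) (2 * v x) \<le> 1"
      using that v_range by auto
    then show "0 \<le> h s x t" "h s x t \<le> 1" using that by (auto simp: h_def mult_le_one)
  qed
  have vr: "continuous_map ?T euclideanreal (\<lambda>p. v (?x p))"
    by (rule cmap_compose[OF cmap_unit_intervalD[OF v] homotopy_coords(2)])
  show ?thesis
  proof (rule rel_homotopicI[where H = "\<lambda>p. q (?x p, h (fst p) (?x p) (?t p))"])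
    have "continuous_map ?T euclideanreal (\<lambda>p. h (fst p) (?x p) (?t p))"
      unfolding h_def by (intro real_cmap homotopy_coords vr)
    then have "continuous_map ?T \<I> (\<lambda>p. h (fst p) (?x p) (?t p))"
      by (rule cmap_unit_intervalI) (use h in auto)
    then show "continuous_map ?T (fst Z) (\<lambda>p. q (?x p, h (fst p) (?x p) (?t p)))"
      by (intro cmap_compose[OF rel_mapD(1)[OF q]] continuous_map_pairedI homotopy_coords)
  next
    fix x t assume x: "x \<in> topspace P" and t: "0 \<le> t" "t \<le> (1::real)"
    have k: "k (1, x) \<in> topspace P" by (rule k_in[OF _ _ x]) auto
    have "q (cancel k r v (x, t)) = q (r x, h 0 x t)"
    proof (cases "t \<le> 1/2")
      case True
      have "q (k (1, x), h 0 x t) = q (r x, h 0 x t)"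
        using inv[OF k h(1,2)[of 0 x t]] rk[OF x] x t by simp
      then show ?thesis using True by (simp add: cancel_def h_def)
    qed (simp add: cancel_def h_def)
    then show "q (?x (0::real, x, t), h (fst (0, x, t)) (?x (0::real, x, t)) (?t (0::real, x, t))) =
        q (cancel k r v (x, t))"
      using inv[OF x h(1,2)[of 0 x t]] x t by simp
    show "q (?x (1::real, x, t), h (fst (1, x, t)) (?x (1::real, x, t)) (?t (1::real, x, t))) = snd Z"
      using rel_mapD(2)[OF q x, of 0] by (simp add: h_def)
  next
    fix s x t assume s: "0 \<le> s" "s \<le> (1::real)" and x: "x \<in> topspace P" and t: "0 \<le> t" "t \<le> (1::real)"
      and triv: "x \<in> W \<union> T \<or> t = 0 \<or> t = 1"
    have "x \<in> W \<or> h s x t = 0"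
      using triv T[of x] v_range[OF x] x t by (auto simp: h_def min_def)
    then show "q (?x (s, x, t), h (fst (s, x, t)) (?x (s, x, t)) (?t (s, x, t))) = snd Z"
      using rel_mapD(2)[OF q x h[OF s x t]] by auto
  qed
qed

end

section \<open>Families of commuting retractions\<close>

text \<open>
  All ways to distribute the entries of a list over two sublists.  The recursion keeps the two
  choices for an entry next to each other, which is the order in which the terms of an expanded
  product cancel.
\<close>

primrec splittings :: "'v list \<Rightarrow> ('v list \<times> 'v list) list"
  where
    "splittings [] = [([], [])]"
  | "splittings (j # js) = concat (map (\<lambda>S. [(j # fst S, snd S), (fst S, j # snd S)]) (splittings js))"

lemma splittings_set: "S \<in> set (splittings js) \<Longrightarrow> set (fst S) \<union> set (snd S) = set js"
  by (induction js arbitrary: S) fastforce+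

lemma splittings_distinct:
  "S \<in> set (splittings js) \<Longrightarrow> distinct js \<Longrightarrow>
    distinct (fst S) \<and> distinct (snd S) \<and> set (fst S) \<inter> set (snd S) = {}"
proof (induction js arbitrary: S)
  case (Cons j js)
  then obtain S' where S': "S' \<in> set (splittings js)" "S = (j # fst S', snd S') \<or> S = (fst S', j #
      snd S')"
    by auto
  have "j \<notin> set (fst S') \<union> set (snd S')"
    using splittings_set[OF S'(1)] Cons.prems by simp
  then show ?case using Cons.IH[OF S'(1)] Cons.prems(2) S'(2) by auto
qed simp

lemma splittings_filter:
  "\<lbrakk>S \<in> set (splittings js); distinct js\<rbrakk> \<Longrightarrow>
    fst S = filter (\<lambda>i. i \<in> set (fst S)) js \<and> snd S = filter (\<lambda>i. i \<notin> set (fst S)) js"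
proof (induction js arbitrary: S)
  case (Cons j js)
  then obtain S' where S': "S' \<in> set (splittings js)" and S: "S = (j # fst S', snd S') \<or> S = (fst
      S', j # snd S')"
    by auto
  have js: "distinct js" "j \<notin> set js" using Cons.prems by auto
  have j: "j \<notin> set (fst S')" using splittings_set[OF S'] js by auto
  have ne: "i \<noteq> j" if "i \<in> set js" for i using js that by auto
  have "filter (\<lambda>i. i \<in> insert j (set (fst S'))) js = filter (\<lambda>i. i \<in> set (fst S')) js"
    "filter (\<lambda>i. i \<notin> insert j (set (fst S'))) js = filter (\<lambda>i. i \<notin> set (fst S')) js"
    by (rule filter_cong[OF refl]; use ne in auto)+
  then show ?case using S Cons.IH[OF S' js(1)] j by auto
qed simp

lemma filter_splitting: "(filter R js, filter (\<lambda>i. \<not> R i) js) \<in> set (splittings js)"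
  by (induction js) (auto intro!: bexI)

lemma distinct_splitting_sets: "distinct js \<Longrightarrow> distinct (map (\<lambda>S. set (fst S)) (splittings js))"
proof (induction js)
  case (Cons j js)
  let ?Is = "map (\<lambda>S. set (fst S)) (splittings js)"
  have distinct_pairs: "distinct (concat (map (\<lambda>I. [insert j I, I]) Is))" if "distinct Is" "\<forall>I\<in>set
      Is. j \<notin> I" for Is
    using that
  proof (induction Is)
    case (Cons I Is)
    have "insert j I \<noteq> insert j I'" "insert j I \<noteq> I'" "I \<noteq> insert j I'" if "I' \<in> set Is" for I'
      using Cons.prems that by (auto simp: insert_ident)
    then show ?case using Cons by auto
  qed simp
  have notin: "\<forall>I\<in>set ?Is. j \<notin> I"
    using splittings_set Cons.prems by fastforce
  have eq: "map (\<lambda>S. set (fst S)) (splittings (j # js)) = concat (map (\<lambda>I. [insert j I, I]) ?Is)"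
    by (simp add: map_concat o_def)
  show ?case
    unfolding eq by (rule distinct_pairs[OF Cons.IH notin]) (use Cons.prems in simp)
qed simp

text \<open>
  The properties of the maps that reset or contract a single coordinate of a product.
\<close>

locale coordinate_retractions =
  fixes P :: "'a topology" and b :: 'a and V :: "'v set"
    and k :: "'v \<Rightarrow> real \<times> 'a \<Rightarrow> 'a" and r :: "'v \<Rightarrow> 'a \<Rightarrow> 'a" and v :: "'v \<Rightarrow> 'a \<Rightarrow> real"
  assumes numerable: "j \<in> V \<Longrightarrow> numerable_retraction P (k j) (r j) (v j)"
    and b: "b \<in> topspace P"
    and rb: "j \<in> V \<Longrightarrow> r j b = b"
    and k_fixed: "\<lbrakk>j \<in> V; x \<in> topspace P; r j x = x; 0 \<le> s; s \<le> 1\<rbrakk> \<Longrightarrow> k j (s, x) = x"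
    and v_fixed: "\<lbrakk>j \<in> V; x \<in> topspace P; r j x = x\<rbrakk> \<Longrightarrow> v j x = 0"
    and rk: "\<lbrakk>j \<in> V; x \<in> topspace P\<rbrakk> \<Longrightarrow> r j (k j (1, x)) = r j x"
    and r_comm: "\<lbrakk>i \<in> V; j \<in> V; x \<in> topspace P\<rbrakk> \<Longrightarrow> r i (r j x) = r j (r i x)"
    and k_comm: "\<lbrakk>i \<in> V; j \<in> V; i \<noteq> j; x \<in> topspace P; 0 \<le> s; s \<le> 1\<rbrakk> \<Longrightarrow> k j (s, r i x) = r i (k j (s, x))"
    and v_comm: "\<lbrakk>i \<in> V; j \<in> V; i \<noteq> j; x \<in> topspace P\<rbrakk> \<Longrightarrow> v j (r i x) = v j x"
begin

lemmas r_in = numerable_retraction.r_in[OF numerable]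
lemmas k_in = numerable_retraction.k_in[OF numerable]
lemmas v_range = numerable_retraction.v_range[OF numerable]

text \<open>
  For coordinates this is the fat wedge in the coordinates \<open>js\<close>, and the base point if \<open>js\<close> is empty.
\<close>

definition fixset :: "'v list \<Rightarrow> 'a set"
  where "fixset js = insert b {x \<in> topspace P. \<exists>j\<in>set js. r j x = x}"

lemma fixset_k:
  assumes "j \<in> V" "set js \<subseteq> V" "x \<in> fixset js" "0 \<le> s" "s \<le> 1"
  shows "k j (s, x) \<in> fixset js"
proof (cases "r j x = x")
  case True
  then show ?thesis using assms k_fixed[OF assms(1) _ True] b by (auto simp: fixset_def)
next
  case False
  then obtain i where i: "i \<in> set js" "r i x = x" and x: "x \<in> topspace P"
    using assms(3) rb[OF assms(1)] by (auto simp: fixset_def)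
  then have "i \<in> V" "i \<noteq> j" using assms False by auto
  then have "r i (k j (s, x)) = k j (s, x)"
    using k_comm[of i j x s] i x assms by simp
  then show ?thesis using k_in[OF assms(1,4,5) x] i by (auto simp: fixset_def)
qed

lemma fixset_r:
  assumes "j \<in> V" "set js \<subseteq> V" "x \<in> fixset js"
  shows "r j x \<in> fixset js"
proof (cases "x = b")
  case True
  then show ?thesis using assms rb by (simp add: fixset_def)
next
  case False
  then obtain i where i: "i \<in> set js" "r i x = x" and x: "x \<in> topspace P"
    using assms(3) by (auto simp: fixset_def)
  then have "i \<in> V" using assms by auto
  then have "r i (r j x) = r j x"
    using r_comm[of i j x] i x assms by simp
  then show ?thesis using r_in[OF assms(1) x] i by (auto simp: fixset_def)
qed

abbreviation coord_cancel :: "'v \<Rightarrow> 'a \<times> real \<Rightarrow> 'a \<times> real"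
  where "coord_cancel j \<equiv> cancel (k j) (r j) (v j)"

lemma coord_cancel_in:
  assumes "j \<in> V" "x \<in> topspace P" "0 \<le> t" "t \<le> 1"
  shows "fst (coord_cancel j (x, t)) \<in> topspace P" "0 \<le> snd (coord_cancel j (x, t))" "snd
      (coord_cancel j (x, t)) \<le> 1"
  using assms r_in[of j x] k_in[of j 1 x] v_range[of j x] by (auto simp: cancel_def)

lemma coord_cancel_comm:
  assumes "i \<in> V" "j \<in> V" "i \<noteq> j" "x \<in> topspace P"
  shows "coord_cancel j (r i x, t) = (r i (fst (coord_cancel j (x, t))), snd (coord_cancel j (x, t)))"
  using assms k_comm[of i j x 1] v_comm[of i j x] r_comm[of i j x] by (simp add: cancel_def)

text \<open>
  Composition on the right with the maps \<open>D_j\<close> for \<open>j\<close> in the list.  It is formed for an arbitrary map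
  \<open>q\<close> on the cylinder that is trivial where it has to be, since \<open>D_j\<close> itself is continuous only as a map
  to the suspension.
\<close>

primrec cancel_all :: "'v list \<Rightarrow> ('a \<times> real \<Rightarrow> 'z) \<Rightarrow> 'a \<times> real \<Rightarrow> 'z"
  where
    "cancel_all [] q = q"
  | "cancel_all (j # js) q = (\<lambda>p. cancel_all js q (coord_cancel j p))"

lemma rel_homotopic_cancel_fixset:
  assumes "j \<in> V" "set js \<subseteq> V" "j \<notin> set js" "rel_homotopic P (fixset js) Z q q'"
  shows "rel_homotopic P (fixset (j # js)) Z (\<lambda>p. q (coord_cancel j p)) (\<lambda>p. q' (coord_cancel j p))"
proof -
  have "rel_homotopic P (fixset js \<union> {x \<in> topspace P. r j x = x}) Z (\<lambda>p. q (coord_cancel j p)) (\<lambda>p.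
      q' (coord_cancel j p))"
    by (rule numerable_retraction.rel_homotopic_cancel[OF numerable[OF assms(1)] assms(4)])
      (use fixset_k[OF assms(1,2), of _ 1] fixset_r[OF assms(1,2)] v_fixed[OF assms(1)] in auto)
  then show ?thesis
    by (rule rel_homotopic_mono) (auto simp: fixset_def)
qed

text \<open>
  Every \<open>D_j\<close> adds the fixed points of \<open>r_j\<close> to the trivial part, and the part found so far is preserved
  by the other coordinates.  This is what makes the composite factor through a smash product.
\<close>

lemma rel_map_cancel_all:
  assumes "set js \<subseteq> V" "distinct js" "rel_map P {b} Z q"
  shows "rel_map P (fixset js) Z (cancel_all js q)"
  using assms(1,2)
proof (induction js)
  case Nil
  show ?case using assms(3) by (simp add: fixset_def)
next
  case (Cons j js)
  then have "rel_map P (fixset js) Z (cancel_all js q)" by simp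
  then have "rel_homotopic P (fixset js) Z (cancel_all js q) (cancel_all js q)"
    by (rule rel_homotopic_refl) simp
  then have "rel_homotopic P (fixset (j # js)) Z (cancel_all (j # js) q) (cancel_all (j # js) q)"
    using rel_homotopic_cancel_fixset[of j js] Cons.prems by simp
  then show ?case by (rule rel_homotopic_rel_map)
qed

lemma cancel_all_cong:
  assumes "set js \<subseteq> V" and "\<And>x t. \<lbrakk>x \<in> topspace P; 0 \<le> t; t \<le> 1\<rbrakk> \<Longrightarrow> q (x, t) = q' (x, t)"
    and "x \<in> topspace P" "0 \<le> t" "t \<le> 1"
  shows "cancel_all js q (x, t) = cancel_all js q' (x, t)"
  using assms(1,3-)
proof (induction js arbitrary: x t)
  case (Cons j js)
  have "j \<in> V" using Cons.prems by simp
  from Cons.IH[OF _ coord_cancel_in[OF this Cons.prems(2-)]] Cons.prems(1) show ?case by simp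
qed (simp add: assms(2))

lemma cancel_all_r:
  assumes "set js \<subseteq> V" "i \<in> V" "i \<notin> set js" "x \<in> topspace P" "0 \<le> t" "t \<le> 1"
  shows "cancel_all js q (r i x, t) = cancel_all js (\<lambda>p. q (r i (fst p), snd p)) (x, t)"
  using assms(1,3-)
proof (induction js arbitrary: x t)
  case (Cons j js)
  have j: "j \<in> V" "i \<noteq> j" using Cons.prems by auto
  show ?case
    using Cons.IH[OF _ _ coord_cancel_in[OF j(1) Cons.prems(3-)]] Cons.prems
    by (simp add: coord_cancel_comm[OF assms(2) j(1,2)])
qed simp

lemma cancel_all_const: "cancel_all js (\<lambda>_. c) = (\<lambda>_. c)"
  by (induction js) auto

lemma cancel_all_postcompose: "g (cancel_all js q p) = cancel_all js (\<lambda>p. g (q p)) p"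
  by (induction js arbitrary: p) auto

text \<open>
  If \<open>q r_i = q\<close> for one \<open>i\<close> in the list, the factor \<open>1 - r_i\<close> annihilates the composite; the other
  factors commute with \<open>r_i\<close>.
\<close>

lemma cancel_all_retract_invariant:
  assumes "set js \<subseteq> V" "distinct js" and q: "rel_map P {b} Z q"
    and i: "i \<in> set js" and inv: "\<And>x t. \<lbrakk>x \<in> topspace P; 0 \<le> t; t \<le> 1\<rbrakk> \<Longrightarrow> q (r i x, t) = q (x, t)"
  shows "rel_homotopic P (fixset js) Z (cancel_all js q) (\<lambda>_. snd Z)"
  using assms(1,2) i
proof (induction js)
  case (Cons j js)
  have j: "j \<in> V" "j \<notin> set js" "set js \<subseteq> V" "distinct js" using Cons.prems by auto
  show ?case
  proof (cases "i = j")
    case True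
    have sm: "rel_map P (fixset js) Z (cancel_all js q)"
      by (rule rel_map_cancel_all[OF j(3,4) q])
    have "rel_homotopic P (fixset js \<union> {x \<in> topspace P. r j x = x}) Z (\<lambda>p. cancel_all js q
        (coord_cancel j p)) (\<lambda>_. snd Z)"
    proof (rule numerable_retraction.cancel_retract_invariant[OF numerable[OF j(1)] sm])
      show "cancel_all js q (r j x, t) = cancel_all js q (x, t)" if "x \<in> topspace P" "0 \<le> t" "t \<le> 1"
          for x t
        by (rule trans[OF cancel_all_r[OF j(3,1,2) that] cancel_all_cong[OF j(3) _ that]])
          (simp add: inv[unfolded True])
    qed (use v_fixed[OF j(1)] rk[OF j(1)] in auto)
    then show ?thesis
      by simp (rule rel_homotopic_mono, auto simp: fixset_def)
  next
    case False
    then have "rel_homotopic P (fixset js) Z (cancel_all js q) (\<lambda>_. snd Z)"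
      using Cons j by simp
    from rel_homotopic_cancel_fixset[OF j(1,3,2) this] show ?thesis by simp
  qed
qed simp

lemma cancel_all_retract_null:
  assumes "set js \<subseteq> V" "distinct js" and q: "rel_map P {b} Z q"
    and null: "\<And>i x t. \<lbrakk>i \<in> set js; x \<in> topspace P; 0 \<le> t; t \<le> 1\<rbrakk> \<Longrightarrow> q (r i x, t) = snd Z"
  shows "rel_homotopic P (fixset js) Z (cancel_all js q) q"
  using assms(1,2) null
proof (induction js)
  case Nil
  show ?case using rel_homotopic_refl[OF q] by (simp add: fixset_def)
next
  case (Cons j js)
  have j: "j \<in> V" "j \<notin> set js" "set js \<subseteq> V" "distinct js" using Cons.prems by auto
  have sm: "rel_map P (fixset (j # js)) Z q"
    unfolding rel_map_def
  proof (intro conjI allI impI)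
    fix x t assume *: "x \<in> topspace P \<and> 0 \<le> t \<and> t \<le> 1 \<and> (x \<in> fixset (j # js) \<or> t = 0 \<or> t = (1::real))"
    then consider "x = b \<or> t = 0 \<or> t = 1" | i where "i \<in> set (j # js)" "r i x = x"
      by (auto simp: fixset_def)
    then show "q (x, t) = snd Z"
    proof cases
      case 2
      then show ?thesis using Cons.prems(3)[of i x t] * by simp
    qed (use rel_mapD(2)[OF q, of x t] * in auto)
  qed (rule rel_mapD(1)[OF q])
  have "rel_homotopic P (fixset js) Z (cancel_all js q) q"
    by (rule Cons.IH[OF j(3,4)]) (use Cons.prems(3) in auto)
  from rel_homotopic_cancel_fixset[OF j(1,3,2) this]
  have "rel_homotopic P (fixset (j # js)) Z (cancel_all (j # js) q) (\<lambda>p. q (coord_cancel j p))"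
    by simp
  also have "rel_homotopic P (fixset (j # js)) Z \<dots> q"
    by (rule numerable_retraction.cancel_null_retract[OF numerable[OF j(1)] sm])
      (use fixset_k[OF j(1) Cons.prems(1)] fixset_r[OF j(1) Cons.prems(1)] Cons.prems(3)[of j] in auto)
  finally show ?case .
qed

definition retract_all :: "'v list \<Rightarrow> 'a \<Rightarrow> 'a"
  where "retract_all = foldr r"

lemma retract_all_simps [simp]:
  "retract_all [] x = x" "retract_all (j # js) x = r j (retract_all js x)"
  by (simp_all add: retract_all_def)

lemma retract_all_in: "set js \<subseteq> V \<Longrightarrow> x \<in> topspace P \<Longrightarrow> retract_all js x \<in> topspace P"
  by (induction js) (auto intro: r_in)

lemma retract_all_b: "set js \<subseteq> V \<Longrightarrow> retract_all js b = b"
  by (induction js) (auto simp: rb)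

lemma cmap_retract_all: "set js \<subseteq> V \<Longrightarrow> continuous_map P P (retract_all js)"
proof (induction js)
  case Nil
  then show ?case using cmap_ident by simp
next
  case (Cons j js)
  then show ?case
    using cmap_compose[OF numerable_retraction.r[OF numerable[of j]]] by simp
qed

lemma retract_all_r:
  "\<lbrakk>set js \<subseteq> V; i \<in> V; x \<in> topspace P\<rbrakk> \<Longrightarrow> retract_all js (r i x) = r i (retract_all js x)"
  by (induction js) (auto simp: r_comm retract_all_in)

lemma coord_cancel_retract_all:
  assumes "set js \<subseteq> V" "j \<in> V" "j \<notin> set js" "x \<in> topspace P"
  shows "coord_cancel j (retract_all js x, t) = (retract_all js (fst (coord_cancel j (x, t))), snd
      (coord_cancel j (x, t)))"
  using assms
proof (induction js)
  case (Cons i js)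
  then have "coord_cancel j (r i (retract_all js x), t)
      = (r i (fst (coord_cancel j (retract_all js x, t))), snd (coord_cancel j (retract_all js x, t)))"
    by (intro coord_cancel_comm retract_all_in) auto
  then show ?case using Cons by simp
qed simp

lemma rel_map_retract_all:
  assumes f: "rel_map P {b} Z f" and ks: "set ks \<subseteq> V"
  shows "rel_map P {b} Z (\<lambda>p. f (retract_all ks (fst p), snd p))"
  unfolding rel_map_def
proof (intro conjI allI impI)
  show "continuous_map (cyl P) (fst Z) (\<lambda>p. f (retract_all ks (fst p), snd p))"
    by (intro cmap_compose[OF rel_mapD(1)[OF f]] continuous_map_pairedI cmap_compose[OF
        cmap_retract_all[OF ks]]
      continuous_map_fst continuous_map_snd)
  fix x t assume "x \<in> topspace P \<and> 0 \<le> t \<and> t \<le> 1 \<and> (x \<in> {b} \<or> t = 0 \<or> t = (1::real))"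
  then show "f (retract_all ks (fst (x, t)), snd (x, t)) = snd Z"
    using rel_mapD(2)[OF f retract_all_in[OF ks, of x], of t] retract_all_b[OF ks] by auto
qed

lemma cancel_all_retract_all:
  assumes "set js \<subseteq> V" "set ks \<subseteq> V" "set js \<inter> set ks = {}" "x \<in> topspace P" "0 \<le> t" "t \<le> 1"
  shows "cancel_all js q (retract_all ks x, t) = cancel_all js (\<lambda>p. q (retract_all ks (fst p), snd
      p)) (x, t)"
  using assms(2,3)
proof (induction ks arbitrary: q)
  case (Cons k ks)
  then have k: "k \<in> V" "k \<notin> set js" "set ks \<subseteq> V" "set js \<inter> set ks = {}" by auto
  have "cancel_all js q (retract_all (k # ks) x, t) = cancel_all js q (r k (retract_all ks x), t)"
    by simp
  also have "\<dots> = cancel_all js (\<lambda>p. q (r k (fst p), snd p)) (retract_all ks x, t)"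
    by (rule cancel_all_r[OF assms(1) k(1,2) retract_all_in[OF k(3) assms(4)] assms(5,6)])
  also have "\<dots> = cancel_all js (\<lambda>p. q (retract_all (k # ks) (fst p), snd p)) (x, t)"
    using Cons.IH[OF k(3,4), of "\<lambda>p. q (r k (fst p), snd p)"] by simp
  finally show ?case .
qed simp

text \<open>
  The expansion of the product of all \<open>(1 - r_j) + r_j = 1\<close>.  The terms are added in the outer
  coordinate, whereas \<open>cancel_add\<close> adds in the inner one; on a double suspension the two
  additions agree up to homotopy.
\<close>

lemma rel_homotopic_sum_splittings:
  assumes q: "rel_map P {b} Z q" and Z: "snd Z \<in> topspace (fst Z)"
    and js: "set js \<subseteq> V" "distinct js"
  shows "rel_homotopic (cyl P) (cyl_trivial P {b}) (susp Z)
    (track_sum (snd (susp Z)) (map (\<lambda>S. presusp Z (\<lambda>p. cancel_all (fst S) q (retract_all (snd S)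
        (fst p), snd p))) (splittings js)))
    (presusp Z q)"
  using js
proof (induction js)
  case Nil
  have "rel_map (cyl P) (cyl_trivial P {b}) (susp Z) (presusp Z q)"
    using rel_homotopic_rel_map(1)[OF rel_homotopic_presusp[OF rel_homotopic_refl[OF q]]] by simp
  from rel_homotopic_track_add_null_right[OF this] show ?case by simp
next
  case (Cons j js)
  let ?rel_homotopic = "rel_homotopic (cyl P) (cyl_trivial P {b}) (susp Z)" and ?rel_map = "rel_map
      (cyl P) (cyl_trivial P {b}) (susp Z)"
  have j: "j \<in> V" "j \<notin> set js" "set js \<subseteq> V" "distinct js" using Cons.prems by auto
  have susp_Z: "snd (susp Z) \<in> topspace (fst (susp Z))" using base_susp[OF Z] by simp
  define c where "c S = (\<lambda>p. cancel_all (fst S) q (retract_all (snd S) (fst p), snd p))" for S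
  define a where "a S = (\<lambda>p. cancel_all (j # fst S) q (retract_all (snd S) (fst p), snd p))" for S
  define d where "d S = (\<lambda>p. cancel_all (fst S) q (retract_all (j # snd S) (fst p), snd p))" for S
  have sub: "set (fst S) \<subseteq> V" "set (snd S) \<subseteq> V" "j \<notin> set (fst S)" "j \<notin> set (snd S)" "distinct (fst S)"
    if "S \<in> set (splittings js)" for S
    using splittings_set[OF that] splittings_distinct[OF that] j by auto
  have dc: "rel_map P {b} Z (cancel_all ks q)" if "set ks \<subseteq> V" "distinct ks" for ks
    by (rule rel_map_mono[OF rel_map_cancel_all[OF that q]]) (simp add: fixset_def)
  have sa: "rel_map P {b} Z (a S)" and sd: "rel_map P {b} Z (d S)" and sc: "rel_map P {b} Z (c S)"
    if "S \<in> set (splittings js)" for S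
    unfolding a_def d_def c_def by (intro rel_map_retract_all dc; use sub[OF that] j in auto)+
  have presusp: "?rel_map (presusp Z f)" if "rel_map P {b} Z f" for f
    using rel_homotopic_rel_map(1)[OF rel_homotopic_presusp[OF rel_homotopic_refl[OF that]]] by simp
  have pair: "?rel_homotopic (track_add (presusp Z (a S)) (presusp Z (d S))) (presusp Z (c S))" if
      S: "S \<in> set (splittings js)" for S
  proof -
    have "?rel_homotopic (track_add (presusp Z (a S)) (presusp Z (d S))) (presusp Z (track_add (a S)
        (d S)))"
      unfolding presusp_track_add by (rule rel_homotopic_track_add_inner_add(1)[OF presusp[OF sa[OF
          S]] presusp[OF sd[OF S]]])
    also have "?rel_homotopic \<dots> (presusp Z (c S))"
    proof (rule rel_homotopic_presusp, rule rel_homotopic_cong)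
      show "rel_homotopic P {b} Z (track_add (\<lambda>p. c S (coord_cancel j p)) (\<lambda>p. c S (r j (fst p), snd
          p))) (c S)"
        using k_fixed[OF j(1) b rb[OF j(1)]] rb[OF j(1)]
        by (intro numerable_retraction.cancel_add[OF numerable[OF j(1)] sc[OF S]]) auto
      fix x t assume x: "x \<in> topspace P"
      have "c S (coord_cancel j (x, t)) = a S (x, t)" for t
        using coord_cancel_retract_all[OF sub(2)[OF S] j(1) sub(4)[OF S] x, of t] by (simp add:
            a_def c_def)
      moreover have "c S (r j x, t) = d S (x, t)" for t
        using retract_all_r[OF sub(2)[OF S] j(1) x] by (simp add: c_def d_def)
      ultimately show "track_add (\<lambda>p. c S (coord_cancel j p)) (\<lambda>p. c S (r j (fst p), snd p)) (x, t)
          = track_add (a S) (d S) (x, t)"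
        by (simp add: track_add_def)
    qed simp
    finally show ?thesis .
  qed
  have "?rel_homotopic (track_sum (snd (susp Z)) (concat (map (\<lambda>S. [presusp Z (a S), presusp Z (d
      S)]) (splittings js))))
      (track_sum (snd (susp Z)) (map (\<lambda>S. presusp Z (c S)) (splittings js)))"
    by (rule rel_homotopic_track_sum_pairs[OF susp_Z presusp[OF sa] presusp[OF sd] pair])
  also have "?rel_homotopic \<dots> (presusp Z q)"
    unfolding c_def by (rule Cons.IH[OF j(3,4)])
  also have "concat (map (\<lambda>S. [presusp Z (a S), presusp Z (d S)]) (splittings js))
    = map (\<lambda>S. presusp Z (\<lambda>p. cancel_all (fst S) q (retract_all (snd S) (fst p), snd p)))
        (splittings (j # js))"
    by (simp add: map_concat a_def d_def o_def)
  finally show ?case .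
qed

end

section \<open>Contracting a neighbourhood of a vertex of a cell complex\<close>

definition sqnorm :: "nat \<Rightarrow> (nat \<Rightarrow> real) \<Rightarrow> real"
  where "sqnorm n y = (\<Sum>i<n. (y i)\<^sup>2)"

abbreviation disc :: "nat \<Rightarrow> (nat \<Rightarrow> real) topology"
  where "disc n \<equiv> subtopology (Euclidean_space n) {x. (\<Sum>i<n. (x i)\<^sup>2) \<le> 1}"

abbreviation open_disc :: "nat \<Rightarrow> (nat \<Rightarrow> real) topology"
  where "open_disc n \<equiv> subtopology (Euclidean_space n) {x. (\<Sum>i<n. (x i)\<^sup>2) < 1}"

lemma topspace_disc: "topspace (disc n) = {y. (\<forall>i\<ge>n. y i = 0) \<and> sqnorm n y \<le> 1}"
  by (auto simp: topspace_Euclidean_space sqnorm_def)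

lemma topspace_open_disc: "topspace (open_disc n) = {y. (\<forall>i\<ge>n. y i = 0) \<and> sqnorm n y < 1}"
  by (auto simp: topspace_Euclidean_space sqnorm_def)

lemma sqnorm_nonneg: "0 \<le> sqnorm n y"
  by (simp add: sqnorm_def sum_nonneg)

lemma sqnorm_scale: "sqnorm n (\<lambda>i. c * y i) = c\<^sup>2 * sqnorm n y"
  by (simp add: sqnorm_def power_mult_distrib sum_distrib_left)

lemma cmap_into_disc:
  assumes "\<And>i. continuous_map X euclideanreal (\<lambda>x. f x i)"
    and "\<And>x. x \<in> topspace X \<Longrightarrow> f x \<in> topspace (disc n)"
  shows "continuous_map X (disc n) f"
  unfolding Euclidean_space_def subtopology_subtopology
  using assms by (auto simp: continuous_map_in_subtopology continuous_map_componentwise_UNIV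
      Euclidean_space_def)

lemma cmap_disc_coord: "continuous_map (disc n) euclideanreal (\<lambda>y. y i)"
  unfolding Euclidean_space_def
  by (intro continuous_map_from_subtopology continuous_map_product_coordinates) auto

lemma cmap_sqnorm:
  assumes "\<And>i. continuous_map X euclideanreal (\<lambda>x. f x i)"
  shows "continuous_map X euclideanreal (\<lambda>x. sqnorm n (f x))"
  unfolding sqnorm_def power2_eq_square
  by (intro continuous_map_sum real_cmap assms) auto

lemma compact_space_disc: "compact_space (disc n)"
proof -
  let ?P = "product_topology (\<lambda>i::nat. euclideanreal) UNIV"
  let ?D = "{y::nat \<Rightarrow> real. (\<forall>i\<ge>n. y i = 0) \<and> sqnorm n y \<le> 1}"
  have "closedin ?P {y \<in> topspace ?P. sqnorm n y \<in> {..1}}"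
    by (rule closedin_continuous_map_preimage[OF cmap_sqnorm]) (auto intro:
        continuous_map_product_coordinates)
  moreover have "?D = {x. \<forall>i\<ge>n. x i = 0} \<inter> {y \<in> topspace ?P. sqnorm n y \<in> {..1}}"
    by auto
  ultimately have "closedin ?P ?D"
    using closedin_Euclidean_space[of n] by (simp add: topspace_Euclidean_space closedin_Int)
  moreover have "compactin ?P (PiE UNIV (\<lambda>_. {-1..1}))"
    by (subst compactin_PiE) auto
  moreover have "?D \<subseteq> PiE UNIV (\<lambda>_. {-1..1})"
  proof
    fix y assume "y \<in> ?D"
    then have y: "\<forall>i\<ge>n. y i = 0" "sqnorm n y \<le> 1" by auto
    have "\<bar>y i\<bar> \<le> 1" for i
    proof (cases "i < n")
      case True
      then have "(y i)\<^sup>2 \<le> sqnorm n y"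
        unfolding sqnorm_def by (intro member_le_sum) auto
      then show ?thesis using y(2) abs_square_le_1[of "y i"] by linarith
    qed (use y in auto)
    then have "- 1 \<le> y i \<and> y i \<le> 1" for i
      by (metis abs_le_iff minus_le_iff)
    then show "y \<in> PiE UNIV (\<lambda>_. {-1..1})" by auto
  qed
  ultimately have "compactin ?P ?D"
    by (meson closed_compactin)
  moreover have "disc n = subtopology ?P ?D"
    unfolding Euclidean_space_def subtopology_subtopology by (rule arg_cong[where f = "subtopology
        ?P"]) (auto simp: sqnorm_def)
  ultimately show ?thesis
    by (simp add: compact_space_subtopology)
qed

text \<open>
  A cell complex with a chosen characteristic map for each cell.
\<close>

locale whitehead_complex =
  fixes X :: "'a topology" and E :: "nat \<Rightarrow> 'a set set" and \<Phi> :: "nat \<Rightarrow> 'a set \<Rightarrow> (nat \<Rightarrow> real) \<Rightarrow> 'a"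
  assumes haus: "Hausdorff_space X"
    and cover: "(\<Union>n. \<Union>(E n)) = topspace X"
    and disj: "\<lbrakk>e \<in> E n; e' \<in> E k; e \<inter> e' \<noteq> {}\<rbrakk> \<Longrightarrow> n = k \<and> e = e'"
    and char_cont: "e \<in> E n \<Longrightarrow> continuous_map (disc n) X (\<Phi> n e)"
    and char_homeo: "e \<in> E n \<Longrightarrow> homeomorphic_map (open_disc n) (subtopology X e) (\<Phi> n e)"
    and char_bd: "e \<in> E n \<Longrightarrow> \<exists>F. finite F \<and> F \<subseteq> (\<Union>k<n. E k) \<and>
          \<Phi> n e ` {x \<in> topspace (Euclidean_space n). (\<Sum>i<n. (x i)\<^sup>2) = 1} \<subseteq> \<Union>F"
    and weak: "\<lbrakk>C \<subseteq> topspace X; \<And>n e. e \<in> E n \<Longrightarrow> closedin X (C \<inter> X closure_of e)\<rbrakk> \<Longrightarrow> closedin X C"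
begin

definition closed_cell :: "nat \<Rightarrow> 'a set \<Rightarrow> 'a set"
  where "closed_cell n e = \<Phi> n e ` topspace (disc n)"

lemma cell_subset: "e \<in> E n \<Longrightarrow> e \<subseteq> topspace X"
  using cover by blast

lemma char_image: "e \<in> E n \<Longrightarrow> \<Phi> n e ` topspace (open_disc n) = e"
  using homeomorphic_imp_surjective_map[OF char_homeo, of e n] cell_subset[of e n]
  by (simp add: Int_absorb1)

lemma char_inj: "e \<in> E n \<Longrightarrow> inj_on (\<Phi> n e) (topspace (open_disc n))"
  using homeomorphic_imp_injective_map[OF char_homeo] .

lemma open_disc_subset: "topspace (open_disc n) \<subseteq> topspace (disc n)"
  unfolding topspace_disc topspace_open_disc by auto

lemma cell_subset_closed_cell: "e \<in> E n \<Longrightarrow> e \<subseteq> closed_cell n e"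
  using char_image[of e n] image_mono[OF open_disc_subset, of "\<Phi> n e" n]
  unfolding closed_cell_def by simp

lemma closedin_closed_cell: "e \<in> E n \<Longrightarrow> closedin X (closed_cell n e)"
  unfolding closed_cell_def
  by (rule compactin_imp_closedin[OF haus image_compactin[OF _ char_cont]])
    (use compact_space_disc in \<open>auto simp: compact_space_def\<close>)

lemma closure_subset_closed_cell: "e \<in> E n \<Longrightarrow> X closure_of e \<subseteq> closed_cell n e"
  by (rule closure_of_minimal[OF cell_subset_closed_cell closedin_closed_cell])

text \<open>
  Every point of the disc is the limit of its multiples by \<open>t < 1\<close>, which lie in the open disc.
\<close>

lemma closed_cell_subset_closure:
  assumes e: "e \<in> E n" shows "closed_cell n e \<subseteq> X closure_of e"
proof
  fix x assume "x \<in> closed_cell n e"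
  then obtain y where y: "\<forall>i\<ge>n. y i = 0" "sqnorm n y \<le> 1" and x: "x = \<Phi> n e y"
    unfolding closed_cell_def topspace_disc by blast
  define g where "g t = \<Phi> n e (\<lambda>i. t * y i)" for t
  have "sqnorm n (\<lambda>i. t * y i) \<le> 1" if "0 \<le> t" "t \<le> 1" for t
    unfolding sqnorm_scale using that y sqnorm_nonneg[of n y] by (simp add: mult_le_one power_le_one)
  then have "continuous_map \<I> X g"
    unfolding g_def
    by (intro cmap_compose[OF char_cont[OF e]] cmap_into_disc real_cmap cmap_interval_self, unfold
        topspace_disc)
      (use y in auto)
  then have "g ` (\<I> closure_of {0..<1}) \<subseteq> X closure_of (g ` {0..<1})"
    by (rule continuous_map_image_closure_subset)
  moreover have "1 \<in> \<I> closure_of {0..<1}"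
  proof -
    have "{0..1} \<inter> {0..<1} = {0..<1::real}" by auto
    then show ?thesis by (simp add: closure_of_subtopology)
  qed
  moreover have "g ` {0..<1} \<subseteq> e"
  proof -
    have "sqnorm n (\<lambda>i. t * y i) < 1" if "0 \<le> t" "t < 1" for t
    proof -
      have "t\<^sup>2 * sqnorm n y \<le> t\<^sup>2" using y(2) by (simp add: mult_left_le)
      also have "t\<^sup>2 < 1" using that by (simp add: power_less_one_iff)
      finally show ?thesis by (simp add: sqnorm_scale)
    qed
    then have "(\<lambda>i. t * y i) \<in> topspace (open_disc n)" if "t \<in> {0..<1}" for t
      using that y unfolding topspace_open_disc by simp
    then have "g t \<in> \<Phi> n e ` topspace (open_disc n)" if "t \<in> {0..<1}" for t
      using that unfolding g_def by (intro imageI)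
    then show ?thesis unfolding char_image[OF e] by (rule image_subsetI)
  qed
  ultimately have "g 1 \<in> X closure_of e"
    using closure_of_mono[of "g ` {0..<1}" e X] by (meson imageI subsetD)
  then show "x \<in> X closure_of e" by (simp add: g_def x)
qed

lemma closed_cell_eq: "e \<in> E n \<Longrightarrow> closed_cell n e = X closure_of e"
  using closed_cell_subset_closure closure_subset_closed_cell by blast

lemma char_boundary:
  assumes "e \<in> E n" "\<forall>i\<ge>n. y i = 0" "sqnorm n y = 1"
  shows "\<exists>k<n. \<exists>d\<in>E k. \<Phi> n e y \<in> d"
proof -
  obtain F where "F \<subseteq> (\<Union>k<n. E k)" "\<Phi> n e ` {x \<in> topspace (Euclidean_space n). (\<Sum>i<n. (x i)\<^sup>2) = 1} \<subseteq> \<Union>F"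
    using char_bd[OF assms(1)] by blast
  moreover have "y \<in> {x \<in> topspace (Euclidean_space n). (\<Sum>i<n. (x i)\<^sup>2) = 1}"
    using assms by (simp add: topspace_Euclidean_space sqnorm_def)
  ultimately have "\<Phi> n e y \<in> \<Union>(\<Union>k<n. E k)" by (meson Union_mono imageI subsetD)
  then show ?thesis by auto
qed

text \<open>
  The closure of a cell meets only finitely many cells.  Its intersection with a subcomplex is therefore
  a finite union of intersections of closures of cells.
\<close>

lemma closedin_subcomplex:
  assumes A: "cw_subcomplex X E A" shows "closedin X A"
proof -
  obtain D where "(\<forall>n. D n \<subseteq> E n) \<and> A = (\<Union>n. \<Union>(D n)) \<and> (\<forall>n. \<forall>e\<in>D n. X closure_of e \<subseteq> A)"
    using A[unfolded cw_subcomplex_def] ..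
  note D0 = this
  have DE: "d \<in> E k" if "d \<in> D k" for k d
    using conjunct1[OF D0] that by blast
  have DA: "X closure_of d \<subseteq> A" if "d \<in> D k" for k d
    using conjunct2[OF conjunct2[OF D0]] that by blast
  have AD: "\<exists>k. \<exists>d\<in>D k. x \<in> d" if "x \<in> A" for x
    using conjunct1[OF conjunct2[OF D0]] that by simp
  show ?thesis
  proof (rule weak)
    show "A \<subseteq> topspace X"
    proof
      fix x assume "x \<in> A"
      from AD[OF this] obtain k d where "d \<in> D k" "x \<in> d" by blast
      then show "x \<in> topspace X" using cell_subset[OF DE] by blast
    qed
    fix n e assume e: "e \<in> E n"
    obtain F where F: "finite F" "F \<subseteq> (\<Union>k<n. E k)" "\<Phi> n e ` {x \<in> topspace (Euclidean_space n).
        (\<Sum>i<n. (x i)\<^sup>2) = 1} \<subseteq> \<Union>F"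
      using char_bd[OF e] by blast
    have cl: "X closure_of e \<subseteq> \<Union>(insert e F)"
    proof
      fix x assume "x \<in> X closure_of e"
      then obtain y where y: "\<forall>i\<ge>n. y i = 0" "sqnorm n y \<le> 1" "x = \<Phi> n e y"
        using closed_cell_eq[OF e] unfolding closed_cell_def topspace_disc by blast
      show "x \<in> \<Union>(insert e F)"
      proof (cases "sqnorm n y < 1")
        case True
        then have "y \<in> topspace (open_disc n)" using y unfolding topspace_open_disc by simp
        then show ?thesis using char_image[OF e] y(3) by blast
      next
        case False
        then have "y \<in> {x \<in> topspace (Euclidean_space n). (\<Sum>i<n. (x i)\<^sup>2) = 1}"
          using y by (simp add: topspace_Euclidean_space sqnorm_def)
        then show ?thesis using F(3) y(3) by blast
      qed
    qed
    let ?C = "{d \<in> insert e F. \<exists>k. d \<in> D k}"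
    have "A \<inter> X closure_of e = (\<Union>d\<in>?C. X closure_of d \<inter> X closure_of e)"
    proof
      show "A \<inter> X closure_of e \<subseteq> (\<Union>d\<in>?C. X closure_of d \<inter> X closure_of e)"
      proof
        fix x assume x: "x \<in> A \<inter> X closure_of e"
        from AD[of x] x obtain k d where d: "d \<in> D k" "x \<in> d" by blast
        obtain d' where d': "d' \<in> insert e F" "x \<in> d'" using cl x by blast
        then obtain k' where k': "d' \<in> E k'" using e F(2) by blast
        have "d' \<inter> d \<noteq> {}" using d d' by blast
        then have "d' = d" using disj[OF k' DE[OF d(1)]] by blast
        moreover have "d \<subseteq> X closure_of d"
          by (rule closure_of_subset[OF cell_subset[OF DE[OF d(1)]]])
        ultimately have "d \<in> ?C" "x \<in> X closure_of d \<inter> X closure_of e"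
          using d d'(1) x by auto
        then show "x \<in> (\<Union>d\<in>?C. X closure_of d \<inter> X closure_of e)"
          by (rule UN_I)
      qed
      show "(\<Union>d\<in>?C. X closure_of d \<inter> X closure_of e) \<subseteq> A \<inter> X closure_of e"
        using DA by auto
    qed
    moreover have "closedin X (\<Union>d\<in>?C. X closure_of d \<inter> X closure_of e)"
      using F(1) by (intro closedin_Union) auto
    ultimately show "closedin X (A \<inter> X closure_of e)" by simp
  qed
qed

definition cell_dim :: "'a \<Rightarrow> nat" where "cell_dim x = (THE n. \<exists>e\<in>E n. x \<in> e)"

lemma cell_dim_eq: "\<lbrakk>e \<in> E n; x \<in> e\<rbrakk> \<Longrightarrow> cell_dim x = n"
  unfolding cell_dim_def
proof (rule the_equality)
  assume e: "e \<in> E n" "x \<in> e"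
  then show "\<exists>e\<in>E n. x \<in> e" by blast
  fix m assume "\<exists>e\<in>E m. x \<in> e"
  then obtain e' where "e' \<in> E m" "x \<in> e'" by blast
  then show "m = n" using disj[of e' m e n] e by blast
qed

end

definition sphere_proj :: "nat \<Rightarrow> (nat \<Rightarrow> real) \<Rightarrow> nat \<Rightarrow> real"
  where "sphere_proj n y = (\<lambda>i. inverse (sqrt (sqnorm n y)) * y i)"

text \<open>
  The map \<open>w\<close> combines a homotopy (first component) with a function \<open>u\<close> (second component) such that the
  homotopy has reached the vertex at every time later than \<open>u\<close>.  On a disc with characteristic map \<open>f\<close>, a
  point \<open>y\<close> first moves radially to the sphere, where it arrives at the time \<open>s\<close> with
  \<open>|y| (1 + s) = 1\<close>, and then follows the homotopy of its image on the sphere for the remaining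
  \<open>|y| (1 + s) - 1\<close>.  It reaches the vertex once this exceeds the value of \<open>u\<close> there, that is, later than
  \<open>(1 + u) / |y| - 1\<close>; this is the new value of \<open>u\<close>, cut off at 1.
\<close>

definition extend_contraction ::
  "nat \<Rightarrow> ((nat \<Rightarrow> real) \<Rightarrow> 'a) \<Rightarrow> ('a \<times> real \<Rightarrow> 'a \<times> real) \<Rightarrow> (nat \<Rightarrow> real) \<times> real \<Rightarrow> 'a \<times> real"
  where "extend_contraction n f w p =
    (let y = fst p; s = snd p; \<rho> = sqrt (sqnorm n y); z = f (sphere_proj n y) in
      (if \<rho> * (1 + s) \<le> 1 then f (\<lambda>i. (1 + s) * y i) else fst (w (z, \<rho> * (1 + s) - 1)),
       if \<rho> \<le> 1/2 then 1 else min 1 ((1 + snd (w (z, 0))) * inverse \<rho> - 1)))"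

lemma sphere_proj_on_sphere: "sqnorm n y > 0 \<Longrightarrow> sqnorm n (sphere_proj n y) = 1"
  by (simp add: sphere_proj_def sqnorm_scale power_inverse)

lemma sphere_proj_zero: "\<forall>i\<ge>n. y i = 0 \<Longrightarrow> \<forall>i\<ge>n. sphere_proj n y i = 0"
  by (simp add: sphere_proj_def)

lemma sphere_proj_id: "sqnorm n y = 1 \<Longrightarrow> sphere_proj n y = y"
  by (simp add: sphere_proj_def)

lemma sqnorm_scale_le:
  assumes "sqrt (sqnorm n y) * (1 + s) \<le> 1" "0 \<le> s"
  shows "sqnorm n (\<lambda>i. (1 + s) * y i) \<le> 1"
proof -
  have "(sqrt (sqnorm n y) * (1 + s))\<^sup>2 \<le> 1"
    using assms by (intro power_le_one) (auto simp: sqnorm_nonneg)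
  then show ?thesis
    unfolding sqnorm_scale by (simp add: power_mult_distrib sqnorm_nonneg mult.commute)
qed

lemma extend_contraction_cong:
  assumes "sqnorm n y > 0 \<Longrightarrow> (\<And>s. w (f (sphere_proj n y), s) = w' (f (sphere_proj n y), s))"
  shows "extend_contraction n f w (y, s) = extend_contraction n f w' (y, s)"
proof (cases "sqnorm n y > 0")
  case False
  then have "sqnorm n y = 0" using sqnorm_nonneg[of n y] by simp
  then show ?thesis by (simp add: extend_contraction_def)
qed (simp add: extend_contraction_def Let_def assms)

locale whitehead_vertex = whitehead_complex +
  fixes x0
  assumes vertex: "{x0} \<in> E 0"
begin

text \<open>
  The construction over the cells of dimension at most \<open>n\<close>.  Among the vertices only \<open>x0\<close> gets the value
  \<open>u = 0\<close>; the values at points of higher cells are provisional.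
\<close>

primrec stage :: "nat \<Rightarrow> 'a \<times> real \<Rightarrow> 'a \<times> real"
  where
    "stage 0 p = (fst p, if fst p = x0 then 0 else 1)"
  | "stage (Suc n) p =
      (if \<exists>e\<in>E (Suc n). fst p \<in> e then
        let e = (THE e. e \<in> E (Suc n) \<and> fst p \<in> e) in
          extend_contraction (Suc n) (\<Phi> (Suc n) e) (stage n)
            (inv_into (topspace (open_disc (Suc n))) (\<Phi> (Suc n) e) (fst p), snd p)
       else stage n p)"

definition contraction :: "'a \<times> real \<Rightarrow> 'a \<times> real"
  where "contraction p = stage (cell_dim (fst p)) p"

lemma stage_stable:
  assumes "e \<in> E k" "x \<in> e" "k \<le> n"
  shows "stage n (x, s) = contraction (x, s)"
  using assms(3)
proof (induction n)
  case 0
  then show ?case using cell_dim_eq[OF assms(1,2)] by (simp add: contraction_def)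
next
  case (Suc n)
  show ?case
  proof (cases "k = Suc n")
    case True
    then show ?thesis using cell_dim_eq[OF assms(1,2)] by (simp add: contraction_def)
  next
    case False
    have "\<not> (\<exists>e\<in>E (Suc n). x \<in> e)"
    proof
      assume "\<exists>e\<in>E (Suc n). x \<in> e"
      then obtain e' where "e' \<in> E (Suc n)" "x \<in> e'" ..
      then show False using disj[OF assms(1), of e' "Suc n"] assms(2) False by blast
    qed
    then have "stage (Suc n) (x, s) = stage n (x, s)" by simp
    then show ?thesis using Suc False by simp
  qed
qed

lemma contraction_vertex: "{x} \<in> E 0 \<or> (\<exists>e\<in>E 0. x \<in> e) \<Longrightarrow> contraction (x, s) = (x, if x = x0 then 0
    else 1)"
  using cell_dim_eq[of _ 0 x] by (auto simp: contraction_def)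

lemma contraction_interior:
  assumes e: "e \<in> E n" and n: "n > 0" and y: "y \<in> topspace (open_disc n)"
  shows "contraction (\<Phi> n e y, s) = extend_contraction n (\<Phi> n e) contraction (y, s)"
proof -
  obtain m where m: "n = Suc m" using n by (cases n) auto
  have x: "\<Phi> n e y \<in> e" using char_image[OF e] imageI[OF y, of "\<Phi> n e"] by simp
  have the: "(THE e. e \<in> E n \<and> \<Phi> n e' y \<in> e) = e" if "e' = e" for e'
  proof (rule the_equality)
    show "e \<in> E n \<and> \<Phi> n e' y \<in> e" using e x that by simp
    fix d assume "d \<in> E n \<and> \<Phi> n e' y \<in> d"
    then show "d = e" using disj[of d n e n] e x that by blast
  qed
  have "contraction (\<Phi> n e y, s) = stage (Suc m) (\<Phi> n e y, s)"
    using cell_dim_eq[OF e x] m by (simp add: contraction_def)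
  also have "\<dots> = extend_contraction n (\<Phi> n e) (stage m) (y, s)"
    unfolding stage.simps(2) fst_conv snd_conv
    unfolding m[symmetric] the[OF refl] Let_def inv_into_f_f[OF char_inj[OF e] y]
    using e x by auto
  also have "\<dots> = extend_contraction n (\<Phi> n e) contraction (y, s)"
  proof (rule extend_contraction_cong)
    fix s assume "sqnorm n y > 0"
    then obtain k d where "k < n" "d \<in> E k" "\<Phi> n e (sphere_proj n y) \<in> d"
      using char_boundary[OF e sphere_proj_zero sphere_proj_on_sphere] y
      unfolding topspace_open_disc by blast
    then show "stage m (\<Phi> n e (sphere_proj n y), s) = contraction (\<Phi> n e (sphere_proj n y), s)"
      by (intro stage_stable[of d k]) (auto simp: m)
  qed
  finally show ?thesis .
qed

text \<open>
  What the construction keeps true from cell to cell.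
\<close>

definition tame :: "'a set \<Rightarrow> 'a \<Rightarrow> bool"
  where "tame A x \<longleftrightarrow> fst (contraction (x, 0)) = x \<and>
    (\<forall>s. 0 \<le> s \<and> s \<le> 1 \<longrightarrow> fst (contraction (x, s)) \<in> topspace X \<and>
      snd (contraction (x, s)) = snd (contraction (x, 0)) \<and>
      0 \<le> snd (contraction (x, s)) \<and> snd (contraction (x, s)) \<le> 1 \<and>
      (snd (contraction (x, s)) < s \<longrightarrow> fst (contraction (x, s)) = x0) \<and>
      (x \<in> A \<longrightarrow> fst (contraction (x, s)) \<in> A))"

lemma char_in_space: "e \<in> E n \<Longrightarrow> y \<in> topspace (disc n) \<Longrightarrow> \<Phi> n e y \<in> topspace X"
  using continuous_map_image_subset_topspace[OF char_cont] by blast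

text \<open>
  Induction on the dimension: the image of the sphere under a characteristic map lies in cells of lower
  dimension.
\<close>

lemma tame_cells:
  assumes A: "cw_subcomplex X E A" and "e \<in> E n" "x \<in> e"
  shows "tame A x"
  using assms(2,3)
proof (induction n arbitrary: e x rule: less_induct)
  case (less n)
  note e = less.prems(1) and x = less.prems(2)
  have xX: "x \<in> topspace X" using cell_subset[OF e] x by blast
  show ?case
  proof (cases "n = 0")
    case True
    then have "contraction (x, s) = (x, if x = x0 then 0 else 1)" for s
      using contraction_vertex e x by blast
    then show ?thesis using xX by (simp add: tame_def)
  next
    case False
    then have n: "n > 0" by simp
    obtain y where y: "y \<in> topspace (open_disc n)" and xy: "x = \<Phi> n e y"
      using char_image[OF e] x by blast
    have y0: "\<forall>i\<ge>n. y i = 0" and y1: "sqnorm n y < 1"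
      using y unfolding topspace_open_disc by auto
    define \<rho> where "\<rho> = sqrt (sqnorm n y)"
    have \<rho>: "0 \<le> \<rho>" "\<rho> < 1" "sqnorm n y > 0 \<longleftrightarrow> \<rho> > 0"
      using y1 sqnorm_nonneg[of n y] by (auto simp: \<rho>_def)
    define z where "z = \<Phi> n e (sphere_proj n y)"
    have eq: "contraction (x, s) =
        (if \<rho> * (1 + s) \<le> 1 then \<Phi> n e (\<lambda>i. (1 + s) * y i) else fst (contraction (z, \<rho> * (1 + s) - 1)),
         if \<rho> \<le> 1/2 then 1 else min 1 ((1 + snd (contraction (z, 0))) * inverse \<rho> - 1))" for s
      unfolding xy contraction_interior[OF e n y] extend_contraction_def Let_def \<rho>_def z_def
          fst_conv snd_conv ..
    have disc: "(\<lambda>i. (1 + s) * y i) \<in> topspace (disc n)" if "\<rho> * (1 + s) \<le> 1" "0 \<le> s" for s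
      using sqnorm_scale_le[of n y s] that y0 unfolding topspace_disc \<rho>_def by simp
    have gz: "tame A z" and zB: "z \<in> closed_cell n e" if "\<rho> > 0"
    proof -
      have pos: "sqnorm n y > 0" using that \<rho>(3) by simp
      obtain k d where "k < n" "d \<in> E k" "z \<in> d"
        using char_boundary[OF e sphere_proj_zero[OF y0] sphere_proj_on_sphere[OF pos]] unfolding
            z_def by blast
      then show "tame A z" by (rule less.IH)
      show "z \<in> closed_cell n e"
        unfolding closed_cell_def z_def topspace_disc
        using sphere_proj_zero[OF y0] sphere_proj_on_sphere[OF pos] by (intro imageI) simp
    qed
    have BA: "closed_cell n e \<subseteq> A" if "x \<in> A"
    proof -
      obtain D where D0: "(\<forall>n. D n \<subseteq> E n) \<and> A = (\<Union>n. \<Union>(D n)) \<and> (\<forall>n. \<forall>e\<in>D n. X closure_of e \<subseteq> A)"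
        using A[unfolded cw_subcomplex_def] ..
      then obtain k d where d: "d \<in> D k" "x \<in> d" using \<open>x \<in> A\<close> by auto
      have "d \<in> E k" using conjunct1[OF D0] d(1) by blast
      then have "e = d" using disj[OF e] x d(2) by blast
      then show ?thesis
        unfolding closed_cell_eq[OF e] using conjunct2[OF conjunct2[OF D0]] d(1) by blast
    qed
    show ?thesis
      unfolding tame_def
    proof (intro conjI allI impI; (elim conjE)?)
      show "fst (contraction (x, 0)) = x"
        using eq[of 0] \<rho> xy by simp
      fix s :: real assume s: "0 \<le> s" "s \<le> 1"
      have t: "0 \<le> \<rho> * (1 + s) - 1" "\<rho> * (1 + s) - 1 \<le> 1" "\<rho> > 0" if "\<not> \<rho> * (1 + s) \<le> 1"
      proof -
        show "0 \<le> \<rho> * (1 + s) - 1" using that by simp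
        have "\<rho> * (1 + s) \<le> 1 * 2" by (rule mult_mono) (use \<rho> s in auto)
        then show "\<rho> * (1 + s) - 1 \<le> 1" by simp
        show "\<rho> > 0" using that \<rho>(1) by (cases "\<rho> = 0") auto
      qed
      note gz' = gz[unfolded tame_def, THEN conjunct2, rule_format]
      show "fst (contraction (x, s)) \<in> topspace X"
        using char_in_space[OF e disc] gz'[of "\<rho> * (1 + s) - 1"] t s by (auto simp: eq)
      show "snd (contraction (x, s)) = snd (contraction (x, 0))"
        by (simp add: eq)
      have u: "0 \<le> snd (contraction (z, 0))" "snd (contraction (z, 0)) \<le> 1" if "\<rho> > 0"
        using gz'[OF that, of 0] by auto
      have "1 \<le> (1 + snd (contraction (z, 0))) * inverse \<rho>" if "\<rho> > 0"
      proof -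
        have "1 \<le> inverse \<rho>" using that \<rho>(2) by (simp add: one_le_inverse)
        then show ?thesis using mult_mono[of 1 "1 + snd (contraction (z, 0))" 1 "inverse \<rho>"] u[OF
            that] by simp
      qed
      then show "0 \<le> snd (contraction (x, s))" by (simp add: eq)
      show "snd (contraction (x, s)) \<le> 1" by (simp add: eq)
      show "fst (contraction (x, s)) \<in> A" if "x \<in> A"
      proof (cases "\<rho> * (1 + s) \<le> 1")
        case True
        then have "fst (contraction (x, s)) \<in> closed_cell n e"
          using imageI[OF disc[OF True s(1)], of "\<Phi> n e"] by (simp add: eq closed_cell_def)
        then show ?thesis using BA[OF that] by blast
      next
        case False
        have "z \<in> A" using zB[OF t(3)[OF False]] BA[OF that] by blast
        then show ?thesis
          using gz'[OF t(3)[OF False], of "\<rho> * (1 + s) - 1"] t[OF False] False by (simp add: eq)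
      qed
      show "fst (contraction (x, s)) = x0" if small: "snd (contraction (x, s)) < s"
      proof -
        have \<rho>2: "\<rho> > 1/2" "(1 + snd (contraction (z, 0))) * inverse \<rho> - 1 < s"
          using small s by (auto simp: eq split: if_splits)
        then have "1 + snd (contraction (z, 0)) < \<rho> * (1 + s)"
          by (simp add: field_simps)
        moreover have "\<rho> > 0" using \<rho>2 by simp
        ultimately have big: "\<not> \<rho> * (1 + s) \<le> 1" and lt: "snd (contraction (z, 0)) < \<rho> * (1 + s) - 1"
          using u by auto
        then show ?thesis
          using gz'[OF \<open>\<rho> > 0\<close>, of "\<rho> * (1 + s) - 1"] t[OF big] by (simp add: eq)
      qed
    qed
  qed
qed

lemma tameD:
  assumes "tame A x" "0 \<le> s" "s \<le> 1"
  shows "fst (contraction (x, 0)) = x" "fst (contraction (x, s)) \<in> topspace X"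
    "snd (contraction (x, s)) = snd (contraction (x, 0))"
    "0 \<le> snd (contraction (x, s))" "snd (contraction (x, s)) \<le> 1"
    "snd (contraction (x, s)) < s \<Longrightarrow> fst (contraction (x, s)) = x0"
    "x \<in> A \<Longrightarrow> fst (contraction (x, s)) \<in> A"
proof -
  note * = assms(1)[unfolded tame_def]
  show "fst (contraction (x, 0)) = x" using conjunct1[OF *] .
  note ** = conjunct2[OF *, rule_format, OF conjI[OF assms(2,3)]]
  show "fst (contraction (x, s)) \<in> topspace X"
    "snd (contraction (x, s)) = snd (contraction (x, 0))"
    "0 \<le> snd (contraction (x, s))" "snd (contraction (x, s)) \<le> 1"
    "snd (contraction (x, s)) < s \<Longrightarrow> fst (contraction (x, s)) = x0"
    "x \<in> A \<Longrightarrow> fst (contraction (x, s)) \<in> A"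
    using ** by blast+
qed

text \<open>
  On the sphere the extension formula reproduces the values it started from, so it holds on the closed
  disc and not only in the interior of the cell.
\<close>

lemma contraction_char:
  assumes A: "cw_subcomplex X E A" and e: "e \<in> E n" and n: "n > 0" and y: "y \<in> topspace (disc n)"
      and s: "0 \<le> s" "s \<le> 1"
  shows "contraction (\<Phi> n e y, s) = extend_contraction n (\<Phi> n e) contraction (y, s)"
proof (cases "sqnorm n y < 1")
  case True
  then have "y \<in> topspace (open_disc n)" using y unfolding topspace_open_disc topspace_disc by simp
  then show ?thesis by (rule contraction_interior[OF e n])
next
  case False
  then have y1: "sqnorm n y = 1" and y0: "\<forall>i\<ge>n. y i = 0"
    using y unfolding topspace_disc by auto
  obtain k d where "d \<in> E k" "\<Phi> n e y \<in> d"
    using char_boundary[OF e y0 y1] by blast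
  then have g: "tame A (\<Phi> n e y)" by (rule tame_cells[OF A])
  have c0: "fst (contraction (\<Phi> n e y, 0)) = \<Phi> n e y"
    and cs: "snd (contraction (\<Phi> n e y, s)) = snd (contraction (\<Phi> n e y, 0))"
    and c1: "snd (contraction (\<Phi> n e y, 0)) \<le> 1"
    using tameD[OF g s] tameD[OF g, of 0] by auto
  have "extend_contraction n (\<Phi> n e) contraction (y, s) =
     (if s \<le> 0 then \<Phi> n e (\<lambda>i. (1 + s) * y i) else fst (contraction (\<Phi> n e y, s)), snd (contraction
         (\<Phi> n e y, 0)))"
    using c1 by (simp add: extend_contraction_def sphere_proj_id[OF y1] y1 Let_def)
  also have "\<dots> = (fst (contraction (\<Phi> n e y, s)), snd (contraction (\<Phi> n e y, s)))"
  proof (cases "s = 0")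
    case True
    then show ?thesis by (simp add: c0)
  qed (use s cs in simp)
  finally show ?thesis by simp
qed

text \<open>
  By induction the contraction is continuous on the closures of the finitely many lower cells that meet the
  image of the sphere, hence on their union.  The formula is then continuous on the disc, from which the
  closed cell is a quotient.
\<close>

lemma continuous_on_closed_cell:
  assumes A: "cw_subcomplex X E A" and "e \<in> E n"
  shows "continuous_map (cyl (subtopology X (closed_cell n e))) (prod_topology X euclideanreal)
      contraction"
  using assms(2)
proof (induction n arbitrary: e rule: less_induct)
  case (less n)
  note e = less.prems
  let ?B = "subtopology X (closed_cell n e)"
  have B: "topspace ?B = closed_cell n e"
    using closedin_subset[OF closedin_closed_cell[OF e]] by auto
  have char_B: "continuous_map (disc n) ?B (\<Phi> n e)"
    using char_cont[OF e] by (auto simp: continuous_map_in_subtopology closed_cell_def)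
  have quot: "quotient_map (disc n) ?B (\<Phi> n e)"
    by (rule T1_Spaces.continuous_imp_quotient_map[OF char_B compact_space_disc
        Hausdorff_space_subtopology[OF haus]])
      (rule trans[OF closed_cell_def[symmetric] B[symmetric]])
  let ?T = "cyl (disc n)"
  have cy: "continuous_map ?T euclideanreal (\<lambda>p. fst p i)" for i
    by (rule cmap_compose[OF cmap_disc_coord continuous_map_fst])
  have cs: "continuous_map ?T \<I> snd" by (rule continuous_map_snd)
  note csr = cmap_unit_intervalD[OF cs]
  have T: "fst p \<in> topspace (disc n)" "0 \<le> snd p" "snd p \<le> 1" if "p \<in> topspace ?T" for p
    using that unfolding topspace_prod_topology by auto
  have "continuous_map ?T (prod_topology X euclideanreal) (\<lambda>p. contraction (\<Phi> n e (fst p), snd p))"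
  proof (cases "n = 0")
    case True
    have "contraction (\<Phi> n e (fst p), snd p) = (\<Phi> n e (fst p), if \<Phi> n e (\<lambda>_. 0) = x0 then 0 else 1)"
      if "p \<in> topspace ?T" for p
    proof -
      have "fst p i = 0" for i
        using T(1)[OF that] unfolding topspace_disc True by simp
      then have y: "fst p = (\<lambda>_. 0)" by (rule ext)
      have "(\<lambda>_. 0) \<in> topspace (open_disc n)"
        unfolding topspace_open_disc True by (simp add: sqnorm_def)
      then have "\<Phi> n e (\<lambda>_. 0) \<in> e"
        using imageI[of _ _ "\<Phi> n e"] char_image[OF e] by blast
      then have "\<exists>d\<in>E 0. \<Phi> n e (\<lambda>_. 0) \<in> d"
        using e True by blast
      from contraction_vertex[OF disjI2[OF this]] show ?thesis
        unfolding y .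
    qed
    note eq = this
    have "continuous_map ?T (prod_topology X euclideanreal) (\<lambda>p. (\<Phi> n e (fst p), if \<Phi> n e (\<lambda>_. 0) =
        x0 then 0 else 1))"
      by (intro continuous_map_pairedI cmap_compose[OF char_cont[OF e] continuous_map_fst] real_cmap)
    then show ?thesis by (rule continuous_map_eq) (rule eq[symmetric])
  next
    case False
    then have n: "n > 0" by simp
    obtain F where F: "finite F" "F \<subseteq> (\<Union>k<n. E k)"
        "\<Phi> n e ` {x \<in> topspace (Euclidean_space n). (\<Sum>i<n. (x i)\<^sup>2) = 1} \<subseteq> \<Union>F"
      using char_bd[OF e] by blast
    have "\<forall>d\<in>F. \<exists>k. k < n \<and> d \<in> E k" using F(2) by blast
    then obtain \<kappa> where \<kappa>: "\<And>d. d \<in> F \<Longrightarrow> \<kappa> d < n \<and> d \<in> E (\<kappa> d)" by metis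
    define L where "L = (\<Union>d\<in>F. closed_cell (\<kappa> d) d)"
    have Lclosed: "closedin X (closed_cell (\<kappa> d) d)" if "d \<in> F" for d
      using closedin_closed_cell \<kappa>[OF that] by blast
    have contL: "continuous_map (cyl (subtopology X L)) (prod_topology X euclideanreal) contraction"
    proof (rule pasting_lemma_closed[OF F(1)])
      fix d assume d: "d \<in> F"
      have sub: "closed_cell (\<kappa> d) d \<subseteq> L" using d unfolding L_def by blast
      show "closedin (cyl (subtopology X L)) (closed_cell (\<kappa> d) d \<times> {0..1})"
        using closedin_subset_topspace[OF Lclosed[OF d] sub] by (simp add: closedin_prod_Times_iff)
      have "subtopology (cyl (subtopology X L)) (closed_cell (\<kappa> d) d \<times> {0..1}) = cyl (subtopology X
          (closed_cell (\<kappa> d) d))"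
        using sub by (simp add: subtopology_Times subtopology_subtopology Int_absorb1)
      then show "continuous_map (subtopology (cyl (subtopology X L)) (closed_cell (\<kappa> d) d \<times> {0..1}))
          (prod_topology X euclideanreal) contraction"
        using less.IH[of "\<kappa> d" d] \<kappa>[OF d] by simp
    next
      fix p assume "p \<in> topspace (cyl (subtopology X L))"
      then show "\<exists>d. d \<in> F \<and> p \<in> closed_cell (\<kappa> d) d \<times> {0..1} \<and> contraction p = contraction p"
        unfolding L_def by auto
    qed simp
    let ?\<rho> = "\<lambda>p. sqrt (sqnorm n (fst p))" and ?z = "\<lambda>p. \<Phi> n e (sphere_proj n (fst p))"
    have c\<rho>: "continuous_map ?T euclideanreal ?\<rho>"
      by (intro continuous_map_sqrt cmap_sqnorm cy)
    \<comment> \<open>Before and after the arrival at the sphere; the sphere can be reached by the time 1 only from the outer half.\<close>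
    let ?early = "{p \<in> topspace ?T. ?\<rho> p * (1 + snd p) \<le> 1}" and ?late = "{p \<in> topspace ?T. 1 \<le> ?\<rho> p
        * (1 + snd p)}"
    define outer where "outer = {p \<in> topspace ?T. 1/2 \<le> ?\<rho> p}"
    have zL: "?z p \<in> L" and pd: "sphere_proj n (fst p) \<in> topspace (disc n)" if "p \<in> outer" for p
    proof -
      have p: "\<forall>i\<ge>n. fst p i = 0" and pos: "sqnorm n (fst p) > 0"
        using that T(1)[of p] sqnorm_nonneg[of n "fst p"] unfolding outer_def topspace_disc
        by (auto simp: less_eq_real_def)
      note sp = sphere_proj_zero[OF p] sphere_proj_on_sphere[OF pos]
      then have "sphere_proj n (fst p) \<in> {x \<in> topspace (Euclidean_space n). (\<Sum>i<n. (x i)\<^sup>2) = 1}"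
        by (simp add: topspace_Euclidean_space sqnorm_def)
      then obtain d where "d \<in> F" "?z p \<in> d" using F(3) by blast
      then show "?z p \<in> L"
        unfolding L_def using cell_subset_closed_cell[of d "\<kappa> d"] \<kappa>[of d] by blast
      show "sphere_proj n (fst p) \<in> topspace (disc n)"
        using sp unfolding topspace_disc by simp
    qed
    have cz: "continuous_map (subtopology ?T outer) (subtopology X L) ?z"
    proof -
      have "continuous_map (subtopology ?T outer) (disc n) (\<lambda>p. sphere_proj n (fst p))"
      proof (rule cmap_into_disc)
        show "continuous_map (subtopology ?T outer) euclideanreal (\<lambda>p. sphere_proj n (fst p) i)" for i
          unfolding sphere_proj_def
          by (intro real_cmap continuous_map_real_inverse cmap_subtopology c\<rho> cy) (auto simp: outer_def)
      qed (use pd in auto)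
      from cmap_compose[OF char_cont[OF e] this]
      show ?thesis using zL by (auto simp: continuous_map_in_subtopology)
    qed
    have outer_sub: "continuous_map (subtopology ?T S) Y f"
      if "continuous_map (subtopology ?T outer) Y f" "S \<subseteq> outer" for S and Y :: "'b topology" and f
      by (rule continuous_map_from_subtopology_mono[OF that])
    have Touter: "p \<in> outer" if "p \<in> topspace ?T" "1 \<le> ?\<rho> p * (1 + snd p)" for p
    proof -
      have "?\<rho> p * (1 + snd p) \<le> ?\<rho> p * 2"
        by (rule mult_left_mono) (use T[OF that(1)] sqnorm_nonneg in auto)
      then show ?thesis using that by (simp add: outer_def)
    qed
    have \<rho>1: "?\<rho> p \<le> 1" if "p \<in> topspace ?T" for p
      using T(1)[OF that] unfolding topspace_disc by simp
    have first: "continuous_map ?T X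
      (\<lambda>p. if ?\<rho> p * (1 + snd p) \<le> 1 then \<Phi> n e (\<lambda>i. (1 + snd p) * fst p i)
        else fst (contraction (?z p, ?\<rho> p * (1 + snd p) - 1)))"
    proof (rule continuous_map_cases_le)
      show "continuous_map (subtopology ?T ?early) X (\<lambda>p. \<Phi> n e (\<lambda>i. (1 + snd p) * fst p i))"
      proof (rule cmap_compose[OF char_cont[OF e]], rule cmap_into_disc)
        show "continuous_map (subtopology ?T ?early) euclideanreal (\<lambda>p. (1 + snd p) * fst p i)" for i
          by (intro cmap_subtopology real_cmap csr cy)
        fix p assume "p \<in> topspace (subtopology ?T ?early)"
        then have p: "p \<in> topspace ?T" "?\<rho> p * (1 + snd p) \<le> 1" by simp_all
        show "(\<lambda>i. (1 + snd p) * fst p i) \<in> topspace (disc n)"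
          using sqnorm_scale_le[OF p(2)] T[OF p(1)] unfolding topspace_disc by simp
      qed
      show "continuous_map (subtopology ?T ?late) X
        (\<lambda>p. fst (contraction (?z p, ?\<rho> p * (1 + snd p) - 1)))"
      proof (rule cmap_fst, rule cmap_compose[OF contL], rule continuous_map_pairedI)
        show "continuous_map (subtopology ?T ?late) (subtopology X L) ?z"
          by (rule outer_sub[OF cz]) (use Touter in blast)
        show "continuous_map (subtopology ?T ?late) \<I> (\<lambda>p. ?\<rho> p * (1 + snd p) - 1)"
        proof (rule cmap_unit_intervalI)
          fix p assume "p \<in> topspace (subtopology ?T ?late)"
          then have p: "p \<in> topspace ?T" "1 \<le> ?\<rho> p * (1 + snd p)" by simp_all
          then show "0 \<le> ?\<rho> p * (1 + snd p) - 1" by simp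
          have "?\<rho> p * (1 + snd p) \<le> 1 * 2"
            by (rule mult_mono[OF \<rho>1]) (use p T[OF p(1)] in auto)
          then show "?\<rho> p * (1 + snd p) - 1 \<le> 1" by simp
        qed (intro cmap_subtopology real_cmap c\<rho> csr)
      qed
      fix p assume p: "p \<in> topspace ?T" and eq: "?\<rho> p * (1 + snd p) = 1"
      have "sphere_proj n (fst p) = (\<lambda>i. (1 + snd p) * fst p i)"
        using inverse_unique[OF eq] by (simp add: sphere_proj_def)
      moreover have "fst (contraction (?z p, 0)) = ?z p"
      proof -
        have "?z p \<in> topspace X" using char_in_space[OF e pd[OF Touter[OF p]]] eq by simp
        then obtain k d where "d \<in> E k" "?z p \<in> d" using cover by blast
        then show ?thesis by (intro tameD(1)[OF tame_cells[OF A], of d k _ 0]) auto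
      qed
      ultimately show "\<Phi> n e (\<lambda>i. (1 + snd p) * fst p i) = fst (contraction (?z p, ?\<rho> p * (1 + snd
          p) - 1))"
        using eq by simp
    qed (intro real_cmap c\<rho> csr)+
    have second: "continuous_map ?T euclideanreal
      (\<lambda>p. if ?\<rho> p \<le> 1/2 then 1 else min 1 ((1 + snd (contraction (?z p, 0))) * inverse (?\<rho> p) - 1))"
    proof (rule continuous_map_cases_le)
      have "continuous_map (subtopology ?T outer) euclideanreal (\<lambda>p. snd (contraction (?z p, 0)))"
        by (rule cmap_snd, rule cmap_compose[OF contL], intro continuous_map_pairedI cz) simp
      moreover have "continuous_map (subtopology ?T outer) euclideanreal (\<lambda>p. inverse (?\<rho> p))"
        by (intro continuous_map_real_inverse cmap_subtopology c\<rho>) (auto simp: outer_def)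
      ultimately have "continuous_map (subtopology ?T outer) euclideanreal
          (\<lambda>p. min 1 ((1 + snd (contraction (?z p, 0))) * inverse (?\<rho> p) - 1))"
        by (intro real_cmap)
      then show "continuous_map (subtopology ?T {p \<in> topspace ?T. 1/2 \<le> ?\<rho> p}) euclideanreal
          (\<lambda>p. min 1 ((1 + snd (contraction (?z p, 0))) * inverse (?\<rho> p) - 1))"
        unfolding outer_def .
      fix p assume p: "p \<in> topspace ?T" and eq: "?\<rho> p = 1/2"
      have "p \<in> outer" using p eq by (simp add: outer_def)
      then have "?z p \<in> topspace X" using char_in_space[OF e pd] by simp
      then obtain k d where "d \<in> E k" "?z p \<in> d" using cover by blast
      then have "tame A (?z p)" by (rule tame_cells[OF A])
      then have "0 \<le> snd (contraction (?z p, 0))" by (rule tameD(4)) auto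
      then show "1 = min 1 ((1 + snd (contraction (?z p, 0))) * inverse (?\<rho> p) - 1)"
        unfolding eq by simp
    qed (intro real_cmap c\<rho> cmap_subtopology)+
    show ?thesis
    proof (rule continuous_map_eq[OF continuous_map_pairedI[OF first second]])
      fix p assume p: "p \<in> topspace ?T"
      show "(if ?\<rho> p * (1 + snd p) \<le> 1 then \<Phi> n e (\<lambda>i. (1 + snd p) * fst p i) else fst (contraction
          (?z p, ?\<rho> p * (1 + snd p) - 1)),
          if ?\<rho> p \<le> 1/2 then 1 else min 1 ((1 + snd (contraction (?z p, 0))) * inverse (?\<rho> p) - 1))
        = contraction (\<Phi> n e (fst p), snd p)"
        unfolding contraction_char[OF A e n T[OF p]] extend_contraction_def Let_def fst_conv snd_conv ..
    qed
  qed
  then show ?case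
    using continuous_map_from_final[OF final_maps_prod_right[OF final_maps_quotient_map[OF quot]]]
        by simp
qed

lemma continuous_contraction:
  assumes A: "cw_subcomplex X E A"
  shows "continuous_map (cyl X) (prod_topology X euclideanreal) contraction"
proof -
  let ?L = "{c. snd c \<in> E (fst c)}" and ?B = "\<lambda>c. closed_cell (fst c) (snd c)"
  have "final_maps ?L (\<lambda>c. subtopology X (?B c)) (\<lambda>_ x. x) X"
    unfolding final_maps_def
  proof (intro conjI ballI allI impI; (elim conjE)?)
    show "continuous_map (subtopology X (?B c)) X (\<lambda>x. x)" for c
      by (rule cmap_subtopology[OF cmap_ident])
    show "topspace X \<subseteq> (\<Union>c\<in>?L. (\<lambda>x. x) ` topspace (subtopology X (?B c)))"
    proof
      fix x assume x: "x \<in> topspace X"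
      then obtain n e where e: "e \<in> E n" "x \<in> e" using cover by blast
      then show "x \<in> (\<Union>c\<in>?L. (\<lambda>x. x) ` topspace (subtopology X (?B c)))"
        using cell_subset_closed_cell[OF e(1)] x by (intro UN_I[of "(n, e)"]) auto
    qed
    fix U assume U: "U \<subseteq> topspace X"
      and op: "\<forall>c\<in>?L. openin (subtopology X (?B c)) {x \<in> topspace (subtopology X (?B c)). x \<in> U}"
    have "closedin X (topspace X - U)"
    proof (rule weak)
      fix n e assume e: "e \<in> E n"
      let ?S = "subtopology X (closed_cell n e)"
      have "openin ?S {x \<in> topspace ?S. x \<in> U}"
        using op[rule_format, of "(n, e)"] e by simp
      then have "closedin ?S (topspace ?S - {x \<in> topspace ?S. x \<in> U})"
        by (rule closedin_diff[OF closedin_topspace])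
      then have "closedin X (topspace ?S - {x \<in> topspace ?S. x \<in> U})"
        by (rule closedin_trans_full[OF _ closedin_closed_cell[OF e]])
      moreover have "(topspace X - U) \<inter> X closure_of e = topspace ?S - {x \<in> topspace ?S. x \<in> U}"
        using closed_cell_eq[OF e] by auto
      ultimately show "closedin X ((topspace X - U) \<inter> X closure_of e)" by simp
    qed auto
    then show "openin X U" using U by (simp add: openin_closedin_eq)
  qed
  from final_maps_prod_right[OF this] show ?thesis
  proof (rule continuous_map_from_final)
    fix c assume "c \<in> ?L"
    then show "continuous_map (cyl (subtopology X (?B c))) (prod_topology X euclideanreal) (\<lambda>x.
        contraction (fst x, snd x))"
      using continuous_on_closed_cell[OF A, of "snd c" "fst c"] by simp
  qed
qed

end

lemma cw_char_maps:
  assumes "cw_complex X E"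
  shows "\<exists>\<Phi>. whitehead_complex X E \<Phi>"
proof -
  let ?char = "\<lambda>n e \<Phi>. continuous_map (disc n) X \<Phi> \<and> homeomorphic_map (open_disc n) (subtopology X e) \<Phi> \<and>
       (\<exists>F. finite F \<and> F \<subseteq> (\<Union>k<n. E k) \<and>
          \<Phi> ` {x \<in> topspace (Euclidean_space n). (\<Sum>i<n. (x i)\<^sup>2) = 1} \<subseteq> \<Union>F)"
  note cw = assms[unfolded cw_complex_def]
  define \<Phi> where "\<Phi> n e = (SOME \<Phi>. ?char n e \<Phi>)" for n e
  have \<Phi>: "?char n e (\<Phi> n e)" if "e \<in> E n" for n e
  proof -
    have "\<exists>\<Phi>. ?char n e \<Phi>"
      using conjunct1[OF conjunct2[OF conjunct2[OF conjunct2[OF cw]]], rule_format, OF that] .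
    then show ?thesis unfolding \<Phi>_def by (rule someI_ex)
  qed
  have "whitehead_complex X E \<Phi>"
  proof
    show "Hausdorff_space X" "(\<Union>n. \<Union>(E n)) = topspace X" using cw by simp_all
    show "n = k \<and> e = e'" if "e \<in> E n" "e' \<in> E k" "e \<inter> e' \<noteq> {}" for e e' n k
      using conjunct1[OF conjunct2[OF conjunct2[OF cw]], rule_format, OF that] .
    show "closedin X C" if "C \<subseteq> topspace X" "\<And>n e. e \<in> E n \<Longrightarrow> closedin X (C \<inter> X closure_of e)" for C
      using conjunct2[OF conjunct2[OF conjunct2[OF conjunct2[OF cw]]], rule_format, of C] that by simp
    fix n e assume e: "e \<in> E n"
    note * = \<Phi>[OF e]
    show "continuous_map (disc n) X (\<Phi> n e)" by (rule conjunct1[OF *])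
    show "homeomorphic_map (open_disc n) (subtopology X e) (\<Phi> n e)" by (rule conjunct1[OF
        conjunct2[OF *]])
    show "\<exists>F. finite F \<and> F \<subseteq> (\<Union>k<n. E k) \<and> \<Phi> n e ` {x \<in> topspace (Euclidean_space n). (\<Sum>i<n. (x
        i)\<^sup>2) = 1} \<subseteq> \<Union>F"
      by (rule conjunct2[OF conjunct2[OF *]])
  qed
  then show ?thesis by (intro exI[of _ \<Phi>])
qed

text \<open>
  The neighbourhood \<open>u < 1\<close> of the vertex is contracted to it by a homotopy of the whole space that
  preserves the subcomplex.
\<close>

lemma cw_pair_contraction:
  assumes "connected_based_cw_pair X A x0"
  obtains h u where "continuous_map (prod_topology \<I> X) X h" "continuous_map X \<I> u" "u x0 = 0"
    "\<And>x. x \<in> topspace X \<Longrightarrow> h (0, x) = x"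
    "\<And>x. \<lbrakk>x \<in> topspace X; u x < 1\<rbrakk> \<Longrightarrow> h (1, x) = x0"
    "\<And>s. \<lbrakk>0 \<le> s; s \<le> 1\<rbrakk> \<Longrightarrow> h (s, x0) = x0"
    "\<And>s x. \<lbrakk>0 \<le> s; s \<le> 1; x \<in> A\<rbrakk> \<Longrightarrow> h (s, x) \<in> A"
    "Hausdorff_space X" "closedin X A" "x0 \<in> A" "A \<subseteq> topspace X"
proof -
  have *: "(\<exists>E. cw_complex X E \<and> cw_subcomplex X E A \<and> {x0} \<in> E 0) \<and> x0 \<in> A"
    using assms by (simp add: connected_based_cw_pair_def)
  obtain E where E0: "cw_complex X E \<and> cw_subcomplex X E A \<and> {x0} \<in> E 0"
    by (rule exE[OF conjunct1[OF *]])
  note E = conjunct1[OF E0] conjunct1[OF conjunct2[OF E0]] conjunct2[OF conjunct2[OF E0]]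
  have x0: "x0 \<in> A" by (rule conjunct2[OF *])
  obtain \<Phi> where \<Phi>: "whitehead_complex X E \<Phi>"
    by (rule exE[OF cw_char_maps[OF E(1)]])
  have wv: "whitehead_vertex X E \<Phi> x0"
    unfolding whitehead_vertex_def whitehead_vertex_axioms_def using \<Phi> E(3) by (rule conjI)
  interpret whitehead_vertex X E \<Phi> x0
    by (rule wv)
  have tame: "tame A x" if "x \<in> topspace X" for x
  proof -
    have "x \<in> (\<Union>n. \<Union>(E n))" by (simp only: cover that)
    then obtain n e where "e \<in> E n" "x \<in> e" by (elim UN_E UnionE)
    then show ?thesis by (rule tame_cells[OF E(2)])
  qed
  have closed: "closedin X A" by (rule closedin_subcomplex[OF E(2)])
  then have AX: "A \<subseteq> topspace X" by (rule closedin_subset)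
  note cont = continuous_contraction[OF E(2)]
  have c0: "contraction (x0, s) = (x0, 0)" for s
    using contraction_vertex[of x0 s] E(3) by simp
  show ?thesis
  proof (rule that[of "\<lambda>p. fst (contraction (snd p, fst p))" "\<lambda>x. snd (contraction (x, 0))"])
    show "continuous_map (prod_topology \<I> X) X (\<lambda>p. fst (contraction (snd p, fst p)))"
      by (rule cmap_fst, rule cmap_compose[OF cont]) (intro continuous_map_pairedI
          continuous_map_fst continuous_map_snd)
    show "continuous_map X \<I> (\<lambda>x. snd (contraction (x, 0)))"
    proof (rule cmap_unit_intervalI)
      show "continuous_map X euclideanreal (\<lambda>x. snd (contraction (x, 0)))"
        by (rule cmap_snd, rule cmap_compose[OF cont]) (intro continuous_map_pairedI cmap_ident, simp)
    qed (use tameD(4,5)[OF tame, of _ 0] in auto)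
    fix x s
    show "fst (contraction (snd (0, x), fst (0, x))) = x" if "x \<in> topspace X"
      using tameD(1)[OF tame[OF that], of 0] by simp
    show "fst (contraction (snd (1, x), fst (1, x))) = x0" if "x \<in> topspace X" "snd (contraction (x,
        0)) < 1"
      using tameD(3,6)[OF tame[OF that(1)], of 1] that(2) by simp
    show "fst (contraction (snd (s, x), fst (s, x))) \<in> A" if "0 \<le> s" "s \<le> 1" "x \<in> A"
      using tameD(7)[OF tame, of x s] that AX by auto
  qed (auto simp: c0 haus closed x0 AX subsetD[OF AX])
qed

section \<open>Polyhedral products as pieces of the wedge\<close>

lemma polyhedral_product_space:
  "fst (polyhedral_product X A x0 J L) =
     subtopology (product_topology (\<lambda>_. X) J) (\<Union>I\<in>L. polyhedral_block X A J I)"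
  by (simp add: polyhedral_product_def)

lemma in_polyhedral_product:
  "x \<in> topspace (fst (polyhedral_product X A x0 J L)) \<longleftrightarrow>
     x \<in> extensional J \<and> (\<forall>j\<in>J. x j \<in> topspace X) \<and> (\<exists>I\<in>L. \<forall>j\<in>J - I. x j \<in> A)"
proof -
  have "x \<in> topspace (fst (polyhedral_product X A x0 J L)) \<longleftrightarrow>
      x \<in> PiE J (\<lambda>_. topspace X) \<and> (\<exists>I\<in>L. x \<in> polyhedral_block X A J I)"
    by (simp add: polyhedral_product_space)
  also have "\<dots> \<longleftrightarrow> x \<in> PiE J (\<lambda>_. topspace X) \<and> (\<exists>I\<in>L. \<forall>j\<in>J - I. x j \<in> A)"
    by (auto simp: polyhedral_block_def)
  finally show ?thesis by (simp add: PiE_iff conj_commute conj_left_commute)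
qed

lemma cmap_into_polyhedral_product:
  assumes "\<And>j. j \<in> J \<Longrightarrow> continuous_map T X (\<lambda>z. f z j)"
    and "\<And>z. z \<in> topspace T \<Longrightarrow> f z \<in> topspace (fst (polyhedral_product X A x0 J L))"
  shows "continuous_map T (fst (polyhedral_product X A x0 J L)) f"
proof -
  have "continuous_map T (product_topology (\<lambda>_. X) J) f"
  proof (rule continuous_map_coordinatewise_then_product)
    show "f z i = undefined" if "i \<notin> J" "z \<in> topspace T" for i z
      using conjunct1[OF assms(2)[OF that(2), unfolded in_polyhedral_product]] that(1) by (rule
          extensional_arb)
  qed (rule assms(1))
  moreover have "f z \<in> (\<Union>I\<in>L. polyhedral_block X A J I)" if "z \<in> topspace T" for z
    using assms(2)[OF that] by (simp add: polyhedral_product_space)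
  ultimately show ?thesis
    unfolding polyhedral_product_space continuous_map_in_subtopology by (intro conjI funcsetI)
qed

lemma cmap_polyhedral_coord:
  assumes "j \<in> J"
  shows "continuous_map (fst (polyhedral_product X A x0 J L)) X (\<lambda>x. x j)"
  unfolding polyhedral_product_space
  using continuous_map_product_coordinates[OF assms, of "\<lambda>_. X"] by (intro cmap_subtopology) simp

lemma closed_map_collapse:
  assumes W: "closedin B W" and b: "b \<in> W"
  shows "closed_map B (fst (collapse B W b)) (collapse_map W b)"
  unfolding closed_map_def
proof (intro allI impI)
  fix D assume D: "closedin B D"
  let ?q = "collapse_map W b"
  have WB: "W \<subseteq> topspace B" and DB: "D \<subseteq> topspace B" using W D by (auto dest: closedin_subset)
  have "{x \<in> topspace B. ?q x \<in> ?q ` D} = (if D \<inter> W = {} then D else D \<union> W)"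
    using WB DB b by (auto simp: collapse_map_def split: if_splits)
  then have "closedin B {x \<in> topspace B. ?q x \<in> ?q ` D}"
    using D W by (simp add: closedin_Un)
  moreover have "?q ` D \<subseteq> topspace (fst (collapse B W b))"
    using DB unfolding topspace_collapse[OF b] by (rule image_mono)
  ultimately show "closedin (fst (collapse B W b)) (?q ` D)"
    using quotient_map_collapse[of B W b] unfolding quotient_map_closedin by blast
qed

text \<open>
  Collapsing a closed set is a closed map, and therefore remains a quotient map when restricted to a closed
  subset.  This is why the polyhedral smash product, defined as a subspace of a quotient, is also the
  quotient of the polyhedral product.
\<close>

lemma quotient_map_collapse_restrict:
  assumes W: "closedin B W" and b: "b \<in> W" and C: "closedin B C"
  shows "quotient_map (subtopology B C) (subtopology (fst (collapse B W b)) (collapse_map W b ` C))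
      (collapse_map W b)"
proof (rule continuous_closed_imp_quotient_map)
  let ?q = "collapse_map W b" and ?Q = "fst (collapse B W b)"
  have CB: "C \<subseteq> topspace B" using C by (rule closedin_subset)
  have qc: "continuous_map B ?Q ?q" by (rule quotient_imp_continuous_map[OF quotient_map_collapse])
  show "continuous_map (subtopology B C) (subtopology ?Q (?q ` C)) ?q"
    using cmap_subtopology[OF qc, of C] by (auto simp: continuous_map_in_subtopology)
  show "closed_map (subtopology B C) (subtopology ?Q (?q ` C)) ?q"
    unfolding closed_map_def
  proof (intro allI impI)
    fix D assume "closedin (subtopology B C) D"
    then have D: "closedin B D" "D \<subseteq> C"
      using closedin_closed_subtopology[OF C] by auto
    show "closedin (subtopology ?Q (?q ` C)) (?q ` D)"
      by (rule closedin_subset_topspace)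
        (use closed_map_collapse[OF W b] D in \<open>auto simp: closed_map_def\<close>)
  qed
  have "?q ` C \<subseteq> topspace ?Q" using CB unfolding topspace_collapse[OF b] by (rule image_mono)
  then show "?q ` topspace (subtopology B C) = topspace (subtopology ?Q (?q ` C))"
    using CB by (simp add: Int_absorb1)
qed

lemma closedin_coordinate:
  assumes "closedin X C" "j \<in> J"
  shows "closedin (product_topology (\<lambda>_. X) J) {x \<in> topspace (product_topology (\<lambda>_. X) J). x j \<in> C}"
  by (rule closedin_continuous_map_preimage[OF _ assms(1)])
    (use continuous_map_product_coordinates[OF assms(2), of "\<lambda>_. X"] in simp)

lemma closedin_fat_wedge:
  assumes "closedin X {x0}" "finite J"
  shows "closedin (product_topology (\<lambda>_. X) J) (fat_wedge X x0 J)"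
proof -
  have "fat_wedge X x0 J = (\<Union>j\<in>J. {x \<in> topspace (product_topology (\<lambda>_. X) J). x j \<in> {x0}})"
    by (auto simp: fat_wedge_def)
  moreover have "closedin (product_topology (\<lambda>_. X) J) \<dots>"
    using assms(2) closedin_coordinate[OF assms(1)] by (intro closedin_Union) auto
  ultimately show ?thesis by simp
qed

lemma closedin_polyhedral_block:
  assumes "closedin X A"
  shows "closedin (product_topology (\<lambda>_. X) J) (polyhedral_block X A J I)"
proof (cases "J - I = {}")
  case True
  then have eq: "polyhedral_block X A J I = topspace (product_topology (\<lambda>_. X) J)"
    by (auto simp: polyhedral_block_def)
  show ?thesis unfolding eq by (rule closedin_topspace)
next
  case False
  then have "polyhedral_block X A J I = (\<Inter>j\<in>J - I. {x \<in> topspace (product_topology (\<lambda>_. X) J). x j \<in> A})"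
    by (auto simp: polyhedral_block_def)
  moreover have "closedin (product_topology (\<lambda>_. X) J) \<dots>"
  proof (rule closedin_Inter)
    show "(\<lambda>j. {x \<in> topspace (product_topology (\<lambda>_. X) J). x j \<in> A}) ` (J - I) \<noteq> {}"
      using False by blast
    fix S assume "S \<in> (\<lambda>j. {x \<in> topspace (product_topology (\<lambda>_. X) J). x j \<in> A}) ` (J - I)"
    then obtain j where j: "j \<in> J" "S = {x \<in> topspace (product_topology (\<lambda>_. X) J). x j \<in> A}"
      by auto
    show "closedin (product_topology (\<lambda>_. X) J) S"
      unfolding j(2) by (rule closedin_coordinate[OF assms j(1)])
  qed
  ultimately show ?thesis by simp
qed

lemma quotient_map_polyhedral_smash:
  assumes "closedin X {x0}" "closedin X A" "finite J" "finite L" "J \<noteq> {}" "x0 \<in> topspace X"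
  shows "quotient_map (fst (polyhedral_product X A x0 J L)) (fst (polyhedral_smash X A x0 J L))
    (collapse_map (fat_wedge X x0 J) (\<lambda>j\<in>J. x0))"
proof -
  let ?B = "product_topology (\<lambda>_. X) J"
  have C: "closedin ?B (\<Union>I\<in>L. polyhedral_block X A J I)"
    using assms(4) closedin_polyhedral_block[OF assms(2)] by (intro closedin_Union) auto
  have b: "(\<lambda>j\<in>J. x0) \<in> fat_wedge X x0 J"
    using assms(5,6) by (auto simp: fat_wedge_def)
  from quotient_map_collapse_restrict[OF closedin_fat_wedge[OF assms(1,3)] b C]
  show ?thesis
    by (simp add: polyhedral_product_space polyhedral_smash_def smash_power_def image_UN)
qed

text \<open>
  For a pair of cell complexes, \<open>h\<close> and its control function \<open>u\<close> are provided by \<open>cw_pair_contraction\<close>.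
\<close>

locale polyhedral_pair =
  fixes X :: "'a topology" and A :: "'a set" and x0 :: 'a
    and h :: "real \<times> 'a \<Rightarrow> 'a" and u :: "'a \<Rightarrow> real"
    and V :: "'v set" and K :: "'v set set"
  assumes h: "continuous_map (prod_topology \<I> X) X h" and u: "continuous_map X \<I> u" and u0: "u x0 = 0"
    and h0: "\<And>x. x \<in> topspace X \<Longrightarrow> h (0, x) = x"
    and h1: "\<And>x. \<lbrakk>x \<in> topspace X; u x < 1\<rbrakk> \<Longrightarrow> h (1, x) = x0"
    and hx0: "\<And>s. \<lbrakk>0 \<le> s; s \<le> 1\<rbrakk> \<Longrightarrow> h (s, x0) = x0"
    and hA: "\<And>s x. \<lbrakk>0 \<le> s; s \<le> 1; x \<in> A\<rbrakk> \<Longrightarrow> h (s, x) \<in> A"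
    and haus: "Hausdorff_space X" and closedA: "closedin X A" and x0A: "x0 \<in> A" and AX: "A \<subseteq> topspace X"
    and finV: "finite V" and K: "simplicial_complex_on V K"
begin

lemma x0X: "x0 \<in> topspace X" using x0A AX by blast

lemma closed_x0: "closedin X {x0}"
  using closedin_Hausdorff_singleton[OF haus x0X] .

lemma h_in: "\<lbrakk>0 \<le> s; s \<le> 1; x \<in> topspace X\<rbrakk> \<Longrightarrow> h (s, x) \<in> topspace X"
  using continuous_map_image_subset_topspace[OF h] by (auto simp: image_subset_iff)

abbreviation PP :: "('v \<Rightarrow> 'a) based" where "PP \<equiv> polyhedral_product X A x0 V K"
abbreviation P :: "('v \<Rightarrow> 'a) topology" where "P \<equiv> fst PP"
abbreviation b :: "'v \<Rightarrow> 'a" where "b \<equiv> \<lambda>j\<in>V. x0"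

lemma snd_PP: "snd PP = b" by (simp add: polyhedral_product_def)

lemma b_in: "b \<in> topspace P"
proof -
  have "{} \<in> K" using K by (simp add: simplicial_complex_on_def)
  then show ?thesis
    unfolding in_polyhedral_product using x0X x0A by (intro conjI bexI[of _ "{}"]) auto
qed

definition reset :: "'v \<Rightarrow> ('v \<Rightarrow> 'a) \<Rightarrow> 'v \<Rightarrow> 'a" where "reset j x = x(j := x0)"
definition push :: "'v \<Rightarrow> real \<times> ('v \<Rightarrow> 'a) \<Rightarrow> 'v \<Rightarrow> 'a" where "push j p = (snd p)(j := h (fst p, snd p j))"
definition height :: "'v \<Rightarrow> ('v \<Rightarrow> 'a) \<Rightarrow> real" where "height j x = u (x j)"

lemma update_in:
  assumes "x \<in> topspace P" "j \<in> V" "y \<in> topspace X" "x j \<in> A \<Longrightarrow> y \<in> A"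
  shows "x(j := y) \<in> topspace P"
proof -
  obtain I where I: "I \<in> K" "\<forall>i\<in>V - I. x i \<in> A" and x: "x \<in> extensional V" "\<forall>i\<in>V. x i \<in> topspace X"
    using assms(1) unfolding in_polyhedral_product by blast
  show ?thesis
    unfolding in_polyhedral_product
  proof (intro conjI bexI[OF _ I(1)] ballI)
    show "x(j := y) \<in> extensional V" using x(1) assms(2) by (auto simp: extensional_def)
    show "(x(j := y)) i \<in> topspace X" if "i \<in> V" for i using x(2) that assms(3) by simp
    show "(x(j := y)) i \<in> A" if "i \<in> V - I" for i using I(2) that assms(4) by (cases "i = j") auto
  qed
qed

sublocale coordinate_retractions P b V push reset height
proof (rule coordinate_retractions.intro)
  fix j assume j: "j \<in> V"
  have cj: "continuous_map P X (\<lambda>x. x i)" if "i \<in> V" for i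
    by (rule cmap_polyhedral_coord[OF that])
  have xj: "x j \<in> topspace X" if "x \<in> topspace P" for x
    using that j unfolding in_polyhedral_product by blast
  show "numerable_retraction P (push j) (reset j) (height j)"
  proof
    show "continuous_map (prod_topology \<I> P) P (push j)"
    proof (rule cmap_into_polyhedral_product)
      fix i assume i: "i \<in> V"
      have c: "continuous_map (prod_topology \<I> P) X (\<lambda>z. snd z k)" if "k \<in> V" for k
        by (rule cmap_compose[OF cj[OF that] continuous_map_snd])
      show "continuous_map (prod_topology \<I> P) X (\<lambda>z. push j z i)"
      proof (cases "i = j")
        case True
        have "continuous_map (prod_topology \<I> P) X (\<lambda>z. h (fst z, snd z j))"
          by (rule cmap_compose[OF h continuous_map_pairedI[OF continuous_map_fst c[OF j]]])
        then show ?thesis by (simp add: push_def True)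
      next
        case False
        then show ?thesis using c[OF i] by (simp add: push_def)
      qed
    next
      fix z assume "z \<in> topspace (prod_topology \<I> P)"
      then have z: "0 \<le> fst z" "fst z \<le> 1" "snd z \<in> topspace P" by auto
      show "push j z \<in> topspace P"
        unfolding push_def by (rule update_in[OF z(3) j h_in[OF z(1,2) xj[OF z(3)]] hA[OF z(1,2)]])
    qed
    show "continuous_map P P (reset j)"
    proof (rule cmap_into_polyhedral_product)
      show "continuous_map P X (\<lambda>z. reset j z i)" if "i \<in> V" for i
        using cj[OF that] x0X by (simp add: reset_def)
      show "reset j z \<in> topspace P" if "z \<in> topspace P" for z
        unfolding reset_def by (rule update_in[OF that j x0X x0A])
    qed
    show "continuous_map P \<I> (height j)"
      unfolding height_def by (rule cmap_compose[OF u cj[OF j]])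
    show "push j (0, x) = x" if "x \<in> topspace P" for x
      using h0[OF xj[OF that]] by (simp add: push_def)
    show "push j (1, x) = reset j x" if "x \<in> topspace P" "height j x < 1" for x
      using h1[OF xj[OF that(1)]] that(2) by (simp add: push_def reset_def height_def)
  qed
  show "reset j b = b"
    by (rule ext) (use j in \<open>simp add: reset_def\<close>)
  have fixed: "x j = x0" if "reset j x = x" for x
    using fun_cong[OF that, of j] by (simp add: reset_def)
  show "push j (s, x) = x" if "x \<in> topspace P" "reset j x = x" "0 \<le> s" "s \<le> 1" for s x
    using hx0[OF that(3,4)] fixed[OF that(2)] by (simp add: push_def fun_upd_idem)
  show "height j x = 0" if "x \<in> topspace P" "reset j x = x" for x
    using u0 fixed[OF that(2)] by (simp add: height_def)
  show "reset j (push j (1, x)) = reset j x" for x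
    by (simp add: push_def reset_def)
  fix i assume "i \<in> V"
  show "reset i (reset j x) = reset j (reset i x)" for x
    by (rule ext) (simp add: reset_def)
  assume ij: "i \<noteq> j"
  show "push j (s, reset i x) = reset i (push j (s, x))" for s x
    by (rule ext) (use ij in \<open>simp add: reset_def push_def\<close>)
  show "height j (reset i x) = height j x" for x
    using ij by (simp add: reset_def height_def)
qed (rule b_in)

lemma reset_apply: "reset j x i = (if i = j then x0 else x i)"
  by (simp add: reset_def)

lemma retract_all_apply: "retract_all js x i = (if i \<in> set js then x0 else x i)"
proof (induction js)
  case (Cons j js)
  have "retract_all (j # js) x i = reset j (retract_all js x) i" by simp
  also have "\<dots> = (if i = j then x0 else retract_all js x i)" by (rule reset_apply)
  finally show ?case using Cons by simp
qed simp

lemma fixset_iff: "x \<in> topspace P \<Longrightarrow> x \<in> fixset js \<longleftrightarrow> x = b \<or> (\<exists>j\<in>set js. x j = x0)"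
proof -
  have "reset j x = x \<longleftrightarrow> x j = x0" for j
    unfolding reset_def by (metis fun_upd_same fun_upd_triv)
  then show "x \<in> topspace P \<Longrightarrow> x \<in> fixset js \<longleftrightarrow> x = b \<or> (\<exists>j\<in>set js. x j = x0)"
    by (simp add: fixset_def)
qed

abbreviation piece :: "'v set \<Rightarrow> ('v \<Rightarrow> 'a) topology"
  where "piece J \<equiv> fst (polyhedral_product X A x0 J (full_subcomplex K J))"

definition summand :: "'v set \<Rightarrow> ('v \<Rightarrow> 'a) based"
  where "summand J = polyhedral_smash X A x0 J (full_subcomplex K J)"

abbreviation Q :: "('v set \<times> ('v \<Rightarrow> 'a)) option based"
  where "Q \<equiv> smash_wedge X A x0 V K"

text \<open>
  The map from the polyhedral product on \<open>J\<close> to the \<open>J\<close>-th summand of the wedge.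
\<close>

definition to_wedge :: "'v set \<Rightarrow> ('v \<Rightarrow> 'a) \<Rightarrow> ('v set \<times> ('v \<Rightarrow> 'a)) option"
  where "to_wedge J y = wedge_in summand J (collapse_map (fat_wedge X x0 J) (\<lambda>j\<in>J. x0) y)"

lemma snd_Q [simp]: "snd Q = None" by (simp add: smash_wedge_def wedge_def)

lemma to_wedge_eq:
  assumes "y \<in> topspace (piece J)"
  shows "to_wedge J y = (if J = {} \<or> (\<exists>j\<in>J. y j = x0) then None else Some (J, y))"
proof -
  have y: "y \<in> extensional J" "\<forall>j\<in>J. y j \<in> topspace X"
    using assms by (auto simp: in_polyhedral_product)
  then have fat: "y \<in> fat_wedge X x0 J \<longleftrightarrow> (\<exists>j\<in>J. y j = x0)"
    by (auto simp: fat_wedge_def PiE_def)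
  have "y = (\<lambda>j\<in>J. x0)" if "J = {}"
    using y(1) that by (auto simp: extensional_def)
  moreover have "y \<noteq> (\<lambda>j\<in>J. x0)" if "J \<noteq> {}" "\<not> (\<exists>j\<in>J. y j = x0)"
    using that by auto
  ultimately show ?thesis
    by (auto simp: to_wedge_def wedge_in_def summand_def polyhedral_smash_def collapse_map_def fat)
qed

lemma finK: "finite (full_subcomplex K J)"
proof -
  have "K \<subseteq> Pow V" using K by (simp add: simplicial_complex_on_def)
  then have "finite K" using finV by (meson finite_Pow_iff finite_subset)
  moreover have "full_subcomplex K J = (\<lambda>\<sigma>. \<sigma> \<inter> J) ` K"
    by (auto simp: full_subcomplex_def)
  ultimately show ?thesis by simp
qed

lemma empty_in_full: "{} \<in> full_subcomplex K J"
  using K by (auto simp: full_subcomplex_def simplicial_complex_on_def)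

lemma piece_base: "J \<subseteq> V \<Longrightarrow> (\<lambda>j\<in>J. x0) \<in> topspace (piece J)"
  unfolding in_polyhedral_product using empty_in_full[of J] x0A x0X by (intro conjI bexI[of _ "{}"]) auto

text \<open>
  The empty set is included among the indices although it indexes no summand: its piece is a single point,
  which maps to the base point and makes the family jointly surjective also when \<open>V\<close> is empty.
\<close>

lemma final_to_wedge: "final_maps (Pow V) piece to_wedge (fst Q)"
proof -
  let ?L = "{J. J \<subseteq> V \<and> J \<noteq> {}}"
  let ?S = "insert None (\<Union>J\<in>?L. wedge_in summand J ` topspace (fst (summand J)))"
  have Qeq: "fst Q = final_topology ?S ?L (\<lambda>J. fst (summand J)) (wedge_in summand)"
    by (simp add: smash_wedge_def wedge_def summand_def[abs_def])
  have topQ: "topspace (fst Q) = ?S"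
    unfolding Qeq by (rule topspace_final_topology) auto
  have quot: "quotient_map (piece J) (fst (summand J)) (collapse_map (fat_wedge X x0 J) (\<lambda>j\<in>J. x0))"
    if "J \<in> ?L" for J
    unfolding summand_def
    by (rule quotient_map_polyhedral_smash[OF closed_x0 closedA _ finK _ x0X])
      (use that finV in \<open>auto intro: finite_subset\<close>)
  have open_iff: "openin (fst Q) U \<longleftrightarrow> U \<subseteq> ?S \<and> (\<forall>J\<in>?L. openin (piece J) {y \<in> topspace (piece J).
      to_wedge J y \<in> U})" for U
  proof -
    have "openin (fst (summand J)) {z \<in> topspace (fst (summand J)). wedge_in summand J z \<in> U} \<longleftrightarrow>
        openin (piece J) {y \<in> topspace (piece J). to_wedge J y \<in> U}" if J: "J \<in> ?L" for J
    proof -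
      let ?q = "collapse_map (fat_wedge X x0 J) (\<lambda>j\<in>J. x0)" and ?U = "{z \<in> topspace (fst (summand
          J)). wedge_in summand J z \<in> U}"
      have q: "?q y \<in> topspace (fst (summand J))" if "y \<in> topspace (piece J)" for y
        using quotient_imp_surjective_map[OF quot[OF J]] that by blast
      have "openin (piece J) {y \<in> topspace (piece J). ?q y \<in> ?U} \<longleftrightarrow> openin (fst (summand J)) ?U"
        by (rule conjunct2[OF quot[OF J, unfolded quotient_map_def], rule_format]) auto
      moreover have "{y \<in> topspace (piece J). ?q y \<in> ?U} = {y \<in> topspace (piece J). to_wedge J y \<in> U}"
        using q by (auto simp: to_wedge_def)
      ultimately show ?thesis by simp
    qed
    then show ?thesis
      unfolding Qeq openin_final_topology by blast
  qed
  have range: "to_wedge J y \<in> ?S" if "J \<in> Pow V" "y \<in> topspace (piece J)" for J y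
  proof (cases "J = {}")
    case False
    then have J: "J \<in> ?L" using that by simp
    have "collapse_map (fat_wedge X x0 J) (\<lambda>j\<in>J. x0) y \<in> topspace (fst (summand J))"
      using quotient_imp_surjective_map[OF quot[OF J]] that(2) by blast
    then show ?thesis using J unfolding to_wedge_def by blast
  qed (use that(2) to_wedge_eq in auto)
  show ?thesis
    unfolding final_maps_def topQ
  proof (intro conjI ballI allI impI; (elim conjE)?)
    fix J assume J: "J \<in> Pow V"
    show "continuous_map (piece J) (fst Q) (to_wedge J)"
    proof (cases "J = {}")
      case True
      have "continuous_map (piece J) (fst Q) (\<lambda>_. None)" using topQ by simp
      then show ?thesis
        by (rule continuous_map_eq) (simp add: to_wedge_eq True)
    next
      case False
      then show ?thesis
        using J range by (auto simp: continuous_map_def topQ open_iff)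
    qed
  next
    show "?S \<subseteq> (\<Union>J\<in>Pow V. to_wedge J ` topspace (piece J))"
    proof
      fix p assume "p \<in> ?S"
      then consider "p = None" | J z where "J \<in> ?L" "z \<in> topspace (fst (summand J))" "p = wedge_in
          summand J z"
        by blast
      then show "p \<in> (\<Union>J\<in>Pow V. to_wedge J ` topspace (piece J))"
      proof cases
        case 1
        then have "p = to_wedge {} (\<lambda>j\<in>{}. x0)"
          using to_wedge_eq[OF piece_base[of "{}"]] by simp
        then show ?thesis using piece_base[of "{}"] by blast
      next
        case 2
        then obtain y where "y \<in> topspace (piece J)" "z = collapse_map (fat_wedge X x0 J) (\<lambda>j\<in>J. x0) y"
          using quotient_imp_surjective_map[OF quot[OF 2(1)]] by blast
        then show ?thesis using 2 unfolding to_wedge_def by blast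
      qed
    qed
  next
    fix U assume "U \<subseteq> ?S" "\<forall>J\<in>Pow V. openin (piece J) {y \<in> topspace (piece J). to_wedge J y \<in> U}"
    then show "openin (fst Q) U" unfolding open_iff by blast
  qed
qed

definition proj :: "'v set \<Rightarrow> ('v \<Rightarrow> 'a) \<Rightarrow> ('v set \<times> ('v \<Rightarrow> 'a)) option"
  where "proj J x = to_wedge J (restrict x J)"

text \<open>
  The inclusion of the piece on \<open>J\<close> into the polyhedral product, with \<open>x0\<close> in the other coordinates.
\<close>

definition fill :: "('v \<Rightarrow> 'a) \<Rightarrow> 'v set \<Rightarrow> 'v \<Rightarrow> 'a"
  where "fill y J = (\<lambda>i\<in>V. if i \<in> J then y i else x0)"

lemma restrict_in_piece:
  assumes "J \<subseteq> V" "x \<in> topspace P" shows "restrict x J \<in> topspace (piece J)"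
proof -
  obtain I where I: "I \<in> K" "\<forall>i\<in>V - I. x i \<in> A" and x: "\<forall>i\<in>V. x i \<in> topspace X"
    using assms(2) unfolding in_polyhedral_product by blast
  have "I \<inter> J \<in> full_subcomplex K J" using I(1) by (auto simp: full_subcomplex_def)
  moreover have "\<forall>j\<in>J - I \<inter> J. restrict x J j \<in> A" using I(2) assms(1) by auto
  moreover have "\<forall>j\<in>J. restrict x J j \<in> topspace X" using x assms(1) by auto
  ultimately show ?thesis unfolding in_polyhedral_product by (meson restrict_extensional)
qed

lemma fill_in:
  assumes "J \<subseteq> V" "y \<in> topspace (piece J)" shows "fill y J \<in> topspace P"
proof -
  obtain I where I: "I \<in> full_subcomplex K J" "\<forall>i\<in>J - I. y i \<in> A" and y: "\<forall>i\<in>J. y i \<in> topspace X"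
    using assms(2) unfolding in_polyhedral_product by blast
  obtain \<sigma> where \<sigma>: "\<sigma> \<in> K" "I = \<sigma> \<inter> J" using I(1) by (auto simp: full_subcomplex_def)
  have "\<forall>i\<in>V - \<sigma>. fill y J i \<in> A" using I(2) \<sigma>(2) x0A by (auto simp: fill_def)
  moreover have "\<forall>i\<in>V. fill y J i \<in> topspace X" using y x0X by (auto simp: fill_def)
  moreover have "fill y J \<in> extensional V" by (simp add: fill_def)
  ultimately show ?thesis unfolding in_polyhedral_product using \<sigma>(1) by blast
qed

lemma cmap_fill:
  assumes "J \<subseteq> V" shows "continuous_map (piece J) P (\<lambda>y. fill y J)"
proof (rule cmap_into_polyhedral_product)
  fix i assume i: "i \<in> V"
  show "continuous_map (piece J) X (\<lambda>y. fill y J i)"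
    using cmap_polyhedral_coord[of i J] i x0X by (cases "i \<in> J") (auto simp: fill_def)
qed (rule fill_in[OF assms])

lemma restrict_fill: "\<lbrakk>J \<subseteq> V; y \<in> topspace (piece J)\<rbrakk> \<Longrightarrow> restrict (fill y J) J = y"
  by (rule ext) (auto simp: fill_def in_polyhedral_product extensional_def)

lemma cmap_proj:
  assumes J: "J \<subseteq> V" shows "continuous_map P (fst Q) (proj J)"
proof -
  have w: "continuous_map (piece J) (fst Q) (to_wedge J)"
    using final_to_wedge J unfolding final_maps_def by blast
  have "continuous_map P (piece J) (\<lambda>x. restrict x J)"
  proof (rule cmap_into_polyhedral_product)
    show "continuous_map P X (\<lambda>x. restrict x J j)" if "j \<in> J" for j
      using cmap_polyhedral_coord[OF subsetD[OF J that]] that by simp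
  qed (rule restrict_in_piece[OF J])
  from cmap_compose[OF w this] show ?thesis unfolding proj_def .
qed

lemma proj_eq:
  assumes "J \<subseteq> V" "x \<in> topspace P"
  shows "proj J x = (if J = {} \<or> (\<exists>j\<in>J. x j = x0) then None else Some (J, restrict x J))"
  unfolding proj_def to_wedge_eq[OF restrict_in_piece[OF assms]] by auto

end

section \<open>The splitting map and its inverse\<close>

text \<open>
  A list of the coordinates fixes the order of summation and of composition.
\<close>

locale ordered_polyhedral_pair = polyhedral_pair X A x0 h u V K
  for X :: "'a topology" and A x0 h u and V :: "'v set" and K +
  fixes vs :: "'v list"
  assumes vs: "set vs = V" "distinct vs"
begin

definition sel :: "'v set \<Rightarrow> 'v list" where "sel J = filter (\<lambda>i. i \<in> J) vs"
definition cosel :: "'v set \<Rightarrow> 'v list" where "cosel J = filter (\<lambda>i. i \<notin> J) vs"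
text \<open>
  All subsets, in the order that suits \<open>rel_homotopic_sum_splittings\<close>.
\<close>

definition subsets :: "'v set list" where "subsets = map (\<lambda>S. set (fst S)) (splittings vs)"

lemma set_sel: "J \<subseteq> V \<Longrightarrow> set (sel J) = J" and set_cosel: "set (cosel J) = V - J"
  using vs by (auto simp: sel_def cosel_def)

lemma distinct_sel: "distinct (sel J)"
  using vs by (simp add: sel_def)

lemma distinct_subsets: "distinct subsets"
  unfolding subsets_def by (rule distinct_splitting_sets[OF vs(2)])

lemma set_subsets: "set subsets = Pow V"
proof
  show "set subsets \<subseteq> Pow V"
    using splittings_set[of _ vs] vs unfolding subsets_def by auto
  show "Pow V \<subseteq> set subsets"
  proof
    fix J assume "J \<in> Pow V"
    then have "J = set (fst (sel J, cosel J))" using set_sel by simp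
    moreover have "(sel J, cosel J) \<in> set (splittings vs)"
      unfolding sel_def cosel_def by (rule filter_splitting)
    ultimately show "J \<in> set subsets" unfolding subsets_def by (metis (no_types, lifting) image_eqI
        set_map)
  qed
qed

lemma map_splittings: "map (\<lambda>S. F (fst S) (snd S)) (splittings vs) = map (\<lambda>J. F (sel J) (cosel J))
    subsets"
proof -
  have "F (fst S) (snd S) = F (sel (set (fst S))) (cosel (set (fst S)))" if "S \<in> set (splittings
      vs)" for S
    using splittings_filter[OF that vs(2)] by (simp add: sel_def cosel_def)
  then show ?thesis by (simp add: subsets_def)
qed

lemma sub: "J \<subseteq> V \<Longrightarrow> set (sel J) \<subseteq> V" "set (cosel J) \<subseteq> V" "set (sel J) \<inter> set (cosel J) = {}"
  using set_sel set_cosel by (auto simp: sel_def cosel_def)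

abbreviation quot :: "('v \<Rightarrow> 'a) \<times> real \<Rightarrow> ('v \<Rightarrow> 'a) \<times> real"
  where "quot \<equiv> susp_collapse PP"

lemma PP_base: "snd PP \<in> topspace (fst PP)" using b_in by (simp add: snd_PP)

lemma proj_b: "J \<subseteq> V \<Longrightarrow> proj J b = None"
  using proj_eq[OF _ b_in, of J] by auto

lemma Q_base: "snd Q \<in> topspace (fst Q)"
  using continuous_map_image_subset_topspace[OF cmap_proj[of "{}"]] b_in proj_b[of "{}"] by force

lemma rel_map_quot: "rel_map P {b} (susp PP) quot"
proof -
  have "rel_map P {b} (susp PP) (presusp PP (\<lambda>x. x))"
    by (rule rel_map_presusp[OF cmap_ident]) (simp add: snd_PP)
  then show ?thesis by (rule rel_map_cong) (simp add: presusp_def)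
qed

definition component :: "'v set \<Rightarrow> ('v \<Rightarrow> 'a) \<times> real \<Rightarrow> ('v set \<times> ('v \<Rightarrow> 'a)) option \<times> real"
  where "component J = presusp Q (proj J)"

lemma rel_map_component: "J \<subseteq> V \<Longrightarrow> rel_map P {b} (susp Q) (component J)"
  unfolding component_def by (rule rel_map_presusp[OF cmap_proj]) (auto simp: proj_b)

lemma component_None: "\<lbrakk>proj J x = None; 0 \<le> t; t \<le> 1\<rbrakk> \<Longrightarrow> component J (x, t) = snd (susp Q)"
  unfolding component_def by (simp add: presusp_base)

definition theta where "theta = track_sum ((None, 0), 0) (map (\<lambda>J. presusp (susp Q) (component J))
    subsets)"

lemma rel_map_presusp_of_rel_map: "rel_map B W Z F \<Longrightarrow> rel_map (cyl B) (cyl_trivial B W) (susp Z)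
    (presusp Z F)"
  using rel_homotopic_rel_map(1)[OF rel_homotopic_presusp[OF rel_homotopic_refl]] by blast

lemma rel_map_theta: "rel_map (cyl P) (cyl_trivial P {b}) (susp2 Q) theta"
proof -
  have "rel_map (cyl P) (cyl_trivial P {b}) (susp (susp Q)) (track_sum (snd (susp (susp Q))) (map
      (\<lambda>J. presusp (susp Q) (component J)) subsets))"
    by (rule rel_map_track_sum) (use base_susp[of "susp Q"] base_susp[OF Q_base] set_subsets in
        \<open>auto intro: rel_map_presusp_of_rel_map[OF rel_map_component]\<close>)
  then show ?thesis by (simp add: theta_def susp2_def)
qed

text \<open>
  The map from \<open>\<Sigma>\<close> of the wedge to \<open>\<Sigma>P\<close> that is given on the \<open>J\<close>-th summand by the composite of the
  \<open>D_j\<close> for \<open>j \<in> J\<close>.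
\<close>

definition lift_wedge :: "('v set \<times> ('v \<Rightarrow> 'a)) option \<times> real \<Rightarrow> ('v \<Rightarrow> 'a) \<times> real"
  where "lift_wedge p =
    (case fst p of None \<Rightarrow> (b, 0) | Some (J, y) \<Rightarrow> cancel_all (sel J) quot (fill y J, snd p))"

definition kappa where "kappa = presusp (susp PP) lift_wedge"

lemma fill_fixset:
  assumes "J \<subseteq> V" "y \<in> topspace (piece J)" "to_wedge J y = None"
  shows "fill y J \<in> fixset (sel J)"
proof -
  have "J = {} \<or> (\<exists>j\<in>J. y j = x0)"
    using to_wedge_eq[OF assms(2)] assms(3) by (auto split: if_splits)
  then have "fill y J = b \<or> (\<exists>j\<in>set (sel J). fill y J j = x0)"
    using assms(1) by (auto simp: fill_def set_sel)
  then show ?thesis using fixset_iff[OF fill_in[OF assms(1,2)]] by blast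
qed

lemma lift_wedge_to_wedge:
  assumes J: "J \<subseteq> V" and y: "y \<in> topspace (piece J)" and t: "0 \<le> t" "t \<le> 1"
  shows "lift_wedge (to_wedge J y, t) = cancel_all (sel J) quot (fill y J, t)"
proof (cases "to_wedge J y = None")
  case True
  have "cancel_all (sel J) quot (fill y J, t) = snd (susp PP)"
    using rel_mapD(2)[OF rel_map_cancel_all[OF sub(1)[OF J] distinct_sel rel_map_quot] fill_in[OF J
        y] t] fill_fixset[OF J y True] by blast
  then show ?thesis using True by (simp add: lift_wedge_def snd_PP)
next
  case False
  then have "to_wedge J y = Some (J, y)" using to_wedge_eq[OF y] by (auto split: if_splits)
  then show ?thesis by (simp add: lift_wedge_def)
qed

text \<open>
  A homotopy on the double suspension of the wedge is a family of homotopies on the pieces, relative to their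
  fat wedges; here each of them comes from a homotopy on \<open>P\<close>, restricted along \<open>fill\<close>.
\<close>

lemma rel_homotopic_glue:
  assumes hom: "\<And>J. J \<subseteq> V \<Longrightarrow> rel_homotopic (cyl P) (cyl_trivial P (fixset (sel J))) Z (F' J) (G' J)"
    and F: "\<And>J y t r. \<lbrakk>J \<subseteq> V; y \<in> topspace (piece J); 0 \<le> t; t \<le> 1; 0 \<le> r; r \<le> 1\<rbrakk> \<Longrightarrow> F ((to_wedge J
        y, t), r) = F' J ((fill y J, t), r)"
    and G: "\<And>J y t r. \<lbrakk>J \<subseteq> V; y \<in> topspace (piece J); 0 \<le> t; t \<le> 1; 0 \<le> r; r \<le> 1\<rbrakk> \<Longrightarrow> G ((to_wedge J
        y, t), r) = G' J ((fill y J, t), r)"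
  shows "rel_homotopic (cyl (fst Q)) (cyl_trivial (fst Q) {snd Q}) Z F G"
proof -
  have "\<forall>J. \<exists>H. J \<subseteq> V \<longrightarrow> rel_homotopy (cyl P) (cyl_trivial P (fixset (sel J))) Z H (F' J) (G' J)"
    using hom unfolding rel_homotopic_def by blast
  then obtain H where H: "\<And>J. J \<subseteq> V \<Longrightarrow> rel_homotopy (cyl P) (cyl_trivial P (fixset (sel J))) Z (H J)
      (F' J) (G' J)"
    by metis
  \<comment> \<open>On representatives the glued homotopy is defined by the summand in which the point lies.\<close>
  define L where "L p = (case fst (fst (snd p)) of None \<Rightarrow> snd Z
    | Some (J, y) \<Rightarrow> H J (fst p, ((fill y J, snd (fst (snd p))), snd (snd p))))" for p
  have L: "L (s, ((to_wedge J y, t), r)) = H J (s, ((fill y J, t), r))"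
    if "J \<subseteq> V" "y \<in> topspace (piece J)" "0 \<le> s" "s \<le> 1" "0 \<le> t" "t \<le> 1" "0 \<le> r" "r \<le> 1" for J y s t r
  proof (cases "to_wedge J y = None")
    case True
    have "(fill y J, t) \<in> cyl_trivial P (fixset (sel J))"
      using fill_fixset[OF that(1,2) True] that by (simp add: cyl_trivial_def)
    moreover have "(fill y J, t) \<in> topspace (cyl P)" using fill_in[OF that(1,2)] that by simp
    ultimately have "H J (s, ((fill y J, t), r)) = snd Z"
      using rel_homotopyD(4)[OF H[OF that(1)] that(3,4) _ that(7,8)] by blast
    then show ?thesis using True by (simp add: L_def)
  next
    case False
    then have "to_wedge J y = Some (J, y)" using to_wedge_eq[OF that(2)] by (auto split: if_splits)
    then show ?thesis by (simp add: L_def)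
  qed
  have pt: "\<exists>J y. J \<subseteq> V \<and> y \<in> topspace (piece J) \<and> p = to_wedge J y" if "p \<in> topspace (fst Q)" for p
    using final_to_wedge that unfolding final_maps_def by blast
  show ?thesis
  proof (rule rel_homotopicI[where H = L])
    show "continuous_map (prod_topology \<I> (cyl (cyl (fst Q)))) (fst Z) L"
    proof (rule continuous_map_from_final[OF final_maps_prod_left[OF final_maps_prod_right[OF
        final_maps_prod_right[OF final_to_wedge]]]])
      fix J assume "J \<in> Pow V"
      then have J: "J \<subseteq> V" by simp
      let ?T = "prod_topology \<I> (cyl (cyl (piece J)))"
      have "continuous_map ?T (fst Z) (\<lambda>p. H J (fst p, ((fill (fst (fst (snd p))) J, snd (fst (snd
          p))), snd (snd p))))"
        by (intro cmap_compose[OF rel_homotopyD(1)[OF H[OF J]]] continuous_map_pairedI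
            cmap_compose[OF cmap_fill[OF J]] homotopy_coords
           cmap_snd[OF homotopy_coords(2)] cmap_fst[OF homotopy_coords(2)])
      then show "continuous_map ?T (fst Z) (\<lambda>p. L (fst p, (to_wedge J (fst (fst (snd p))), snd (fst
          (snd p))), snd (snd p)))"
      proof (rule continuous_map_eq)
        fix p assume "p \<in> topspace ?T"
        then show "H J (fst p, ((fill (fst (fst (snd p))) J, snd (fst (snd p))), snd (snd p))) = L
            (fst p, (to_wedge J (fst (fst (snd p))), snd (fst (snd p))), snd (snd p))"
          using L[OF J, of "fst (fst (snd p))" "fst p" "snd (fst (snd p))" "snd (snd p)"] by auto
      qed
    qed
  next
    fix z r assume z: "z \<in> topspace (cyl (fst Q))" and r: "0 \<le> r" "r \<le> (1::real)"
    obtain p t where zp: "z = (p, t)" and p: "p \<in> topspace (fst Q)" and t: "0 \<le> t" "t \<le> 1"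
      using z by (cases z) auto
    obtain J y where J: "J \<subseteq> V" and y: "y \<in> topspace (piece J)" and py: "p = to_wedge J y"
      using pt[OF p] by blast
    have f: "(fill y J, t) \<in> topspace (cyl P)" using fill_in[OF J y] t by simp
    show "L (0, z, r) = F (z, r)"
      unfolding zp py F[OF J y t r] using L[OF J y _ _ t r, of 0] rel_homotopyD(2)[OF H[OF J] f r]
          by simp
    show "L (1, z, r) = G (z, r)"
      unfolding zp py G[OF J y t r] using L[OF J y _ _ t r, of 1] rel_homotopyD(3)[OF H[OF J] f r]
          by simp
    fix s :: real assume s: "0 \<le> s" "s \<le> 1" and triv: "z \<in> cyl_trivial (fst Q) {snd Q} \<or> r = 0 \<or> r = 1"
    show "L (s, z, r) = snd Z"
    proof (cases "p = None")
      case False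
      then have "(fill y J, t) \<in> cyl_trivial P (fixset (sel J)) \<or> r = 0 \<or> r = 1"
        using triv fill_in[OF J y] by (auto simp: cyl_trivial_def zp)
      then show ?thesis
        unfolding zp py L[OF J y s t r] by (rule rel_homotopyD(4)[OF H[OF J] s f r])
    qed (simp add: L_def zp)
  qed
qed

lemma rel_map_kappa: "rel_map (cyl (fst Q)) (cyl_trivial (fst Q) {snd Q}) (susp2 PP) kappa"
  and based_map_kappa: "based_map (susp2 Q) (susp2 PP) kappa"
proof -
  have rel_homotopic: "rel_homotopic (cyl (fst Q)) (cyl_trivial (fst Q) {snd Q}) (susp2 PP) kappa kappa"
  proof (rule rel_homotopic_glue)
    fix J assume J: "J \<subseteq> V"
    show "rel_homotopic (cyl P) (cyl_trivial P (fixset (sel J))) (susp2 PP) (presusp (susp PP)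
        (cancel_all (sel J) quot)) (presusp (susp PP) (cancel_all (sel J) quot))"
      unfolding susp2_def
      by (rule rel_homotopic_refl[OF rel_map_presusp_of_rel_map[OF rel_map_cancel_all[OF sub(1)[OF
          J] distinct_sel rel_map_quot]]]) simp
  qed (simp_all add: kappa_def presusp_def lift_wedge_to_wedge)
  then show "rel_map (cyl (fst Q)) (cyl_trivial (fst Q) {snd Q}) (susp2 PP) kappa" by (rule
      rel_homotopic_rel_map)
  show "based_map (susp2 Q) (susp2 PP) kappa"
    by (rule based_homotopic_imp_based_map[OF based_homotopic_susp2[OF rel_homotopic Q_base]])
qed

lemma based_map_theta: "based_map (susp2 PP) (susp2 Q) theta"
proof (rule based_homotopic_imp_based_map[OF based_homotopic_susp2[OF _ PP_base]])
  show "rel_homotopic (cyl (fst PP)) (cyl_trivial (fst PP) {snd PP}) (susp2 Q) theta theta"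
    unfolding snd_PP by (rule rel_homotopic_refl[OF rel_map_theta]) simp
qed

text \<open>
  Since \<open>\<kappa>\<close> is applied after the sum, \<open>\<kappa> \<theta>\<close> is the sum of the \<open>\<kappa> f_J\<close>, and filling up the restriction of
  \<open>x\<close> to \<open>J\<close> is the same as resetting all coordinates outside \<open>J\<close>.
\<close>

lemma kappa_theta: "based_homotopic (susp2 PP) (susp2 PP) (kappa \<circ> theta) id"
proof -
  let ?c = "\<lambda>J p. cancel_all (sel J) quot (retract_all (cosel J) (fst p), snd p)"
  have base: "kappa ((None, 0), 0) = snd (susp (susp PP))"
    by (simp add: kappa_def presusp_def lift_wedge_def susp_collapse_eq[of "susp PP"]
        cyl_trivial_def snd_PP)
  have summand: "kappa (presusp (susp Q) (component J) ((x, t), r)) = presusp (susp PP) (?c J) ((x,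
      t), r)"
    if J: "J \<in> set subsets" and x: "x \<in> topspace P" and t: "0 \<le> t" "t \<le> 1" and r: "0 \<le> r" "r \<le> 1"
        for J x t r
  proof -
    have J: "J \<subseteq> V" using J set_subsets by simp
    have "proj J x \<in> topspace (fst Q)"
      using continuous_map_image_subset_topspace[OF cmap_proj[OF J]] x by blast
    from double_collapse[OF rel_map_kappa Q_base this t r]
    have "kappa (presusp (susp Q) (component J) ((x, t), r)) = susp_collapse (susp PP) (lift_wedge
        (proj J x, t), r)"
      by (simp add: presusp_def component_def kappa_def)
    also have "lift_wedge (proj J x, t) = cancel_all (sel J) quot (fill (restrict x J) J, t)"
      unfolding proj_def by (rule lift_wedge_to_wedge[OF J restrict_in_piece[OF J x] t])
    also have "fill (restrict x J) J = retract_all (cosel J) x"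
    proof (rule ext)
      have "x \<in> extensional V" using x by (simp add: in_polyhedral_product)
      then show "fill (restrict x J) J i = retract_all (cosel J) x i" for i
        using J by (auto simp: retract_all_apply set_cosel fill_def extensional_def)
    qed
    finally show ?thesis by (simp add: presusp_def)
  qed
  have "rel_homotopic (cyl P) (cyl_trivial P {b}) (susp (susp PP))
      (track_sum (snd (susp (susp PP))) (map (\<lambda>J. presusp (susp PP) (?c J)) subsets)) (presusp (susp
          PP) quot)"
    using rel_homotopic_sum_splittings[OF rel_map_quot, of vs] base_susp[OF PP_base] vs
    by (simp add: map_splittings[of "\<lambda>J C. presusp (susp PP) (\<lambda>p. cancel_all J quot (retract_all C
        (fst p), snd p))"])
  then have "rel_homotopic (cyl P) (cyl_trivial P {b}) (susp (susp PP)) (\<lambda>p. kappa (theta p))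
      (presusp (susp PP) quot)"
  proof (rule rel_homotopic_cong)
    fix z r assume z: "z \<in> topspace (cyl P)" and r: "0 \<le> r" "r \<le> (1::real)"
    have "kappa (theta (z, r)) = track_sum (kappa ((None, 0), 0)) (map (\<lambda>J p. kappa (presusp (susp
        Q) (component J) p)) subsets) (z, r)"
      unfolding theta_def track_sum_postcompose[of kappa] by (simp add: o_def)
    also have "\<dots> = track_sum (snd (susp (susp PP))) (map (\<lambda>J. presusp (susp PP) (?c J)) subsets) (z, r)"
      unfolding base by (rule track_sum_cong_at[OF _ r]) (use z summand in auto)
    finally show "track_sum (snd (susp (susp PP))) (map (\<lambda>J. presusp (susp PP) (?c J)) subsets) (z,
        r) = kappa (theta (z, r))" by simp
  qed simp
  then have "based_homotopic (susp2 PP) (susp2 PP) (\<lambda>p. kappa (theta p)) (presusp (susp PP) quot)"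
    unfolding susp2_def[of PP, symmetric]
    by (intro based_homotopic_susp2[OF _ PP_base]) (simp add: snd_PP)
  then show ?thesis
  proof (rule based_homotopic_cong)
    show "snd (susp2 PP) \<in> topspace (fst (susp2 PP))"
      using base_susp[of "susp PP"] base_susp[OF PP_base] by (simp add: susp2_def)
    fix p assume "p \<in> topspace (fst (susp2 PP))"
    then obtain x t r where "p = ((x, t), r)" "susp_collapse (susp PP) (quot (x, t), r) = p"
      using susp2_rep[OF PP_base] by metis
    then show "presusp (susp PP) quot p = id p" by (simp add: presusp_def)
  qed simp
qed

lemma proj_retract_null:
  assumes "I \<subseteq> V" "i \<in> I" "x \<in> topspace P" "x i = x0"
  shows "proj I x = None"
  using proj_eq[OF assms(1,3)] assms(2,4) by auto

text \<open>
  On the \<open>J\<close>-th piece every point is fixed by resetting the coordinates outside \<open>J\<close>, so \<open>f_I\<close> may be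
  preceded by these resets.  The resulting maps on \<open>P\<close> are invariant under \<open>r_j\<close> for \<open>j \<in> J - I\<close>,
  constant if \<open>I\<close> contains a coordinate outside \<open>J\<close>, and made constant by each \<open>r_j\<close> if \<open>I = J\<close>.
\<close>

lemma theta_kappa: "based_homotopic (susp2 Q) (susp2 Q) (theta \<circ> kappa) id"
proof -
  let ?q = "\<lambda>J I p. component I (retract_all (cosel J) (fst p), snd p)"
  let ?F = "\<lambda>J I. presusp (susp Q) (cancel_all (sel J) (?q J I))"
  have susp2_Q: "snd (susp (susp Q)) \<in> topspace (fst (susp (susp Q)))"
    using base_susp[of "susp Q"] base_susp[OF Q_base] by simp
  have ra: "retract_all (cosel J) x \<in> topspace P" if "x \<in> topspace P" for J x
    by (rule retract_all_in[OF sub(2) that])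
  have rs: "reset i x \<in> topspace P" if "x \<in> topspace P" "i \<in> V" for i x
    by (rule r_in[OF that(2,1)])
  have sq: "rel_map P {b} (susp Q) (?q J I)" if "I \<subseteq> V" for J I
    by (rule rel_map_retract_all[OF rel_map_component[OF that] sub(2)])
  have off: "rel_homotopic P (fixset (sel J)) (susp Q) (cancel_all (sel J) (?q J I)) (\<lambda>_. snd (susp Q))"
    if J: "J \<subseteq> V" and I: "I \<subseteq> V" "I \<noteq> J" for J I
  proof (cases "J \<subseteq> I")
    case True
    then obtain i where i: "i \<in> I" "i \<notin> J" "i \<in> V" using I by blast
    have "?q J I (x, t) = snd (susp Q)" if x: "x \<in> topspace P" and t: "0 \<le> t" "t \<le> 1" for x t
      using component_None[OF proj_retract_null[OF I(1) i(1) ra[OF x]] t] i by (simp add: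
          retract_all_apply set_cosel)
    then have "cancel_all (sel J) (?q J I) (x, t) = snd (susp Q)" if x: "x \<in> topspace P" and t: "0 \<le>
        t" "t \<le> 1" for x t
      using cancel_all_cong[OF sub(1)[OF J] _ x t, of "?q J I" "\<lambda>_. snd (susp Q)"] by (simp add:
          cancel_all_const)
    then show ?thesis
      by (intro rel_homotopic_refl[OF rel_map_cancel_all[OF sub(1)[OF J] distinct_sel sq[OF I(1)]]])
  next
    case False
    then obtain j where j: "j \<in> J" "j \<notin> I" by blast
    show ?thesis
    proof (rule cancel_all_retract_invariant[OF sub(1)[OF J] distinct_sel sq[OF I(1)]])
      show "j \<in> set (sel J)" using j set_sel[OF J] by simp
      fix x t assume x: "x \<in> topspace P"
      have "restrict (retract_all (cosel J) (reset j x)) I = restrict (retract_all (cosel J) x) I"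
        by (rule restrict_ext) (use j in \<open>auto simp: retract_all_apply reset_apply\<close>)
      then show "?q J I (reset j x, t) = ?q J I (x, t)"
        by (simp add: component_def presusp_def proj_def)
    qed
  qed
  have diag: "rel_homotopic P (fixset (sel J)) (susp Q) (cancel_all (sel J) (?q J J)) (?q J J)" if
      J: "J \<subseteq> V" for J
  proof (rule cancel_all_retract_null[OF sub(1)[OF J] distinct_sel sq[OF J]])
    fix i x t assume i: "i \<in> set (sel J)" and x: "x \<in> topspace P" and t: "0 \<le> t" "t \<le> (1::real)"
    have i: "i \<in> J" "i \<in> V" using i set_sel[OF J] J by auto
    show "?q J J (reset i x, t) = snd (susp Q)"
      using component_None[OF proj_retract_null[OF J i(1) ra[OF rs[OF x i(2)]]] t] by (simp add:
          retract_all_apply reset_apply)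
  qed
  have hom: "rel_homotopic (cyl P) (cyl_trivial P (fixset (sel J))) (susp (susp Q))
      (track_sum (snd (susp (susp Q))) (map (?F J) subsets)) (presusp (susp Q) (?q J J))" if J: "J \<subseteq>
          V" for J
  proof -
    have "rel_homotopic (cyl P) (cyl_trivial P (fixset (sel J))) (susp (susp Q)) (track_sum (snd
        (susp (susp Q))) (map (?F J) subsets)) (?F J J)"
    proof (rule rel_homotopic_track_sum_single[OF susp2_Q distinct_subsets])
      show "J \<in> set subsets" using J set_subsets by simp
      show "rel_map (cyl P) (cyl_trivial P (fixset (sel J))) (susp (susp Q)) (?F J J)"
        by (rule rel_map_presusp_of_rel_map[OF rel_homotopic_rel_map(1)[OF diag[OF J]]])
      fix I assume "I \<in> set subsets" "I \<noteq> J"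
      then have I: "I \<subseteq> V" "I \<noteq> J" using set_subsets by auto
      show "rel_homotopic (cyl P) (cyl_trivial P (fixset (sel J))) (susp (susp Q)) (?F J I) (\<lambda>_. snd
          (susp (susp Q)))"
        by (rule rel_homotopic_cong[OF rel_homotopic_presusp[OF off[OF J I]]]) (auto simp:
            presusp_base[of _ _ "susp Q"])
    qed
    also have "rel_homotopic (cyl P) (cyl_trivial P (fixset (sel J))) (susp (susp Q)) (?F J J)
        (presusp (susp Q) (?q J J))"
      by (rule rel_homotopic_presusp[OF diag[OF J]])
    finally show ?thesis .
  qed
  have "rel_homotopic (cyl (fst Q)) (cyl_trivial (fst Q) {snd Q}) (susp2 Q) (\<lambda>p. theta (kappa p))
      (presusp (susp Q) (susp_collapse Q))"
    unfolding susp2_def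
  proof (rule rel_homotopic_glue[OF hom])
    fix J y t r
    assume J: "J \<subseteq> V" and y: "y \<in> topspace (piece J)" and t: "0 \<le> t" "t \<le> (1::real)" and r: "0 \<le> r"
        "r \<le> (1::real)"
    have f: "fill y J \<in> topspace P" by (rule fill_in[OF J y])
    have rf: "retract_all (cosel J) (fill y J) = fill y J"
      by (rule ext) (use J in \<open>auto simp: retract_all_apply set_cosel fill_def\<close>)
    show "presusp (susp Q) (susp_collapse Q) ((to_wedge J y, t), r) = presusp (susp Q) (?q J J)
        ((fill y J, t), r)"
      by (simp add: presusp_def rf component_def proj_def restrict_fill[OF J y])
    define z where "z = cancel_all (sel J) quot (fill y J, t)"
    have "z \<in> topspace (fst (susp PP))"
      using continuous_map_image_subset_topspace[OF rel_mapD(1)[OF rel_map_cancel_all[OF sub(1)[OF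
          J] distinct_sel rel_map_quot]]] f t
      by (auto simp: z_def image_subset_iff)
    note zz = susp_rep[OF PP_base this]
    obtain x' t' where z': "z = (x', t')" "x' \<in> topspace P" "0 \<le> t'" "t' \<le> 1"
      using zz(2) by (cases z) auto
    have "theta (kappa ((to_wedge J y, t), r)) = theta (susp_collapse (susp PP) (quot (x', t'), r))"
      using zz(1) by (simp add: kappa_def presusp_def lift_wedge_to_wedge[OF J y t] z_def[symmetric]
          z'(1))
    also have "\<dots> = theta (z, r)"
      unfolding z'(1) by (rule double_collapse[OF _ PP_base z'(2-4) r]) (use rel_map_theta in \<open>simp
          add: snd_PP\<close>)
    also have "\<dots> = track_sum ((None, 0), 0) (map (\<lambda>I p. presusp (susp Q) (component I) (cancel_all
        (sel J) quot (fst p), snd p)) subsets) ((fill y J, t), r)"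
      using track_sum_precompose[of "((None, 0), 0)" "map (\<lambda>J. presusp (susp Q) (component J))
          subsets" "cancel_all (sel J) quot" "((fill y J, t), r)"]
      by (simp add: theta_def z_def o_def)
    also have "\<dots> = track_sum ((None, 0), 0) (map (?F J) subsets) ((fill y J, t), r)"
    proof (rule track_sum_cong_at[OF _ r])
      fix I r assume "I \<in> set subsets"
      then have I: "I \<subseteq> V" using set_subsets by auto
      have "component I (cancel_all (sel J) quot (fill y J, t)) = cancel_all (sel J) (\<lambda>p. component
          I (quot p)) (fill y J, t)"
        by (rule cancel_all_postcompose)
      also have "\<dots> = cancel_all (sel J) (component I) (fill y J, t)"
      proof (rule cancel_all_cong[OF sub(1)[OF J] _ f t])
        fix x t assume x: "x \<in> topspace P" "0 \<le> t" "t \<le> (1::real)"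
        have b0: "component I (b, 0) = snd (susp Q)"
          by (rule rel_mapD(2)[OF rel_map_component[OF I] b_in]) auto
        show "component I (quot (x, t)) = component I (x, t)"
          using rel_mapD(2)[OF rel_map_component[OF I] x] b0 by (auto simp: susp_collapse_eq
              cyl_trivial_def snd_PP)
      qed
      also have "\<dots> = cancel_all (sel J) (component I) (retract_all (cosel J) (fill y J), t)" by
          (simp only: rf)
      also have "\<dots> = cancel_all (sel J) (?q J I) (fill y J, t)"
        by (rule cancel_all_retract_all[OF sub(1)[OF J] sub(2,3) f t])
      finally show "presusp (susp Q) (component I) (cancel_all (sel J) quot (fst ((fill y J, t),
          r)), snd ((fill y J, t), r)) = ?F J I ((fill y J, t), r)"
        by (simp add: presusp_def)
    qed
    finally show "theta (kappa ((to_wedge J y, t), r)) = track_sum (snd (susp (susp Q))) (map (?F J)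
        subsets) ((fill y J, t), r)"
      by simp
  qed
  then have "based_homotopic (susp2 Q) (susp2 Q) (\<lambda>p. theta (kappa p)) (presusp (susp Q)
      (susp_collapse Q))"
    by (rule based_homotopic_susp2[OF _ Q_base])
  then show ?thesis
  proof (rule based_homotopic_cong)
    show "snd (susp2 Q) \<in> topspace (fst (susp2 Q))"
      using susp2_Q by (simp add: susp2_def)
    fix p assume "p \<in> topspace (fst (susp2 Q))"
    then obtain x t r where "p = ((x, t), r)" "susp_collapse (susp Q) (susp_collapse Q (x, t), r) = p"
      using susp2_rep[OF Q_base] by metis
    then show "presusp (susp Q) (susp_collapse Q) p = id p" by (simp add: presusp_def)
  qed simp
qed

lemma theta_equivalence: "based_homotopy_equivalence (susp2 PP) (susp2 Q) theta"
  unfolding based_homotopy_equivalence_def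
  using based_map_theta based_map_kappa kappa_theta theta_kappa by blast

end

section \<open>Equivariance\<close>

locale polyhedral_action = ordered_polyhedral_pair X A x0 h u V K vs
  for X :: "'a topology" and A x0 h u and V :: "'v set" and K and vs +
  fixes G :: "('g, 'r) monoid_scheme" and \<phi> :: "'g \<Rightarrow> 'v \<Rightarrow> 'v" and g :: 'g
  assumes action: "group_action G V \<phi>" and g: "g \<in> carrier G"
    and gK: "\<And>\<sigma>. \<sigma> \<in> K \<Longrightarrow> \<phi> g ` \<sigma> \<in> K"
begin

abbreviation ginv :: "'v \<Rightarrow> 'v" where "ginv \<equiv> \<phi> (inv\<^bsub>G\<^esub> g)"

abbreviation perm :: "('v \<Rightarrow> 'a) \<Rightarrow> 'v \<Rightarrow> 'a" where "perm \<equiv> permute_coords G \<phi> g V"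

abbreviation act :: "('v set \<times> ('v \<Rightarrow> 'a)) option \<Rightarrow> ('v set \<times> ('v \<Rightarrow> 'a)) option"
  where "act \<equiv> smash_wedge_action G \<phi> X A x0 K g"

lemma gV: "\<phi> g ` V = V"
  by (rule group_action.surj_prop[OF action g])

lemma ginv_g: "i \<in> V \<Longrightarrow> ginv (\<phi> g i) = i"
  by (rule group_action.orbit_sym_aux[OF action g _ refl])

lemma ginv_in: "i \<in> V \<Longrightarrow> ginv i \<in> V" and g_ginv: "i \<in> V \<Longrightarrow> \<phi> g (ginv i) = i"
proof -
  have "ginv i \<in> V \<and> \<phi> g (ginv i) = i" if "i \<in> V"
  proof -
    have "i \<in> \<phi> g ` V" by (simp only: gV that)
    then obtain k where "k \<in> V" "i = \<phi> g k" by (elim imageE)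
    then show ?thesis using ginv_g[of k] by simp
  qed
  then show "i \<in> V \<Longrightarrow> ginv i \<in> V" "i \<in> V \<Longrightarrow> \<phi> g (ginv i) = i" by simp_all
qed

lemma gJ: "J \<subseteq> V \<Longrightarrow> \<phi> g ` J \<subseteq> V"
  using image_mono[of J V "\<phi> g"] by (simp only: gV)

lemma ginv_image: "J \<subseteq> V \<Longrightarrow> i \<in> \<phi> g ` J \<Longrightarrow> ginv i \<in> J"
  by (elim imageE) (simp add: ginv_g subset_iff)

lemma perm_apply: "i \<in> V \<Longrightarrow> perm x i = x (ginv i)"
  by (simp add: permute_coords_def gV)

lemma perm_in: assumes x: "x \<in> topspace P" shows "perm x \<in> topspace P"
proof -
  obtain I where I: "I \<in> K" "\<forall>i\<in>V - I. x i \<in> A" and xX: "\<forall>i\<in>V. x i \<in> topspace X"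
    using x unfolding in_polyhedral_product by blast
  show ?thesis
    unfolding in_polyhedral_product
  proof (intro conjI bexI[OF _ gK[OF I(1)]] ballI)
    show "perm x \<in> extensional V" by (simp add: permute_coords_def gV)
    show "perm x i \<in> topspace X" if "i \<in> V" for i
      using xX ginv_in[OF that] by (simp add: perm_apply[OF that])
    fix i assume i: "i \<in> V - \<phi> g ` I"
    have "ginv i \<notin> I"
    proof
      assume "ginv i \<in> I"
      then have "\<phi> g (ginv i) \<in> \<phi> g ` I" by (rule imageI)
      then show False using g_ginv[of i] i by simp
    qed
    then have "ginv i \<in> V - I" using ginv_in[of i] i by simp
    then show "perm x i \<in> A" using I(2) perm_apply[of i x] i by simp
  qed
qed

lemma cmap_perm: "continuous_map P P perm"
proof (rule cmap_into_polyhedral_product[OF _ perm_in])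
  fix i assume i: "i \<in> V"
  show "continuous_map P X (\<lambda>x. perm x i)"
    using cmap_polyhedral_coord[OF ginv_in[OF i]] by (simp add: perm_apply[OF i])
qed

lemma perm_b: "perm b = b"
proof (rule ext)
  fix i show "perm b i = b i"
    using ginv_in[of i] by (cases "i \<in> V") (auto simp: permute_coords_def gV)
qed

text \<open>
  \<open>g f_J = f_{gJ} g\<close>, without any homotopy.
\<close>

lemma act_proj:
  assumes J: "J \<subseteq> V" and x: "x \<in> topspace P"
  shows "act (proj J x) = proj (\<phi> g ` J) (perm x)"
proof -
  have pt: "perm x (\<phi> g j) = x j" if "j \<in> J" for j
  proof -
    have "\<phi> g j \<in> V" using gJ[OF J] that by blast
    then show ?thesis using ginv_g[of j] J that by (simp add: perm_apply subset_iff)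
  qed
  note pgJ = proj_eq[OF gJ[OF J] perm_in[OF x]]
  show ?thesis
  proof (cases "J = {} \<or> (\<exists>j\<in>J. x j = x0)")
    case True
    then have "proj J x = None" using proj_eq[OF J x] by simp
    moreover have "\<phi> g ` J = {} \<or> (\<exists>i\<in>\<phi> g ` J. perm x i = x0)" using True pt by auto
    ultimately show ?thesis using pgJ by (simp add: smash_wedge_action_def wedge_map_def)
  next
    case False
    have eq: "permute_coords G \<phi> g J (restrict x J) = restrict (perm x) (\<phi> g ` J)"
    proof (rule ext)
      fix i show "permute_coords G \<phi> g J (restrict x J) i = restrict (perm x) (\<phi> g ` J) i"
      proof (cases "i \<in> \<phi> g ` J")
        case True
        then have "i \<in> V" using gJ[OF J] by blast
        then show ?thesis using True ginv_image[OF J True] by (simp add: permute_coords_def[of G \<phi> g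
            J] perm_apply)
      qed (simp add: permute_coords_def)
    qed
    have no: "\<not> (\<phi> g ` J = {} \<or> (\<exists>i\<in>\<phi> g ` J. perm x i = x0))" using False pt by auto
    obtain j where j: "j \<in> J" using False by blast
    have ne: "restrict (perm x) (\<phi> g ` J) \<noteq> (\<lambda>i\<in>\<phi> g ` J. x0)"
    proof
      assume "restrict (perm x) (\<phi> g ` J) = (\<lambda>i\<in>\<phi> g ` J. x0)"
      from fun_cong[OF this, of "\<phi> g j"] show False using False j pt[OF j] by simp
    qed
    have "proj J x = Some (J, restrict x J)" using proj_eq[OF J x] False by simp
    then have "act (proj J x) = wedge_in (\<lambda>J. polyhedral_smash X A x0 J (full_subcomplex K J)) (\<phi> g
        ` J) (restrict (perm x) (\<phi> g ` J))"
      by (simp add: smash_wedge_action_def wedge_map_def eq)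
    also have "\<dots> = Some (\<phi> g ` J, restrict (perm x) (\<phi> g ` J))"
      using ne by (simp add: wedge_in_def polyhedral_smash_def)
    finally show ?thesis using pgJ no by simp
  qed
qed

lemma image_subsets: "mset (map (\<lambda>J. \<phi> g ` J) subsets) = mset subsets"
proof -
  have inj: "inj_on (\<lambda>J. \<phi> g ` J) (Pow V)"
    by (rule inj_on_image_Pow[OF group_action.inj_prop[OF action g]])
  then have "distinct (map (\<lambda>J. \<phi> g ` J) subsets)"
    using distinct_subsets by (simp add: distinct_map set_subsets)
  moreover have "set (map (\<lambda>J. \<phi> g ` J) subsets) = set subsets"
    using image_Pow_surj[OF gV] by (simp add: set_subsets)
  ultimately show ?thesis
    using distinct_subsets set_eq_iff_mset_eq_distinct by blast
qed

lemma theta_equivariant: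
  "based_homotopic (susp2 PP) (susp2 Q) (susp2_map Q act \<circ> theta) (theta \<circ> susp2_map PP perm)"
proof -
  define N where "N J = presusp (susp Q) (presusp Q (\<lambda>x. proj J (perm x)))" for J
  have N: "rel_map (cyl P) (cyl_trivial P {b}) (susp (susp Q)) (N J)" if J: "J \<subseteq> V" for J
    unfolding N_def
    by (rule rel_map_presusp_of_rel_map[OF rel_map_presusp[OF cmap_compose[OF cmap_proj[OF J]
        cmap_perm]]]) (auto simp: perm_b proj_b[OF J])
  have act_None: "act None = None" by (simp add: smash_wedge_action_def wedge_map_def)
  have susp2_Q: "snd (susp (susp Q)) \<in> topspace (fst (susp (susp Q)))"
    using base_susp[of "susp Q"] base_susp[OF Q_base] by simp
  have base: "susp2_map Q act ((None, 0), 0) = ((None, 0), 0)"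
    using susp_collapse_eq[of "susp Q" "((None, 0), 0)"]
    by (simp add: susp2_map_def susp_map_def act_None susp_collapse_eq cyl_trivial_def)
  have projQ: "proj J x \<in> topspace (fst Q)" if "J \<subseteq> V" "x \<in> topspace P" for J x
    using continuous_map_image_subset_topspace[OF cmap_proj[OF that(1)]] that(2) by blast
  have "rel_homotopic (cyl P) (cyl_trivial P {b}) (susp (susp Q))
      (track_sum (snd (susp (susp Q))) (map N (map (\<lambda>J. \<phi> g ` J) subsets))) (track_sum (snd (susp
          (susp Q))) (map N subsets))"
  proof (rule rel_homotopic_track_sum_mset[OF susp2_Q])
    show "mset (map N (map (\<lambda>J. \<phi> g ` J) subsets)) = mset (map N subsets)"
      by (simp only: mset_map[of N] image_subsets)
    fix F assume "F \<in> set (map N (map (\<lambda>J. \<phi> g ` J) subsets))"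
    then obtain J where "J \<in> set subsets" "F = N (\<phi> g ` J)" by auto
    then show "rel_map (cyl P) (cyl_trivial P {b}) (susp (susp Q)) F"
      using N[OF gJ] set_subsets by simp
  qed
  then have "rel_homotopic (cyl P) (cyl_trivial P {b}) (susp (susp Q)) (\<lambda>p. susp2_map Q act (theta
      p)) (\<lambda>p. theta (susp2_map PP perm p))"
  proof (rule rel_homotopic_cong)
    fix z r assume z: "z \<in> topspace (cyl P)" and r: "0 \<le> r" "r \<le> (1::real)"
    obtain x t where zx: "z = (x, t)" and x: "x \<in> topspace P" and t: "0 \<le> t" "t \<le> 1"
      using z by (cases z) auto
    have "susp2_map Q act (theta (z, r)) = track_sum (susp2_map Q act ((None, 0), 0))
        (map (\<lambda>J p. susp2_map Q act (presusp (susp Q) (component J) p)) subsets) (z, r)"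
      unfolding theta_def track_sum_postcompose[of "susp2_map Q act"] by (simp add: o_def)
    also have "\<dots> = track_sum ((None, 0), 0) (map (\<lambda>J. N (\<phi> g ` J)) subsets) (z, r)"
      unfolding base
    proof (rule track_sum_cong_at[OF _ r])
      fix J and r :: real assume "J \<in> set subsets" and r: "0 \<le> r" "r \<le> 1"
      then have J: "J \<subseteq> V" using set_subsets by simp
      have "act (proj J x) \<in> topspace (fst Q)"
        unfolding act_proj[OF J x] by (rule projQ[OF gJ[OF J] perm_in[OF x]])
      from susp2_map_collapse[where a = act, OF _ projQ[OF J x] this t r Q_base]
      show "susp2_map Q act (presusp (susp Q) (component J) (z, r)) = N (\<phi> g ` J) (z, r)"
        by (simp add: act_None presusp_def component_def N_def zx act_proj[OF J x])
    qed
    finally show "track_sum (snd (susp (susp Q))) (map N (map (\<lambda>J. \<phi> g ` J) subsets)) (z, r) =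
        susp2_map Q act (theta (z, r))"
      by (simp add: o_def)
    have "theta (susp2_map PP perm (z, r)) = theta ((perm x, t), r)"
      using double_collapse[OF _ PP_base perm_in[OF x] t r, of "susp2 Q" theta] rel_map_theta
      by (simp add: snd_PP susp2_map_def susp_map_def zx)
    also have "\<dots> = track_sum ((None, 0), 0) (map (\<lambda>J p. presusp (susp Q) (component J) ((perm (fst
        (fst p)), snd (fst p)), snd p)) subsets) (z, r)"
      using track_sum_precompose[of "((None, 0), 0)" "map (\<lambda>J. presusp (susp Q) (component J))
          subsets" "\<lambda>z. (perm (fst z), snd z)" "(z, r)"]
      by (simp add: theta_def zx o_def)
    also have "\<dots> = track_sum ((None, 0), 0) (map N subsets) (z, r)"
      by (rule track_sum_cong_at[OF _ r]) (simp add: N_def presusp_def component_def)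
    finally show "track_sum (snd (susp (susp Q))) (map N subsets) (z, r) = theta (susp2_map PP perm
        (z, r))" by simp
  qed
  then show ?thesis
    unfolding susp2_def[of Q, symmetric] o_def
    by (intro based_homotopic_susp2[OF _ PP_base]) (simp add: snd_PP)
qed

end

section \<open>The homotopy decomposition\<close>

theorem theorem3p3:
  fixes G :: "('g, 'r) monoid_scheme" and \<phi> :: "'g \<Rightarrow> nat \<Rightarrow> nat"
    and m :: nat and K :: "nat set set"
    and X :: "'a topology" and A :: "'a set" and x0 :: 'a
  assumes "group G" and "finite (carrier G)"
    and "simplicial_G_complex G \<phi> m K"
    and "connected_based_cw_pair X A x0"
  shows "\<exists>\<theta>.
    based_homotopy_equivalence
      (susp2 (polyhedral_product X A x0 {1..m} K)) (susp2 (smash_wedge X A x0 {1..m} K)) \<theta> \<and>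
    (\<forall>g\<in>carrier G.
      based_homotopic
        (susp2 (polyhedral_product X A x0 {1..m} K)) (susp2 (smash_wedge X A x0 {1..m} K))
        (susp2_map (smash_wedge X A x0 {1..m} K) (smash_wedge_action G \<phi> X A x0 K g) \<circ> \<theta>)
        (\<theta> \<circ> susp2_map (polyhedral_product X A x0 {1..m} K) (permute_coords G \<phi> g {1..m})))"
proof -
  obtain h u where hu: "continuous_map (prod_topology \<I> X) X h" "continuous_map X \<I> u" "u x0 = 0"
    "\<And>x. x \<in> topspace X \<Longrightarrow> h (0, x) = x"
    "\<And>x. \<lbrakk>x \<in> topspace X; u x < 1\<rbrakk> \<Longrightarrow> h (1, x) = x0"
    "\<And>s. \<lbrakk>0 \<le> s; s \<le> 1\<rbrakk> \<Longrightarrow> h (s, x0) = x0"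
    "\<And>s x. \<lbrakk>0 \<le> s; s \<le> 1; x \<in> A\<rbrakk> \<Longrightarrow> h (s, x) \<in> A"
    "Hausdorff_space X" "closedin X A" "x0 \<in> A" "A \<subseteq> topspace X"
    using cw_pair_contraction[OF assms(4)] by blast
  note cpx = assms(3)[unfolded simplicial_G_complex_def]
  interpret ordered_polyhedral_pair X A x0 h u "{1..m}" K "[1..<Suc m]"
    by unfold_locales (use hu cpx in auto)
  have "based_homotopic (susp2 PP) (susp2 Q) (susp2_map Q (smash_wedge_action G \<phi> X A x0 K g) \<circ> theta)
      (theta \<circ> susp2_map PP (permute_coords G \<phi> g {1..m}))" if g: "g \<in> carrier G" for g
  proof -
    have "polyhedral_action X A x0 h u {1..m} K [1..<Suc m] G \<phi> g"
    proof (rule polyhedral_action.intro)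
      show "polyhedral_action_axioms {1..m} K G \<phi> g"
        unfolding polyhedral_action_axioms_def using cpx g by blast
    qed (rule ordered_polyhedral_pair_axioms)
    then show ?thesis by (rule polyhedral_action.theta_equivariant)
  qed
  then show ?thesis using theta_equivalence by blast
qed

end
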